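(* Let $\mathfrak X$ be a compact metric space with distance $d_{\mathfrak X}$, $E$ a separable Banach space, $\{\mathfrak p(U;\cdot)\}_{U\in\mathfrak X}$ a transition probability from $\mathfrak X$ to $E$, $\mathcal K\subset E$ a compact set, and $\mathcal S:\mathfrak X\times\mathcal K\to\mathfrak X$ a Lipschitz-continuous map. Suppose that Hypotheses (DN), (GCP), (LAC) and (DLP) stated in the context are fulfilled. Then the Markov process associated with the random dynamical system $U_k=\mathcal S(U_{k-1},\zeta_k^{U_{k-1}})$, $k\ge1$, has a unique stationary measure $\boldsymbol\mu\in\mathcal P(\mathfrak X)$, and there are positive numbers $C$ and $\gamma$ such that $$\|P_k(U;\cdot)-\boldsymbol\mu\|_L^*\le Ce^{-\gamma k}\quad\text{for any }U\in\mathfrak X,\ k\ge0.$$ Moreover, if $\{V_k,k\ge0\}$ is a stationary trajectory of this Markov process, $\mathcal D(V_k)\equiv\boldsymbol\mu$, and $\boldsymbol\mu_s=\mathcal D(V_1,\dots,V_s)$, then for any integer $s\ge1$ there is $C_s>0$ such that $$\|\mathcal D(U_k,\dots,U_{k+s})-\boldsymbol\mu_{s+1}\|_L^*\le C_se^{-\gamma k}\quad\text{for any }U\in\mathfrak X,\ k\ge0,$$ where $\{U_k\}$ is the trajectory of the system issued from $U$.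
   Context: Notation. $\mathcal P(Y)$ is the set of Borel probability measures on $Y$; $\mathcal D(\cdot)$ is the law of a random variable; $\|\mu-\nu\|_{\mathrm{var}}=\sup_\Gamma|\mu(\Gamma)-\nu(\Gamma)|$ is the total variation distance; $\|\mu-\nu\|_L^*=\sup|\langle f,\mu\rangle-\langle f,\nu\rangle|$, the supremum being over Lipschitz $f$ with $|f|\le1$, $\operatorname{Lip}(f)\le1$ (finite products of metric spaces carry the sum of the distances). A transition probability from $\mathfrak X$ to $E$ is a family of Borel probability measures $\mathfrak p(U;\cdot)$ on $E$ such that $U\mapsto\mathfrak p(U;\Gamma)$ is measurable for every Borel $\Gamma\subset E$. The system. $\{\zeta_k^U,U\in\mathfrak X\}_{k\ge1}$ are independent $\mathcal K$-valued random fields, measurable in $(U,\omega)$, with $\mathcal D(\zeta_k^U)=\mathfrak p(U;\cdot)$ for all $U,k$, and independent of the initial state $U_0$. The trajectories of $U_k=\mathcal S(U_{k-1},\zeta_k^{U_{k-1}})$ form a Markov process in $\mathfrak X$ with time-1 transition probability $P_1(U;\cdot)$ equal to the image of $\mathfrak p(U;\cdot)$ under $\eta\mapsto\mathcal S(U,\eta)$; $P_k(U;\cdot)$ denotes the time-$k$ transition probability. (DN) The map $U\mapsto\mathfrak p(U;\cdot)$ is continuous from $\mathfrak X$ to $\mathcal P(E)$ with the weak topology; $\operatorname{supp}\mathfrak p(U;\cdot)\subset\mathcal K$ for any $U\in\mathfrak X$; and there is $C>0$ such that $\|\mathfrak p(U;\cdot)-\mathfrak p(U';\cdot)\|_{\mathrm{var}}\le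 C\,d_{\mathfrak X}(U,U')$ for $U,U'\in\mathfrak X$. (GCP) For any $\varepsilon>0$ there are an integer $m\ge1$ and a point $\widehat U\in\mathfrak X$ (both depending on $\varepsilon$) such that for any $U\in\mathfrak X$ there are $\xi_1,\dots,\xi_m\in\mathcal K$ for which the points $U_0=U$, $U_k=\mathcal S(U_{k-1},\xi_k)$ $(1\le k\le m)$ satisfy $\xi_k\in\operatorname{supp}\mathfrak p(U_{k-1};\cdot)$ for $1\le k\le m$ and $d_{\mathfrak X}(U_m,\widehat U)<\varepsilon$. For $\delta>0$ let $D_\delta=\{(U,U')\in\mathfrak X\times\mathfrak X:d_{\mathfrak X}(U,U')\le\delta\}$. For $\varPhi:\mathcal K\to E$ let $\operatorname{Lip}_\xi(\varPhi)=\sup\|\varPhi(\xi_1)-\varPhi(\xi_2)\|_E/\|\xi_1-\xi_2\|_E$ over $\xi_1,\xi_2\in\mathcal K$ with $0<\|\xi_1-\xi_2\|_E\le1$. (LAC) There are positive numbers $C_*,\delta$ and $q<1$, a finite-dimensional subspace $F\subset E$, and a continuous map $\varPhi:D_\delta\times\mathcal K\to F$ such that for any $(U,U')\in D_\delta$ $$\sup_{\xi\in\mathcal K}\|\varPhi(U,U',\xi)\|_E+\operatorname{Lip}_\xi(\varPhi(U,U',\cdot))\le C_*d_{\mathfrak X}(U,U'),$$ $$\sup_{\xi\in\mathcal K}d_{\mathfrak X}\bigl(\mathcal S(U,\xi),\mathcal S(U',\xi+\varPhi(U,U',\xi))\bigr)\le q\,d_{\mathfrak X}(U,U').$$ (DLP)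 The subspace $F$ in (LAC) has a closed complementary subspace $F^\dagger\subset E$ ($E=F\dotplus F^\dagger$) such that $\mathfrak p(U;\cdot)$ admits the disintegration $$\mathfrak p(U;d\xi_F,d\xi_{F^\dagger})=\mathfrak p_{F^\dagger}(U;d\xi_{F^\dagger})\,\mathfrak p_F(U,\xi_{F^\dagger};d\xi_F),\quad U\in\mathfrak X,$$ where $\mathfrak p_{F^\dagger}(U;\cdot)$ is the projection of $\mathfrak p(U;\cdot)$ to $F^\dagger$ and $\mathfrak p_F(U,\xi_{F^\dagger};\cdot)\in\mathcal P(F)$ is the regular conditional probability given that the projection to $F^\dagger$ equals $\xi_{F^\dagger}$. Moreover there are $M>0$ and $p_F:\mathfrak X\times E\to\mathbb R_+$ with $|p_F(U,\xi)-p_F(U',\xi')|\le M(d_{\mathfrak X}(U,U')+\|\xi-\xi'\|_E)$ for all $U,U'\in\mathfrak X$, $\xi,\xi'\in E$, such that $\mathfrak p_F(U,\xi_{F^\dagger};d\xi_F)=p_F(U,\xi_{F^\dagger},\xi_F)\,\ell_F(d\xi_F)$ for any $U\in\mathfrak X$, $\xi_{F^\dagger}\in F^\dagger$, where $\ell_F$ is Lebesgue measure on $F$. *)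

theory Defs
  imports "HOL-Probability.Probability"
begin

text \<open>
  The compact metric space is a type \<open>'x\<close> with \<open>compact UNIV\<close>, and the separable Banach space is a
  type \<open>'e\<close> of sorts \<open>banach\<close> and \<open>second_countable_topology\<close>.  The sort
  \<open>second_countable_topology\<close> on \<open>'x\<close> is no restriction, since a compact metric space is second
  countable; it makes the library results on Borel sets of products available.

  The map \<open>S :: 'x \<Rightarrow> 'e \<Rightarrow> 'x\<close> is total for typing reasons only: no definition below depends on its
  values \<open>S U \<xi>\<close> for \<open>\<xi> \<notin> K\<close>.
\<close>

subsection \<open>Measures\<close>

definition tv_dist :: "'a measure \<Rightarrow> 'a measure \<Rightarrow> real" where
  "tv_dist \<mu> \<nu> = (SUP \<Gamma>\<in>sets \<mu>. \<bar>measure \<mu> \<Gamma> - measure \<nu> \<Gamma>\<bar>)"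

text \<open>
  The metric \<open>d\<close> is a parameter, because a product of \<open>n\<close> copies of a space is the carrier of a
  \<open>PiM\<close> measure and not a type.  For measures on separable metric spaces the admissible functions
  are automatically measurable.
\<close>

definition dual_lip_dist :: "('a \<Rightarrow> 'a \<Rightarrow> real) \<Rightarrow> 'a measure \<Rightarrow> 'a measure \<Rightarrow> real" where
  "dual_lip_dist d \<mu> \<nu> =
     (SUP f\<in>{f :: 'a \<Rightarrow> real. (\<forall>x\<in>space \<mu>. \<bar>f x\<bar> \<le> 1) \<and>
                            (\<forall>x\<in>space \<mu>. \<forall>y\<in>space \<mu>. \<bar>f x - f y\<bar> \<le> d x y)}.
        \<bar>(\<integral>x. f x \<partial>\<mu>) - (\<integral>x. f x \<partial>\<nu>)\<bar>)"

definition sum_dist :: "nat \<Rightarrow> (nat \<Rightarrow> 'a::metric_space) \<Rightarrow> (nat \<Rightarrow> 'a) \<Rightarrow> real" where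
  "sum_dist n x y = (\<Sum>i<n. dist (x i) (y i))"

definition measure_supp :: "'a::topological_space measure \<Rightarrow> 'a set" where
  "measure_supp \<mu> = {x. \<forall>G. open G \<and> x \<in> G \<longrightarrow> emeasure \<mu> G > 0}"

text \<open>Continuity for the weak topology, the coarsest one making \<open>\<mu> \<mapsto> \<integral>f d\<mu>\<close> continuous for all
  bounded continuous \<open>f\<close>.\<close>

definition weakly_continuous :: "('x::topological_space \<Rightarrow> 'e::topological_space measure) \<Rightarrow> bool" where
  "weakly_continuous p \<longleftrightarrow>
     (\<forall>f :: 'e \<Rightarrow> real. continuous_on UNIV f \<and> bounded (range f) \<longrightarrow>
        continuous_on UNIV (\<lambda>U. \<integral>\<xi>. f \<xi> \<partial>p U))"


subsection \<open>The random dynamical system and its Markov process\<close>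

text \<open>The fields \<open>\<zeta> k\<close>, \<open>k \<ge> 1\<close>, are independent of each other and of \<open>U0\<close>, as measurable random
  fields: there are independent \<open>\<sigma>\<close>-algebras \<open>\<F> 0, \<F> 1, \<dots>\<close> such that \<open>U0\<close> is \<open>\<F> 0\<close>-measurable and
  \<open>(U, \<omega>) \<mapsto> \<zeta> k U \<omega>\<close> is measurable for the product of the Borel sets with \<open>\<F> k\<close>.  Independence of
  the \<open>\<sigma>\<close>-algebras generated by the single variables \<open>\<zeta> k U\<close> would not be enough for
  \<open>U\<^sub>k = S U\<^sub>k\<^sub>-\<^sub>1 (\<zeta> k U\<^sub>k\<^sub>-\<^sub>1)\<close> to be a Markov process: \<open>\<zeta> 2 U\<close> may vanish almost surely for every
  fixed \<open>U\<close> and yet differ from 0 at the random point \<open>U\<^sub>1\<close>.\<close>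

definition random_fields ::
    "'w measure \<Rightarrow> ('x::topological_space \<Rightarrow> 'e::topological_space measure) \<Rightarrow> 'e set \<Rightarrow>
     (nat \<Rightarrow> 'x \<Rightarrow> 'w \<Rightarrow> 'e) \<Rightarrow> ('w \<Rightarrow> 'x) \<Rightarrow> bool" where
  "random_fields M p K \<zeta> U0 \<longleftrightarrow> prob_space M \<and>
     (\<exists>\<F> :: nat \<Rightarrow> 'w measure.
        (\<forall>k. subalgebra M (\<F> k)) \<and> prob_space.indep_sets M (\<lambda>k. sets (\<F> k)) UNIV \<and>
        U0 \<in> \<F> 0 \<rightarrow>\<^sub>M borel \<and>
        (\<forall>k\<ge>1. (\<lambda>(U, \<omega>). \<zeta> k U \<omega>) \<in> borel \<Otimes>\<^sub>M \<F> k \<rightarrow>\<^sub>M borel \<and>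
               (\<forall>U. \<forall>\<omega>\<in>space M. \<zeta> k U \<omega> \<in> K) \<and>
               (\<forall>U. distr M borel (\<zeta> k U) = p U)))"

primrec trajectory ::
    "('x \<Rightarrow> 'e \<Rightarrow> 'x) \<Rightarrow> (nat \<Rightarrow> 'x \<Rightarrow> 'w \<Rightarrow> 'e) \<Rightarrow> ('w \<Rightarrow> 'x) \<Rightarrow> nat \<Rightarrow> 'w \<Rightarrow> 'x" where
  "trajectory S \<zeta> U0 0 \<omega> = U0 \<omega>"
| "trajectory S \<zeta> U0 (Suc k) \<omega> =
     S (trajectory S \<zeta> U0 k \<omega>) (\<zeta> (Suc k) (trajectory S \<zeta> U0 k \<omega>) \<omega>)"

text \<open>The law of \<open>(V\<^sub>k, \<dots>, V\<^sub>k\<^sub>+\<^sub>n\<^sub>-\<^sub>1)\<close>.\<close>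

definition segment_law ::
    "'w measure \<Rightarrow> (nat \<Rightarrow> 'w \<Rightarrow> 'x::topological_space) \<Rightarrow> nat \<Rightarrow> nat \<Rightarrow> (nat \<Rightarrow> 'x) measure" where
  "segment_law M V k n =
     distr M (PiM {..<n} (\<lambda>_. borel)) (\<lambda>\<omega>. \<lambda>i\<in>{..<n}. V (k + i) \<omega>)"

text \<open>\<open>p U\<close> is restricted to \<open>K\<close>, where \<open>S U\<close> lives, before taking the image.\<close>

definition P1 ::
    "('x::topological_space \<Rightarrow> 'e \<Rightarrow> 'x) \<Rightarrow> ('x \<Rightarrow> 'e measure) \<Rightarrow> 'e set \<Rightarrow> 'x \<Rightarrow> 'x measure" where
  "P1 S p K U = distr (restrict_space (p U) K) borel (S U)"

primrec Pk ::
    "('x::topological_space \<Rightarrow> 'e \<Rightarrow> 'x) \<Rightarrow> ('x \<Rightarrow> 'e measure) \<Rightarrow> 'e set \<Rightarrow> nat \<Rightarrow> 'x \<Rightarrow> 'x measure" where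
  "Pk S p K 0 U = return borel U"
| "Pk S p K (Suc k) U = Pk S p K k U \<bind> P1 S p K"

definition stationary_measure ::
    "('x::topological_space \<Rightarrow> 'e \<Rightarrow> 'x) \<Rightarrow> ('x \<Rightarrow> 'e measure) \<Rightarrow> 'e set \<Rightarrow> 'x measure \<Rightarrow> bool" where
  "stationary_measure S p K \<mu> \<longleftrightarrow> \<mu> \<in> space (prob_algebra borel) \<and> \<mu> \<bind> P1 S p K = \<mu>"


subsection \<open>Hypotheses\<close>

definition DN ::
    "('x::metric_space \<Rightarrow> 'e::real_normed_vector measure) \<Rightarrow> 'e set \<Rightarrow> bool" where
  "DN p K \<longleftrightarrow> weakly_continuous p \<and> (\<forall>U. measure_supp (p U) \<subseteq> K) \<and>
     (\<exists>C>0. \<forall>U U'. tv_dist (p U) (p U') \<le> C * dist U U')"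

definition GCP ::
    "('x::metric_space \<Rightarrow> 'e \<Rightarrow> 'x) \<Rightarrow> ('x \<Rightarrow> 'e::real_normed_vector measure) \<Rightarrow> 'e set \<Rightarrow> bool" where
  "GCP S p K \<longleftrightarrow>
     (\<forall>\<epsilon>>0. \<exists>m\<ge>1. \<exists>U_hat. \<forall>U. \<exists>\<xi> :: nat \<Rightarrow> 'e. \<exists>u :: nat \<Rightarrow> 'x.
        u 0 = U \<and>
        (\<forall>k\<in>{1..m}. \<xi> k \<in> K \<and> u k = S (u (k - 1)) (\<xi> k) \<and> \<xi> k \<in> measure_supp (p (u (k - 1)))) \<and>
        dist (u m) U_hat < \<epsilon>)"

text \<open>Suprema are taken in \<open>[0, \<infinity>]\<close>, so that they are 0 over the empty set and \<open>\<infinity>\<close> when unbounded.\<close>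

definition Lip_on :: "'e set \<Rightarrow> ('e::real_normed_vector \<Rightarrow> 'e) \<Rightarrow> ennreal" where
  "Lip_on K \<phi> =
     (SUP (\<xi>1, \<xi>2)\<in>{(\<xi>1, \<xi>2). \<xi>1 \<in> K \<and> \<xi>2 \<in> K \<and> 0 < norm (\<xi>1 - \<xi>2) \<and> norm (\<xi>1 - \<xi>2) \<le> 1}.
        ennreal (norm (\<phi> \<xi>1 - \<phi> \<xi>2) / norm (\<xi>1 - \<xi>2)))"

text \<open>As \<open>S\<close> is defined on \<open>K\<close> only, the last supremum is over those \<open>\<xi> \<in> K\<close> for which
  \<open>S U' (\<xi> + \<Phi> U U' \<xi>)\<close> makes sense, that is, for which \<open>\<xi> + \<Phi> U U' \<xi>\<close> is again in \<open>K\<close>.  If the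
  shift maps \<open>K\<close> to itself, this is the supremum over all of \<open>K\<close>.\<close>

definition LAC ::
    "('x::metric_space \<Rightarrow> 'e \<Rightarrow> 'x) \<Rightarrow> 'e::real_normed_vector set \<Rightarrow> 'e set \<Rightarrow> bool" where
  "LAC S K F \<longleftrightarrow> (\<exists>B. finite B \<and> F = span B) \<and>
     (\<exists>C>0. \<exists>\<delta>>0. \<exists>q>0. q < 1 \<and> (\<exists>\<Phi> :: 'x \<Rightarrow> 'x \<Rightarrow> 'e \<Rightarrow> 'e.
        continuous_on ({(U, U'). dist U U' \<le> \<delta>} \<times> K) (\<lambda>((U, U'), \<xi>). \<Phi> U U' \<xi>) \<and>
        (\<forall>U U'. dist U U' \<le> \<delta> \<longrightarrow>
           (\<forall>\<xi>\<in>K. \<Phi> U U' \<xi> \<in> F) \<and>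
           (SUP \<xi>\<in>K. ennreal (norm (\<Phi> U U' \<xi>))) + Lip_on K (\<Phi> U U') \<le> ennreal (C * dist U U') \<and>
           (SUP \<xi>\<in>{\<xi>\<in>K. \<xi> + \<Phi> U U' \<xi> \<in> K}. ennreal (dist (S U \<xi>) (S U' (\<xi> + \<Phi> U U' \<xi>))))
             \<le> ennreal (q * dist U U'))))"

text \<open>The component in \<open>G\<close> of \<open>x\<close> in a direct sum of \<open>G\<close> and \<open>H\<close>.\<close>

definition proj_along :: "'e set \<Rightarrow> 'e set \<Rightarrow> 'e::real_vector \<Rightarrow> 'e" where
  "proj_along G H x = (THE y. y \<in> G \<and> x - y \<in> H)"

text \<open>Lebesgue measure on the span of a finite independent set \<open>B\<close>, which is identified with \<open>\<real>\<^sup>B\<close>.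
  Another basis of the same subspace changes it by a positive factor only, which the density in
  \<open>DLP\<close> absorbs.\<close>

definition lebesgue_span :: "'e set \<Rightarrow> 'e::real_normed_vector measure" where
  "lebesgue_span B =
     distr (PiM B (\<lambda>_. lborel :: real measure)) (restrict_space borel (span B))
       (\<lambda>c. \<Sum>b\<in>B. c b *\<^sub>R b)"

text \<open>\<open>F'\<close> is the closed complement of \<open>F\<close>, \<open>\<kappa> U \<eta>\<close> is the conditional law of the component in \<open>F\<close>
  given that the component in \<open>F'\<close> is \<open>\<eta>\<close>, and \<open>\<rho> U\<close> is the density, a function of
  \<open>\<xi> = \<eta> + y\<close> with \<open>\<eta> \<in> F'\<close> and \<open>y \<in> F\<close>.\<close>

definition DLP ::
    "('x::metric_space \<Rightarrow> 'e::real_normed_vector measure) \<Rightarrow> 'e set \<Rightarrow> bool" where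
  "DLP p F \<longleftrightarrow>
     (\<exists>F' B (\<kappa> :: 'x \<Rightarrow> 'e \<Rightarrow> 'e measure) (\<rho> :: 'x \<Rightarrow> 'e \<Rightarrow> real) M.
        subspace F' \<and> closed F' \<and> F \<inter> F' = {0} \<and> (\<forall>x. \<exists>y\<in>F. \<exists>z\<in>F'. x = y + z) \<and>
        finite B \<and> independent B \<and> span B = F \<and>
        (\<forall>U. \<kappa> U \<in> restrict_space borel F' \<rightarrow>\<^sub>M prob_algebra (restrict_space borel F)) \<and>
        (\<forall>U. p U = distr (p U) (restrict_space borel F') (proj_along F' F) \<bind>
                     (\<lambda>\<eta>. distr (\<kappa> U \<eta>) borel (\<lambda>y. \<eta> + y))) \<and>
        (\<forall>U \<xi>. 0 \<le> \<rho> U \<xi>) \<and> M > 0 \<and>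
        (\<forall>U U' \<xi> \<xi>'. \<bar>\<rho> U \<xi> - \<rho> U' \<xi>'\<bar> \<le> M * (dist U U' + norm (\<xi> - \<xi>'))) \<and>
        (\<forall>U. \<forall>\<eta>\<in>F'. \<kappa> U \<eta> = density (lebesgue_span B) (\<lambda>y. ennreal (\<rho> U (\<eta> + y)))))"

end

theory Submission
  imports Defs
begin

text \<open>Everything is done on the dual side, with the Markov operator \<open>P\<close> acting on Lipschitz functions.  Under
  (LAC) a shift of the noise by \<open>\<Phi> U U'\<close> makes the trajectories from \<open>U\<close> and \<open>U'\<close> approach each other by the
  factor \<open>q\<close>, and by (DN) and (DLP) the shifted law differs from \<open>p U'\<close> in variation by \<open>O(dist U U')\<close>.  Hence
  a function with Lipschitz constant \<open>L\<close> and oscillation \<open>w\<close> is mapped by \<open>P\<close> to one with Lipschitz constant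
  \<open>q * L + C * w\<close>.  By (GCP) and compactness all points reach a small ball around \<open>U_hat\<close> with probability
  bounded below, so that some iterate of \<open>P\<close> decreases the oscillation up to a small multiple of \<open>L\<close>.  The
  two estimates combine to a contraction of \<open>w + \<beta> * L\<close>.  The iterates of \<open>P\<close> thus converge exponentially
  to a positive functional on Lipschitz functions, which is represented by the stationary measure.
  Finally, integrating out the last coordinates by the Markov property turns a Lipschitz function of
  a trajectory segment into a Lipschitz function of its first point.\<close>

subsection \<open>Comparison of integrals\<close>

text \<open>Two obstacles shape the estimate of the shifted law. The shift
  \<open>\<Phi> U U'\<close> is only Lipschitz in the noise, so there is no Jacobian; and it may
  carry points of \<open>K\<close> out of \<open>K\<close>, where \<open>S\<close> says nothing. The
  first is met by comparing measures of sets in one direction only: the shifted law of a set exceeds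
  its \<open>p U\<close>-measure by at most a multiple of the size of the shift. For compact sets
  this is a volume count for a map with Lipschitz inverse, for Borel sets it follows by inner
  regularity. One direction is enough, because it already compares the integrals of functions with
  values in \<open>[0, w]\<close>, and \<open>U\<close> and \<open>U'\<close> may be exchanged. The
  second is met by the same bound: \<open>p U'\<close> gives no mass to the complement of
  \<open>K\<close>, so the shifted law gives it mass \<open>O(dist U U')\<close>, which is charged
  to the oscillation. No coupling of trajectories is built. A pair of bounds, one for the Lipschitz
  constant and one for the oscillation, records what a coupling would give, and it is propagated
  through the iterates of \<open>P\<close>.\<close>

text \<open>The sum counts the integers \<open>j < n\<close> below \<open>y\<close>. It acts as a
  discrete layer cake: with \<open>y = n * h x\<close> it replaces \<open>h\<close> by its level
  sets, up to an error of 1 in \<open>n\<close>.\<close>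

lemma sum_steps_bounds:
  fixes y :: real
  assumes "0 \<le> y"
  shows "min y (real n) \<le> (\<Sum>j<n. of_bool (real j < y))" "(\<Sum>j<n. of_bool (real j < y)) \<le> y + 1"
proof -
  \<comment> \<open>The cap \<open>real n\<close> in the upper bound carries the induction: if
    \<open>real n < y\<close>, the new term raises the sum to at most \<open>n + 1\<close>, which is
    below \<open>y + 1\<close>.\<close>
  have "min y (real n) \<le> (\<Sum>j<n. of_bool (real j < y)) \<and>
        (\<Sum>j<n. of_bool (real j < y)) \<le> min (y + 1) (real n)"
    by (induction n) (use assms in \<open>auto simp: min_def split: if_splits\<close>)
  then show "min y (real n) \<le> (\<Sum>j<n. of_bool (real j < y))" "(\<Sum>j<n. of_bool (real j < y)) \<le> y + 1"
    by auto
qed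

lemma le_if_le_add_inverse:
  fixes a b :: real
  assumes "\<And>n. a \<le> b + c / real (Suc n)"
  shows "a \<le> b"
proof (rule LIMSEQ_le_const)
  show "(\<lambda>n. b + c / real (Suc n)) \<longlonglongrightarrow> b"
    using tendsto_add[OF tendsto_const[of b] tendsto_mult[OF tendsto_const[of c] LIMSEQ_inverse_real_of_nat]]
    by (simp add: divide_inverse)
qed (use assms in auto)

lemma integral_step_bounds:
  fixes h :: "'a \<Rightarrow> real"
  assumes "prob_space \<mu>" and h: "h \<in> borel_measurable \<mu>" and h01: "\<And>x. x \<in> space \<mu> \<Longrightarrow> 0 \<le> h x \<and> h x \<le> 1"
  shows "real n * (\<integral>x. h x \<partial>\<mu>) \<le> (\<Sum>j<n. measure \<mu> {x \<in> space \<mu>. real j < real n * h x})"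
    and "(\<Sum>j<n. measure \<mu> {x \<in> space \<mu>. real j < real n * h x}) \<le> real n * (\<integral>x. h x \<partial>\<mu>) + 1"
proof -
  interpret prob_space \<mu> by fact
  let ?A = "\<lambda>j. {x \<in> space \<mu>. real j < real n * h x}"
  let ?s = "\<lambda>x. \<Sum>j<n. of_bool (real j < real n * h x) :: real"
  have [measurable]: "h \<in> borel_measurable \<mu>" by fact
  have inth: "integrable \<mu> h"
    by (rule integrable_const_bound[where B=1]) (use h01 in auto)
  have ints: "integrable \<mu> (\<lambda>x. of_bool (real j < real n * h x) :: real)" for j :: nat
    by (rule integrable_const_bound[where B=1]) auto
  have ints': "integrable \<mu> ?s" by (intro Bochner_Integration.integrable_sum ints)
  have "(\<integral>x. of_bool (real j < real n * h x) \<partial>\<mu>) = measure \<mu> (?A j)" for j :: nat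
  proof -
    have "(\<integral>x. of_bool (real j < real n * h x) \<partial>\<mu>) = (\<integral>x. (indicator (?A j) x :: real) \<partial>\<mu>)"
      by (intro Bochner_Integration.integral_cong) (auto simp: indicator_def)
    moreover have "?A j \<in> sets \<mu>" by measurable
    ultimately show ?thesis by (simp add: Int_absorb2)
  qed
  then have eq: "(\<integral>x. ?s x \<partial>\<mu>) = (\<Sum>j<n. measure \<mu> (?A j))"
    by (subst Bochner_Integration.integral_sum) (simp_all only: ints)
  have le: "real n * h x \<le> ?s x \<and> ?s x \<le> real n * h x + 1" if "x \<in> space \<mu>" for x
    using sum_steps_bounds[of "real n * h x" n] h01[OF that] by (simp add: mult_left_le)
  have "(\<integral>x. real n * h x \<partial>\<mu>) \<le> (\<integral>x. ?s x \<partial>\<mu>)"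
    using inth ints' le by (intro integral_mono) auto
  then show "real n * (\<integral>x. h x \<partial>\<mu>) \<le> (\<Sum>j<n. measure \<mu> (?A j))" using eq by simp
  have "(\<integral>x. ?s x \<partial>\<mu>) \<le> (\<integral>x. real n * h x + 1 \<partial>\<mu>)"
    using inth ints' le by (intro integral_mono) auto
  then show "(\<Sum>j<n. measure \<mu> (?A j)) \<le> real n * (\<integral>x. h x \<partial>\<mu>) + 1"
    using eq inth by (simp add: prob_space)
qed

text \<open>Each of the \<open>n\<close> level sets of \<open>h / w\<close> costs \<open>c\<close>,
  which after division by \<open>n\<close> is a single \<open>c\<close>; the rounding error
  \<open>1 / n\<close> vanishes in the limit.\<close>

lemma integral_le_add_of_measure_le_add:
  fixes h :: "'a \<Rightarrow> real"
  assumes \<mu>: "prob_space \<mu>" and \<nu>: "prob_space \<nu>" and sets: "sets \<nu> = sets \<mu>"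
    and le: "\<And>A. A \<in> sets \<mu> \<Longrightarrow> measure \<mu> A \<le> measure \<nu> A + c"
    and h: "h \<in> borel_measurable \<mu>" and hw: "\<And>x. x \<in> space \<mu> \<Longrightarrow> 0 \<le> h x \<and> h x \<le> w"
  shows "(\<integral>x. h x \<partial>\<mu>) \<le> (\<integral>x. h x \<partial>\<nu>) + c * w"
proof -
  have sp: "space \<nu> = space \<mu>" using sets by (rule sets_eq_imp_space_eq)
  have h\<nu>: "h \<in> borel_measurable \<nu>" using h sets by (simp cong: measurable_cong_sets)
  interpret \<mu>: prob_space \<mu> by fact
  obtain x0 where x0: "x0 \<in> space \<mu>" using \<mu>.not_empty by auto
  have w0: "0 \<le> w" using hw[OF x0] by auto
  show ?thesis
  proof (cases "w = 0")
    case True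
    then have "(\<integral>x. h x \<partial>\<mu>) = 0" "(\<integral>x. h x \<partial>\<nu>) = 0"
      using hw sp by (auto intro!: integral_eq_zero_AE AE_I2 simp: antisym)
    then show ?thesis using True by simp
  next
    case False
    then have w: "0 < w" using w0 by auto
    let ?h = "\<lambda>x. h x / w"
    have hm: "?h \<in> borel_measurable \<mu>" "?h \<in> borel_measurable \<nu>" using h h\<nu> by auto
    have h01: "0 \<le> ?h x \<and> ?h x \<le> 1" if "x \<in> space \<mu>" for x using hw[OF that] w by simp
    have "(\<integral>x. ?h x \<partial>\<mu>) \<le> ((\<integral>x. ?h x \<partial>\<nu>) + c) + 1 / real (Suc n)" for n
    proof -
      have A: "{x \<in> space \<mu>. real j < real (Suc n) * ?h x} \<in> sets \<mu>" for j
        using hm(1) by measurable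
      have "real (Suc n) * (\<integral>x. ?h x \<partial>\<mu>) \<le> (\<Sum>j<Suc n. measure \<mu> {x \<in> space \<mu>. real j < real (Suc n) * ?h x})"
        by (rule integral_step_bounds(1)[OF \<mu> hm(1) h01])
      also have "\<dots> \<le> (\<Sum>j<Suc n. measure \<nu> {x \<in> space \<mu>. real j < real (Suc n) * ?h x} + c)"
        by (intro sum_mono le A)
      also have "\<dots> = (\<Sum>j<Suc n. measure \<nu> {x \<in> space \<nu>. real j < real (Suc n) * ?h x}) + real (Suc n) * c"
        unfolding sp by (simp add: sum.distrib del: sum.lessThan_Suc)
      also have "\<dots> \<le> real (Suc n) * (\<integral>x. ?h x \<partial>\<nu>) + 1 + real (Suc n) * c"
        using integral_step_bounds(2)[OF \<nu> hm(2), of "Suc n"] h01 sp by simp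
      also have "\<dots> = real (Suc n) * ((\<integral>x. ?h x \<partial>\<nu>) + c + 1 / real (Suc n))"
        by (simp add: field_simps)
      finally show ?thesis by (simp only: mult_le_cancel_left_pos of_nat_0_less_iff zero_less_Suc)
    qed
    then have "(\<integral>x. ?h x \<partial>\<mu>) \<le> (\<integral>x. ?h x \<partial>\<nu>) + c" by (rule le_if_le_add_inverse)
    then show ?thesis using w by (simp add: field_simps)
  qed
qed

subsection \<open>Positive functionals on Lipschitz functions\<close>

lemma lipschitz_on_max:
  fixes f g :: "'a::metric_space \<Rightarrow> real"
  assumes "L-lipschitz_on A f" "M-lipschitz_on A g"
  shows "(max L M)-lipschitz_on A (\<lambda>x. max (f x) (g x))"
proof (rule lipschitz_onI)
  fix x y assume "x \<in> A" "y \<in> A"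
  then have "dist (f x) (f y) \<le> L * dist x y" "dist (g x) (g y) \<le> M * dist x y"
    using assms by (auto dest: lipschitz_onD)
  moreover have "L * dist x y \<le> max L M * dist x y" "M * dist x y \<le> max L M * dist x y"
    by (auto intro!: mult_right_mono)
  ultimately show "dist (max (f x) (g x)) (max (f y) (g y)) \<le> max L M * dist x y"
    unfolding dist_real_def by linarith
qed (use assms lipschitz_on_nonneg in \<open>auto simp: max_def\<close>)

lemma lipschitz_on_min:
  fixes f g :: "'a::metric_space \<Rightarrow> real"
  assumes "L-lipschitz_on A f" "M-lipschitz_on A g"
  shows "(max L M)-lipschitz_on A (\<lambda>x. min (f x) (g x))"
  using lipschitz_on_minus[OF lipschitz_on_max[OF lipschitz_on_minus[OF assms(1)] lipschitz_on_minus[OF assms(2)]]]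
  by (simp only: minus_max_eq_min minus_minus)

text \<open>Dini's argument: the sets where the limit exceeds \<open>f n\<close> by less than
  \<open>e\<close> are open, increase with \<open>n\<close> and cover the space.\<close>

lemma compact_increasing_limit_uniform:
  fixes f :: "nat \<Rightarrow> 'a::topological_space \<Rightarrow> real"
  assumes "compact (UNIV :: 'a set)" and f: "\<And>n. continuous_on UNIV (f n)" and g: "continuous_on UNIV g"
    and mono: "\<And>x. incseq (\<lambda>n. f n x)" and lim: "\<And>x. (\<lambda>n. f n x) \<longlonglongrightarrow> g x" and "0 < e"
  shows "\<exists>N. \<forall>n\<ge>N. \<forall>x. g x < f n x + e"
proof -
  let ?U = "\<lambda>n. {x. g x < f n x + e}"
  have "open (?U n)" for n
    using f g by (intro open_Collect_less continuous_intros)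
  moreover have "UNIV \<subseteq> (\<Union>n\<in>UNIV. ?U n)"
  proof
    fix x
    have "eventually (\<lambda>n. g x - e < f n x) sequentially"
      using lim[of x] \<open>0 < e\<close> by (intro order_tendstoD) auto
    then obtain n where "g x - e < f n x" by (auto simp: eventually_sequentially)
    then show "x \<in> (\<Union>n\<in>UNIV. ?U n)" by (auto intro!: exI[of _ n])
  qed
  ultimately obtain D where D: "finite D" "UNIV \<subseteq> (\<Union>n\<in>D. ?U n)"
    using compactE_image[OF assms(1), of UNIV ?U] by (metis (lifting))
  have "g x < f n x + e" if n: "Max (insert 0 D) \<le> n" for n x
  proof -
    obtain m where m: "m \<in> D" "g x < f m x + e" using D by auto
    then have "m \<le> n" using n D(1) by (meson Max_ge finite.insertI insertCI order_trans)
    then have "f m x \<le> f n x" using mono[of x] by (auto dest: incseqD)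
    then show ?thesis using m by simp
  qed
  then show ?thesis by blast
qed

text \<open>Half open, so that the bands form a semiring: removing one band from another leaves a
  band below it and a band above it.\<close>

definition band :: "('x \<Rightarrow> real) \<Rightarrow> ('x \<Rightarrow> real) \<Rightarrow> ('x \<times> real) set" where
  "band f g = {(x, t). f x \<le> t \<and> t < g x}"

definition lips :: "('x::metric_space \<Rightarrow> real) set" where
  "lips = {f. \<exists>L. L-lipschitz_on UNIV f}"

lemma lips_const [simp, intro]: "(\<lambda>_. c) \<in> lips"
  unfolding lips_def by (auto intro: lipschitz_intros)

lemma lips_add [intro]: "f \<in> lips \<Longrightarrow> g \<in> lips \<Longrightarrow> (\<lambda>x. f x + g x) \<in> lips"
  unfolding lips_def by (auto intro: lipschitz_on_add)

lemma lips_diff [intro]: "f \<in> lips \<Longrightarrow> g \<in> lips \<Longrightarrow> (\<lambda>x. f x - g x) \<in> lips"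
  unfolding lips_def by (auto intro: lipschitz_on_diff)

lemma lips_cmult [intro]: "f \<in> lips \<Longrightarrow> (\<lambda>x. c * f x) \<in> lips"
  unfolding lips_def by (auto intro: lipschitz_on_cmult_real)

lemma lips_max [intro]: "f \<in> lips \<Longrightarrow> g \<in> lips \<Longrightarrow> (\<lambda>x. max (f x) (g x)) \<in> lips"
  unfolding lips_def by (auto intro: lipschitz_on_max)

lemma lips_min [intro]: "f \<in> lips \<Longrightarrow> g \<in> lips \<Longrightarrow> (\<lambda>x. min (f x) (g x)) \<in> lips"
  unfolding lips_def by (auto intro: lipschitz_on_min)

lemma lips_sum [intro]: "(\<And>i. i \<in> I \<Longrightarrow> f i \<in> lips) \<Longrightarrow> (\<lambda>x. \<Sum>i\<in>I. f i x) \<in> lips"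
  by (induction I rule: infinite_finite_induct) auto

lemma lips_continuous: "f \<in> lips \<Longrightarrow> continuous_on UNIV f"
  unfolding lips_def by (auto intro: lipschitz_on_continuous_on)

lemma lips_measurable [measurable_dest]: "f \<in> lips \<Longrightarrow> f \<in> borel_measurable borel"
  by (intro borel_measurable_continuous_onI lips_continuous)

lemma lips_infdist: "(\<lambda>x. infdist x A) \<in> lips"
proof -
  have "1-lipschitz_on UNIV (\<lambda>x. infdist x A)"
    by (rule lipschitz_onI) (use infdist_triangle_abs in \<open>auto simp: dist_real_def\<close>)
  then show ?thesis unfolding lips_def by auto
qed

lemma semiring_band: "semiring_of_sets UNIV {band f g |f g :: 'x::metric_space \<Rightarrow> real. f \<in> lips \<and> g \<in> lips \<and> f \<le> g}"
  (is "semiring_of_sets UNIV ?B")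
proof -
  \<comment> \<open>Raising the upper function to \<open>max f g\<close> does not change the band,
    so the order of the two functions can be ignored below.\<close>
  have bandI: "band f g \<in> ?B" if "f \<in> lips" "g \<in> lips" for f g :: "'x \<Rightarrow> real"
  proof -
    have "band f g = band f (\<lambda>x. max (f x) (g x))" by (auto simp: band_def)
    moreover have "(\<lambda>x. max (f x) (g x)) \<in> lips" using that by auto
    ultimately show ?thesis using that(1) by (fastforce simp: le_fun_def)
  qed
  show ?thesis
  proof
    show "{} \<in> ?B"
    proof -
      have "{} = band (\<lambda>_::'x. 0) (\<lambda>_. 0)" by (auto simp: band_def)
      then show ?thesis using bandI[of "\<lambda>_. 0" "\<lambda>_. 0"] by (simp only:) blast
    qed
  next
    fix a b assume "a \<in> ?B" "b \<in> ?B"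
    then obtain f g f' g' where ab: "a = band f g" "b = band f' g'"
      and l: "f \<in> lips" "g \<in> lips" "f' \<in> lips" "g' \<in> lips" by blast
    have "a \<inter> b = band (\<lambda>x. max (f x) (f' x)) (\<lambda>x. min (g x) (g' x))"
      unfolding ab band_def by auto
    moreover have "\<dots> \<in> ?B" using l by (intro bandI lips_max lips_min)
    ultimately show "a \<inter> b \<in> ?B" by (simp only:)
    define c where "c = band f (\<lambda>x. min (g x) (f' x))"
    \<comment> \<open>\<open>max (f' x) (g' x)\<close> takes care of the points where the removed
      band has an empty fibre: there \<open>c\<close> and \<open>d\<close> still make up the whole
      fibre of \<open>a\<close>.\<close>
    define d where "d = band (\<lambda>x. max (f x) (max (f' x) (g' x))) g"
    have "a - b = c \<union> d" "c \<inter> d = {}"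
      unfolding ab c_def d_def band_def by auto
    moreover have "c \<in> ?B" "d \<in> ?B" unfolding c_def d_def by (intro bandI lips_max lips_min l)+
    ultimately show "\<exists>C\<subseteq>?B. finite C \<and> disjoint C \<and> a - b = \<Union> C"
      by (intro exI[of _ "{c, d}"]) (auto simp: disjoint_def)
  qed auto
qed

text \<open>Daniell's construction: the measure lives on the product with the real line, and the band between
  two functions gets the value of the functional at their difference.\<close>

theorem positive_functional_representation:
  fixes \<l> :: "('x::metric_space \<Rightarrow> real) \<Rightarrow> real"
  assumes cpt: "compact (UNIV :: 'x set)"
    and add: "\<And>f g. f \<in> lips \<Longrightarrow> g \<in> lips \<Longrightarrow> \<l> (\<lambda>x. f x + g x) = \<l> f + \<l> g"
    and cmult: "\<And>f c. f \<in> lips \<Longrightarrow> \<l> (\<lambda>x. c * f x) = c * \<l> f"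
    and pos: "\<And>f. f \<in> lips \<Longrightarrow> (\<And>x. 0 \<le> f x) \<Longrightarrow> 0 \<le> \<l> f"
    and one: "\<l> (\<lambda>_. 1) = 1"
  shows "\<exists>\<mu>\<in>space (prob_algebra borel). \<forall>f\<in>lips. \<l> f = (\<integral>x. f x \<partial>\<mu>)"
proof -
  have diff: "\<l> (\<lambda>x. f x - g x) = \<l> f - \<l> g" if "f \<in> lips" "g \<in> lips" for f g
    using add[of "\<lambda>x. f x - g x" g] that lips_diff[OF that] by simp
  have mono: "\<l> f \<le> \<l> g" if "f \<in> lips" "g \<in> lips" "\<And>x. f x \<le> g x" for f g
    using pos[of "\<lambda>x. g x - f x"] diff[of g f] that lips_diff[of g f] by simp
  have const: "\<l> (\<lambda>_. c) = c" for c using cmult[of "\<lambda>_. 1" c] one by simp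
  have sum: "\<l> (\<lambda>x. \<Sum>i\<in>I. f i x) = (\<Sum>i\<in>I. \<l> (f i))" if "\<And>i. i \<in> I \<Longrightarrow> f i \<in> lips" "finite I"
    for f :: "nat \<Rightarrow> 'x \<Rightarrow> real" and I
    using that(2,1) by (induction I) (auto simp: const add lips_sum)
  define P where "P = (\<lambda>f g :: 'x \<Rightarrow> real. f \<in> lips \<and> g \<in> lips \<and> f \<le> g)"
  define \<nu> where "\<nu> = extend_measure UNIV {(f, g). P f g} (\<lambda>(f, g). band f g) (\<lambda>(f, g). ennreal (\<l> g - \<l> f))"
  have ind: "indicator (band f g) (x, t) = (indicator {f x..<g x} t :: ennreal)"
    for f g :: "'x \<Rightarrow> real" and x t by (auto simp: band_def indicator_def)
  \<comment> \<open>The fibres of a band are intervals, so the band determines \<open>g - f\<close>,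
    and a disjoint union of bands becomes a series of lengths that converges at every
    \<open>x\<close>.\<close>
  have band_diff: "(\<integral>\<^sup>+t. indicator (band f g) (x, t) \<partial>lborel) = ennreal (g x - f x)"
    if "P f g" for f g :: "'x \<Rightarrow> real" and x
    using that by (simp add: ind P_def le_fun_def)
  have "emeasure \<nu> (band f g) = ennreal (\<l> g - \<l> f)" if "P f g" for f g
  proof (rule extend_measure_caratheodory_pair[OF \<nu>_def])
    show "P f g" by fact
  next
    show "semiring_of_sets UNIV {band f g |f g. P f g}"
      using semiring_band unfolding P_def .
  next
    fix f g assume "P f g" "band f g = {}"
    then have "f = g" by (intro ext antisym) (auto simp: P_def band_def le_fun_def not_less)
    then show "ennreal (\<l> g - \<l> f) = 0" by simp
  next
    fix f g f' g' assume 1: "P f g" "P f' g'" "band f g = band f' g'"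
    then have "ennreal (g x - f x) = ennreal (g' x - f' x)" for x
      using band_diff[of f g x] band_diff[of f' g' x] by simp
    then have "(\<lambda>x. g x - f x) = (\<lambda>x. g' x - f' x)"
      using 1 by (auto simp: P_def le_fun_def)
    then show "ennreal (\<l> g - \<l> f) = ennreal (\<l> g' - \<l> f')"
      using diff[of g f] diff[of g' f'] 1 by (simp add: P_def)
  next
    fix F G :: "nat \<Rightarrow> 'x \<Rightarrow> real" and f g
    assume FG: "\<And>n. P (F n) (G n)" and fg: "P f g" and disj: "disjoint_family (\<lambda>n. band (F n) (G n))"
      and un: "(\<Union>n. band (F n) (G n)) = band f g"
    let ?s = "\<lambda>n x. \<Sum>i<n. G i x - F i x"
    have l: "F n \<in> lips" "G n \<in> lips" "f \<in> lips" "g \<in> lips" for n using FG[of n] fg by (auto simp: P_def)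
    have slips: "?s n \<in> lips" for n by (intro lips_sum lips_diff l)
    have le: "0 \<le> G n x - F n x" "0 \<le> g x - f x" for n x using FG[of n] fg by (auto simp: P_def le_fun_def)
    have \<l>s: "\<l> (?s n) = (\<Sum>i<n. \<l> (G i) - \<l> (F i))" for n
      using l by (subst sum) (auto simp: diff)
    have sums: "(\<lambda>i. G i x - F i x) sums (g x - f x)" for x
    proof -
      have "(\<Sum>i. ennreal (G i x - F i x)) = (\<Sum>i. \<integral>\<^sup>+t. indicator (band (F i) (G i)) (x, t) \<partial>lborel)"
        using FG by (simp add: band_diff)
      also have "\<dots> = (\<integral>\<^sup>+t. (\<Sum>i. indicator (band (F i) (G i)) (x, t)) \<partial>lborel)"
        by (subst nn_integral_suminf) (auto simp: ind)
      also have "\<dots> = (\<integral>\<^sup>+t. indicator (band f g) (x, t) \<partial>lborel)"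
        unfolding un[symmetric] using suminf_indicator[OF disj] by simp
      also have "\<dots> = ennreal (g x - f x)" using fg by (rule band_diff)
      finally have "(\<lambda>i. ennreal (G i x - F i x)) sums ennreal (g x - f x)"
        by (metis summableI summable_sums)
      then show ?thesis using le by (simp add: sums_ennreal)
    qed
    have "(\<lambda>i. \<l> (G i) - \<l> (F i)) sums (\<l> g - \<l> f)"
      unfolding sums_def \<l>s[symmetric]
    proof (rule LIMSEQ_I)
      fix e :: real assume "0 < e"
      \<comment> \<open>Countable additivity comes from here: compactness makes the convergence of
        the partial sums uniform, and positivity together with \<open>\<l> 1 = 1\<close> passes it
        on to \<open>\<l>\<close>.\<close>
      have "\<exists>N. \<forall>n\<ge>N. \<forall>x. (g x - f x) < ?s n x + e / 2"
      proof (rule compact_increasing_limit_uniform[OF cpt])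
        show "continuous_on UNIV (?s n)" for n using slips by (rule lips_continuous)
        show "continuous_on UNIV (\<lambda>x. g x - f x)" using l by (intro lips_continuous) auto
        show "incseq (\<lambda>n. ?s n x)" for x using le(1) by (auto intro!: incseq_SucI)
        show "(\<lambda>n. ?s n x) \<longlonglongrightarrow> g x - f x" for x using sums[of x] by (simp add: sums_def)
      qed (use \<open>0 < e\<close> in simp)
      then obtain N where N: "\<And>n x. n \<ge> N \<Longrightarrow> (g x - f x) < ?s n x + e / 2" by auto
      have "norm (\<l> (?s n) - (\<l> g - \<l> f)) < e" if "n \<ge> N" for n
      proof -
        have up: "?s n x \<le> g x - f x" for x
          using sums[of x] le(1) by (intro sum_le_suminf[of _ "{..<n}", THEN order_trans]) (auto simp: sums_iff)
        have gf: "(\<lambda>x. g x - f x) \<in> lips" using l by auto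
        have "\<l> (?s n) \<le> \<l> (\<lambda>x. g x - f x)" using up by (intro mono slips gf)
        moreover have "\<l> (\<lambda>x. g x - f x) \<le> \<l> (\<lambda>x. ?s n x + e / 2)"
          using N[OF that] slips gf by (intro mono) (auto simp: less_imp_le)
        ultimately show ?thesis using add[OF slips, of "\<lambda>_. e / 2"] \<open>0 < e\<close> const diff l by auto
      qed
      then show "\<exists>N. \<forall>n\<ge>N. norm (\<l> (?s n) - (\<l> g - \<l> f)) < e" by blast
    qed
    moreover have "0 \<le> \<l> (G i) - \<l> (F i)" "0 \<le> \<l> g - \<l> f" for i
      using mono[of "F i" "G i"] mono[of f g] le l by auto
    ultimately show "(\<Sum>i. ennreal (\<l> (G i) - \<l> (F i))) = ennreal (\<l> g - \<l> f)"
      by (simp add: suminf_ennreal2 sums_iff)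
  qed simp
  note em = this
  have sp: "space \<nu> = UNIV" unfolding \<nu>_def by (rule space_extend_measure) auto
  have sets: "band f g \<in> sets \<nu>" if "f \<in> lips" "g \<in> lips" for f g
  proof -
    have "band f g = band f (\<lambda>x. max (f x) (g x))" by (auto simp: band_def)
    moreover have "P f (\<lambda>x. max (f x) (g x))" using that by (auto simp: P_def le_fun_def)
    then have "band f (\<lambda>x. max (f x) (g x)) \<in> sets \<nu>"
      unfolding \<nu>_def by (subst sets_extend_measure) (auto intro!: sigma_sets.Basic)
    ultimately show ?thesis by simp
  qed
  \<comment> \<open>Keeping only the heights in \<open>[0, 1)\<close> cuts a probability out of
    \<open>\<nu>\<close>; its projection to the space will represent \<open>\<l>\<close>.\<close>
  define Y where "Y = band (\<lambda>_::'x. 0) (\<lambda>_. 1)"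
  have Y: "Y \<in> sets \<nu>" unfolding Y_def by (rule sets) auto
  define \<mu> where "\<mu> = distr (restrict_space \<nu> Y) borel fst"
  \<comment> \<open>The multiples of \<open>f\<close> capped at 1 exhaust the set where
    \<open>f\<close> is positive. Every open set other than the whole space has this form, with
    \<open>f\<close> the distance to its complement.\<close>
  have level: "{(x, t). 0 < f x \<and> 0 \<le> t \<and> t < 1} \<in> sets \<nu>" if "f \<in> lips" for f
  proof -
    have "{(x, t). 0 < f x \<and> 0 \<le> t \<and> t < 1} = (\<Union>n. band (\<lambda>_. 0) (\<lambda>x. min 1 (real n * f x)))"
    proof safe
      fix x and t :: real assume "0 < f x" "0 \<le> t" "t < 1"
      obtain n where "t < real n * f x" using reals_Archimedean3[OF \<open>0 < f x\<close>] by blast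
      then show "(x, t) \<in> (\<Union>n. band (\<lambda>_. 0) (\<lambda>x. min 1 (real n * f x)))"
        using \<open>0 \<le> t\<close> \<open>t < 1\<close> by (auto simp: band_def)
    next
      fix x t n assume "(x, t) \<in> band (\<lambda>_. 0) (\<lambda>x. min 1 (real n * f x))"
      then have t: "0 \<le> t" "t < 1" "t < real n * f x" by (auto simp: band_def)
      then have "0 < real n * f x" by linarith
      with t show "0 < f x" "0 \<le> t" "t < 1" by (auto simp: zero_less_mult_iff)
    qed
    also have "\<dots> \<in> sets \<nu>" using that by (intro sets.countable_UN image_subsetI sets) auto
    finally show ?thesis .
  qed
  have fst_m: "fst \<in> restrict_space \<nu> Y \<rightarrow>\<^sub>M borel"
  proof (rule borel_measurableI)
    fix S :: "'x set" assume "open S"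
    show "fst -` S \<inter> space (restrict_space \<nu> Y) \<in> sets (restrict_space \<nu> Y)"
    \<comment> \<open>By convention the distance to the empty complement of \<open>UNIV\<close> is
      0, so this case does not fit the general argument.\<close>
    proof (cases "S = UNIV")
      case True
      then show ?thesis by simp
    next
      case False
      have pos_iff: "0 < infdist x (- S) \<longleftrightarrow> x \<in> S" for x
        using \<open>open S\<close> False in_closed_iff_infdist_zero[of "- S" x] infdist_nonneg[of x "- S"] by (auto simp: less_le)
      have "fst -` S \<inter> space (restrict_space \<nu> Y) = {(x, t). 0 < infdist x (- S) \<and> 0 \<le> t \<and> t < 1}"
        unfolding pos_iff by (auto simp: space_restrict_space sp Y_def band_def)
      moreover have "{(x, t). 0 < infdist x (- S) \<and> 0 \<le> t \<and> t < 1} \<subseteq> Y" by (auto simp: Y_def band_def)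
      ultimately show ?thesis
        using level[OF lips_infdist[of "- S"]] Y by (simp add: sets_restrict_space_iff sp)
    qed
  qed
  have \<mu>A: "emeasure \<mu> A = emeasure \<nu> (A \<times> {0..<1})" if "A \<in> sets borel" for A
  proof -
    have "fst -` A \<inter> Y = A \<times> {0..<1}" "A \<times> {0..<1} \<subseteq> Y" by (auto simp: Y_def band_def)
    then show ?thesis
      unfolding \<mu>_def using that Y
      by (subst emeasure_distr[OF fst_m]) (auto simp: space_restrict_space sp emeasure_restrict_space)
  qed
  have AY: "A \<times> {0..<1::real} \<in> sets \<nu>" if "A \<in> sets borel" for A :: "'x set"
  proof -
    have "fst -` A \<inter> space (restrict_space \<nu> Y) = A \<times> {0..<1}"
      by (auto simp: Y_def band_def space_restrict_space sp)
    then show ?thesis using measurable_sets[OF fst_m that] Y by (simp add: sets_restrict_space_iff sp)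
  qed
  have "band (\<lambda>_::'x. 0) (\<lambda>_. 1) = UNIV \<times> {0..<1}" by (auto simp: band_def)
  then have "emeasure \<mu> UNIV = 1"
    using em[of "\<lambda>_. 0" "\<lambda>_. 1"] \<mu>A[of UNIV] const by (simp add: P_def le_fun_def)
  then have prob: "prob_space \<mu>" by (intro prob_spaceI) (simp add: \<mu>_def)
  interpret prob_space \<mu> by fact
  have le: "\<l> f \<le> (\<integral>x. f x \<partial>\<mu>)" if f: "f \<in> lips" "\<And>x. 0 \<le> f x" "\<And>x. f x \<le> 1" for f
  proof (rule le_if_le_add_inverse)
    fix m
    define n where "n = Suc m"
    \<comment> \<open>\<open>?h j\<close> is the part of \<open>n * f\<close> between the heights
      \<open>j\<close> and \<open>j + 1\<close>. It lies under the indicator of the level set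
      \<open>j < n * f\<close>, and monotonicity of \<open>\<nu>\<close> compares the two.\<close>
    let ?h = "\<lambda>j x. min 1 (max 0 (real n * f x - real j))"
    have h: "?h j \<in> lips" for j :: nat
      by (intro lips_min lips_max lips_diff lips_cmult lips_const f(1))
    have sum_h: "(\<Sum>j<n. ?h j x) = real n * f x" for x
    proof -
      have "(\<Sum>j<k. min 1 (max 0 (y - real j))) = min y (real k)" if "0 \<le> y" for y k
        by (induction k) (use that in \<open>auto simp: min_def max_def\<close>)
      from this[of "real n * f x" n] show ?thesis using f(2,3)[of x] by (simp add: mult_left_le)
    qed
    have hj: "\<l> (?h j) \<le> measure \<mu> {x \<in> space \<mu>. real j < real n * f x}" for j :: nat
    proof -
      have A: "{x. real j < real n * f x} \<in> sets borel" using lips_measurable[OF f(1)] by measurable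
      have "ennreal (\<l> (?h j)) = emeasure \<nu> (band (\<lambda>_. 0) (?h j))"
        using h[of j] by (subst em) (auto simp: P_def le_fun_def const)
      also have "\<dots> \<le> emeasure \<nu> ({x. real j < real n * f x} \<times> {0..<1})"
        by (intro emeasure_mono AY A) (auto simp: band_def min_def max_def split: if_splits)
      also have "\<dots> = ennreal (measure \<mu> {x. real j < real n * f x})"
        by (simp add: \<mu>A[OF A, symmetric] emeasure_eq_measure)
      finally show ?thesis by (simp add: \<mu>_def)
    qed
    have "real n * \<l> f = \<l> (\<lambda>x. \<Sum>j<n. ?h j x)" unfolding sum_h using cmult f by simp
    also have "\<dots> = (\<Sum>j<n. \<l> (?h j))" using h by (intro sum) auto
    also have "\<dots> \<le> (\<Sum>j<n. measure \<mu> {x \<in> space \<mu>. real j < real n * f x})" by (intro sum_mono hj)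
    also have "\<dots> \<le> real n * (\<integral>x. f x \<partial>\<mu>) + 1"
      using f by (intro integral_step_bounds prob) (auto simp: \<mu>_def dest: lips_measurable)
    also have "\<dots> = real n * ((\<integral>x. f x \<partial>\<mu>) + 1 / real n)" by (simp add: n_def field_simps)
    finally show "\<l> f \<le> (\<integral>x. f x \<partial>\<mu>) + 1 / real (Suc m)"
      unfolding n_def by (simp only: mult_le_cancel_left_pos of_nat_0_less_iff zero_less_Suc)
  qed
  have int: "integrable \<mu> f" if f: "f \<in> lips" for f
  proof -
    have "bounded (range f)" using compact_continuous_image[OF lips_continuous[OF f] cpt] by (rule compact_imp_bounded)
    then obtain c where "\<And>x. \<bar>f x\<bar> \<le> c" by (auto simp: bounded_iff)
    then show ?thesis
      using lips_measurable[OF f] by (intro integrable_const_bound[where B=c]) (auto simp: \<mu>_def)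
  qed
  have eq01: "\<l> f = (\<integral>x. f x \<partial>\<mu>)" if f: "f \<in> lips" "\<And>x. 0 \<le> f x" "\<And>x. f x \<le> 1" for f
  proof (rule antisym)
    show "\<l> f \<le> (\<integral>x. f x \<partial>\<mu>)" by (rule le[OF f])
    \<comment> \<open>The opposite inequality is the first one for \<open>1 - f\<close>.\<close>
    have "\<l> (\<lambda>x. 1 - f x) \<le> (\<integral>x. 1 - f x \<partial>\<mu>)" using f by (intro le) auto
    then show "(\<integral>x. f x \<partial>\<mu>) \<le> \<l> f" using diff[of "\<lambda>_. 1" f] f int[OF f(1)] const by (simp add: prob_space)
  qed
  have "\<l> f = (\<integral>x. f x \<partial>\<mu>)" if f: "f \<in> lips" for f
  proof -
    have "bounded (range f)" using compact_continuous_image[OF lips_continuous[OF f] cpt] by (rule compact_imp_bounded)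
    then obtain c where c: "0 < c" "\<And>x. \<bar>f x\<bar> \<le> c" by (auto simp: bounded_pos)
    define g where "g = (\<lambda>x. (1 / (2 * c)) * (f x + c))"
    have g: "g \<in> lips" unfolding g_def by (intro lips_cmult lips_add lips_const f)
    have "0 \<le> g x \<and> g x \<le> 1" for x using c(2)[of x] c(1) by (simp add: g_def field_simps abs_le_iff)
    then have "\<l> g = (\<integral>x. g x \<partial>\<mu>)" using g by (intro eq01) auto
    moreover have fg: "f = (\<lambda>x. 2 * c * g x - c)" using c(1) by (auto simp: g_def)
    have "\<l> f = 2 * c * \<l> g - c" unfolding fg using g by (subst diff) (auto simp: cmult const)
    moreover have "(\<integral>x. f x \<partial>\<mu>) = 2 * c * (\<integral>x. g x \<partial>\<mu>) - c"
      unfolding fg using int[OF g] by (simp add: prob_space)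
    ultimately show ?thesis by simp
  qed
  moreover have "\<mu> \<in> space (prob_algebra borel)" using prob by (simp add: space_prob_algebra \<mu>_def)
  ultimately show ?thesis by blast
qed

section \<open>Lipschitz functions determine a probability measure\<close>

lemma lips_max_infdist: "(\<lambda>x. max 0 (1 - c * infdist x A)) \<in> lips"
  by (intro lips_max lips_diff lips_cmult lips_const lips_infdist)

text \<open>The indicator of a nonempty closed set is a decreasing limit of Lipschitz functions with
  values in \<open>[0, 1]\<close>, and the closed sets form an intersection-stable
  generator.\<close>

lemma prob_measure_eqI_lips:
  fixes \<mu> \<nu> :: "'a::metric_space measure"
  assumes \<mu>: "\<mu> \<in> space (prob_algebra borel)" and \<nu>: "\<nu> \<in> space (prob_algebra borel)"
    and eq: "\<And>f. f \<in> lips \<Longrightarrow> (\<And>x. 0 \<le> f x \<and> f x \<le> 1) \<Longrightarrow> (\<integral>x. f x \<partial>\<mu>) = (\<integral>x. f x \<partial>\<nu>)"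
  shows "\<mu> = \<nu>"
proof (rule measure_eqI_generator_eq[where E="{A. closed A}" and \<Omega>=UNIV and A="\<lambda>_. UNIV"])
  have lim: "(\<lambda>n. \<integral>x. max 0 (1 - real n * infdist x A) \<partial>M) \<longlonglongrightarrow> measure M A"
    if M: "M \<in> space (prob_algebra borel)" and A: "closed A" "A \<noteq> {}" for M and A :: "'a set"
  proof -
    interpret prob_space M using M by (simp add: space_prob_algebra)
    have sets: "sets M = sets borel" using M by (simp add: space_prob_algebra)
    have AM: "A \<in> sets M" using A sets by simp
    have "(\<lambda>n. \<integral>x. max 0 (1 - real n * infdist x A) \<partial>M) \<longlonglongrightarrow> (\<integral>x. indicator A x \<partial>M)"
    proof (rule integral_dominated_convergence[where w="\<lambda>_. 1"])
      show "(\<lambda>x. max 0 (1 - real n * infdist x A)) \<in> borel_measurable M" for n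
        using lips_measurable[OF lips_max_infdist[of "real n" A]] sets by (simp cong: measurable_cong_sets)
      show "AE x in M. (\<lambda>n. max 0 (1 - real n * infdist x A)) \<longlonglongrightarrow> indicator A x"
      proof (rule AE_I2)
        fix x
        show "(\<lambda>n. max 0 (1 - real n * infdist x A)) \<longlonglongrightarrow> indicator A x"
        proof (cases "x \<in> A")
          case False
          then have pos: "0 < infdist x A"
            using A in_closed_iff_infdist_zero[of A x] infdist_nonneg[of x A] by auto
          obtain n where n: "1 < real n * infdist x A" using reals_Archimedean3[OF pos] by blast
          have "max 0 (1 - real m * infdist x A) = 0" if "m \<ge> n" for m
          proof -
            have "real n * infdist x A \<le> real m * infdist x A" using that pos by simp
            then show ?thesis using n by simp
          qed
          then have "eventually (\<lambda>m. max 0 (1 - real m * infdist x A) = indicator A x) sequentially"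
            using False by (auto simp: eventually_sequentially)
          then show ?thesis by (rule tendsto_eventually)
        qed simp
      qed
      show "AE x in M. norm (max 0 (1 - real n * infdist x A)) \<le> 1" for n
        by (auto simp: infdist_nonneg)
    qed (use AM in auto)
    then show ?thesis using AM by (simp add: sets.Int_space_eq2)
  qed
  fix A :: "'a set" assume "A \<in> {A. closed A}"
  then have A: "closed A" by simp
  interpret \<mu>: prob_space \<mu> using \<mu> by (simp add: space_prob_algebra)
  interpret \<nu>: prob_space \<nu> using \<nu> by (simp add: space_prob_algebra)
  show "emeasure \<mu> A = emeasure \<nu> A"
  \<comment> \<open>As \<open>infdist x {}\<close> is 0, the approximating functions would not tend
    to the indicator of the empty set.\<close>
  proof (cases "A = {}")
    case False
    have "(\<integral>x. max 0 (1 - real n * infdist x A) \<partial>\<mu>) = (\<integral>x. max 0 (1 - real n * infdist x A) \<partial>\<nu>)" for n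
      by (intro eq lips_max_infdist) (auto simp: infdist_nonneg)
    then have "measure \<mu> A = measure \<nu> A"
      using lim[OF \<mu> A False] lim[OF \<nu> A False] by (simp add: LIMSEQ_unique)
    then show ?thesis by (simp add: \<mu>.emeasure_eq_measure \<nu>.emeasure_eq_measure)
  qed simp
next
  show "sets \<mu> = sigma_sets UNIV {A. closed A}" "sets \<nu> = sigma_sets UNIV {A. closed A}"
    using \<mu> \<nu> by (simp_all add: space_prob_algebra borel_eq_closed)
  show "emeasure \<mu> UNIV \<noteq> \<infinity>" using \<mu> by (auto simp: space_prob_algebra prob_space_def finite_measure.emeasure_finite)
qed (auto simp: Int_stable_def)

subsection \<open>Coordinates with respect to a closed complement\<close>

text \<open>If \<open>b\<close> is outside the closed subspace \<open>G\<close>, its positive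
  distance from \<open>G\<close> bounds the coefficient \<open>t\<close> by the norm of
  \<open>t *\<^sub>R b + z\<close>. Along a convergent sequence the coefficients are therefore
  Cauchy, and the remainders converge within \<open>G\<close>.\<close>

lemma closed_add_line:
  fixes G :: "'e::real_normed_vector set"
  assumes G: "subspace G" "closed G"
  shows "closed {t *\<^sub>R b + z |t z. z \<in> G}"
proof (cases "b \<in> G")
  case True
  have "{t *\<^sub>R b + z |t z. z \<in> G} = G"
  proof safe
    fix x assume "x \<in> G" then show "\<exists>t z. x = t *\<^sub>R b + z \<and> z \<in> G"
      by (intro exI[of _ 0] exI[of _ x]) simp
  qed (use True G in \<open>auto intro: subspace_add subspace_scale\<close>)
  then show ?thesis using G by simp
next
  case False
  have bd: "\<bar>t\<bar> * infdist b G \<le> norm (t *\<^sub>R b + z)" if "z \<in> G" for t z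
  proof (cases "t = 0")
    case False
    have "- (1 / t) *\<^sub>R z \<in> G" using that G subspace_scale by blast
    then have "infdist b G \<le> dist b (- (1 / t) *\<^sub>R z)" by (rule infdist_le)
    also have "\<dots> = norm ((1 / t) *\<^sub>R (t *\<^sub>R b + z))" using False by (simp add: dist_norm algebra_simps)
    also have "\<dots> = norm (t *\<^sub>R b + z) / \<bar>t\<bar>" by simp
    finally show ?thesis using False by (simp add: field_simps)
  qed simp
  have pos: "0 < infdist b G"
    using False G in_closed_iff_infdist_zero[of G b] infdist_nonneg[of b G] subspace_0[OF G(1)] by (auto simp: less_le)
  show ?thesis
    unfolding closed_sequential_limits
  proof (intro allI impI, elim conjE)
    fix x l assume "\<forall>n. x n \<in> {t *\<^sub>R b + z |t z. z \<in> G}" and l: "x \<longlonglongrightarrow> l"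
    then obtain t z where x: "\<And>n. x n = t n *\<^sub>R b + z n" and z: "\<And>n. z n \<in> G"
      by simp metis
    have "Cauchy t"
    proof (rule metric_CauchyI)
      fix e :: real assume "0 < e"
      then have "0 < e * infdist b G" using pos by simp
      then obtain N where N: "\<And>m n. m \<ge> N \<Longrightarrow> n \<ge> N \<Longrightarrow> dist (x m) (x n) < e * infdist b G"
        using metric_CauchyD[OF LIMSEQ_imp_Cauchy[OF l]] by blast
      have "dist (t m) (t n) < e" if "m \<ge> N" "n \<ge> N" for m n
      proof -
        have "\<bar>t m - t n\<bar> * infdist b G \<le> norm ((t m - t n) *\<^sub>R b + (z m - z n))"
          using z G by (intro bd subspace_diff)
        also have "\<dots> = dist (x m) (x n)" by (simp add: x dist_norm algebra_simps)
        also have "\<dots> < e * infdist b G" using N that by blast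
        finally show ?thesis using pos by (simp add: dist_real_def)
      qed
      then show "\<exists>M. \<forall>m\<ge>M. \<forall>n\<ge>M. dist (t m) (t n) < e" by blast
    qed
    then obtain s where s: "t \<longlonglongrightarrow> s" using Cauchy_convergent convergent_def by blast
    have "(\<lambda>n. x n - t n *\<^sub>R b) \<longlonglongrightarrow> l - s *\<^sub>R b" by (intro tendsto_intros l s)
    then have "z \<longlonglongrightarrow> l - s *\<^sub>R b" by (simp add: x)
    then have "l - s *\<^sub>R b \<in> G" using closed_sequentially[OF G(2)] z by blast
    then show "l \<in> {t *\<^sub>R b + z |t z. z \<in> G}" by (intro CollectI exI[of _ s] exI[of _ "l - s *\<^sub>R b"]) simp
  qed
qed

lemma closed_add_span:
  fixes G :: "'e::real_normed_vector set"
  assumes "finite B" and G: "subspace G" "closed G"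
  shows "closed {y + z |y z. y \<in> span B \<and> z \<in> G}"
  using \<open>finite B\<close>
proof induction
  case (insert b B)
  let ?H = "{y + z |y z. y \<in> span B \<and> z \<in> G}"
  have "subspace ?H" using subspace_sums[OF subspace_span G(1), of B] by simp
  then have "closed {t *\<^sub>R b + z |t z. z \<in> ?H}" using insert.IH by (rule closed_add_line)
  also have "{t *\<^sub>R b + z |t z. z \<in> ?H} = {y + z |y z. y \<in> span (insert b B) \<and> z \<in> G}"
  proof safe
    fix t y z assume "y \<in> span B" "z \<in> G"
    then show "\<exists>y' z'. t *\<^sub>R b + (y + z) = y' + z' \<and> y' \<in> span (insert b B) \<and> z' \<in> G"
      by (intro exI[of _ "t *\<^sub>R b + y"] exI[of _ z])
         (auto simp: span_insert intro!: exI[of _ t])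
  next
    fix y z assume "y \<in> span (insert b B)" "z \<in> G"
    then obtain t where "y - t *\<^sub>R b \<in> span B" by (auto simp: span_insert)
    then show "\<exists>t z'. y + z = t *\<^sub>R b + z' \<and> z' \<in> ?H"
      using \<open>z \<in> G\<close> by (intro exI[of _ t] exI[of _ "(y - t *\<^sub>R b) + z"]) auto
  qed
  finally show ?case .
qed (use G in simp)

text \<open>The coefficient of each basis vector is a bounded functional, because the other basis vectors
  together with the complement span a closed subspace.\<close>

lemma bounded_coordinates:
  fixes G B :: "'e::real_normed_vector set"
  assumes B: "finite B" "independent B" and G: "subspace G" "closed G" and int: "span B \<inter> G = {0}"
    and sum: "\<And>x. \<exists>y\<in>span B. \<exists>z\<in>G. x = y + z"
  shows "\<exists>a C. 0 < C \<and> (\<forall>x. x - (\<Sum>b\<in>B. a b x *\<^sub>R b) \<in> G) \<and>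
    (\<forall>b\<in>B. \<forall>x y. \<bar>a b x - a b y\<bar> \<le> C * norm (x - y)) \<and>
    (\<forall>b\<in>B. \<forall>c. \<forall>z\<in>G. a b (z + (\<Sum>b\<in>B. c b *\<^sub>R b)) = c b)"
proof -
  have bound: "\<exists>D>0. \<forall>c. \<forall>z\<in>G. \<bar>c b\<bar> \<le> D * norm (z + (\<Sum>b\<in>B. c b *\<^sub>R b))" if b: "b \<in> B" for b
  proof -
    let ?H = "{y + z |y z. y \<in> span (B - {b}) \<and> z \<in> G}"
    have H: "subspace ?H" "closed ?H"
      using closed_add_span[of "B - {b}" G] B G subspace_sums[OF subspace_span G(1), of "B - {b}"] by auto
    have "b \<notin> ?H"
    proof
      assume "b \<in> ?H"
      then obtain y z where yz: "b = y + z" "y \<in> span (B - {b})" "z \<in> G" by blast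
      then have "z \<in> span B" using span_mono[of "B - {b}" B] b
        by (metis Diff_subset add_diff_cancel_left' span_base span_diff subsetD)
      then have "z = 0" using yz int by blast
      then show False using yz B b by (auto simp: dependent_def)
    qed
    then have pos: "0 < infdist b ?H"
      using H in_closed_iff_infdist_zero[of ?H b] infdist_nonneg[of b ?H] subspace_0[OF H(1)] by (auto simp: less_le)
    have "\<bar>c b\<bar> * infdist b ?H \<le> norm (z + (\<Sum>b\<in>B. c b *\<^sub>R b))" if "z \<in> G" for c z
    proof (cases "c b = 0")
      case False
      let ?y = "(\<Sum>b\<in>B - {b}. c b *\<^sub>R b) + z"
      have "(\<Sum>b\<in>B - {b}. c b *\<^sub>R b) \<in> span (B - {b})"
        by (intro span_sum span_scale span_base)
      then have y: "?y \<in> ?H" using that by blast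
      have "infdist b ?H \<le> dist b ((- 1 / c b) *\<^sub>R ?y)"
        by (intro infdist_le subspace_scale H y)
      also have "\<dots> = norm ((1 / c b) *\<^sub>R (c b *\<^sub>R b + ?y))"
        using False by (simp add: dist_norm algebra_simps)
      also have "c b *\<^sub>R b + ?y = z + (\<Sum>b\<in>B. c b *\<^sub>R b)"
        using b B by (subst sum.remove[of B b]) (simp_all add: algebra_simps)
      also have "norm ((1 / c b) *\<^sub>R (z + (\<Sum>b\<in>B. c b *\<^sub>R b))) = norm (z + (\<Sum>b\<in>B. c b *\<^sub>R b)) / \<bar>c b\<bar>"
        unfolding norm_scaleR by simp
      finally show ?thesis using False by (simp add: field_simps)
    qed simp
    then show ?thesis using pos by (intro exI[of _ "1 / infdist b ?H"]) (simp add: field_simps)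
  qed
  then obtain D where D: "\<And>b. b \<in> B \<Longrightarrow> 0 < D b"
    "\<And>b c z. b \<in> B \<Longrightarrow> z \<in> G \<Longrightarrow> \<bar>c b\<bar> \<le> D b * norm (z + (\<Sum>b\<in>B. c b *\<^sub>R b))" by metis
  have "\<exists>c. x - (\<Sum>b\<in>B. c b *\<^sub>R b) \<in> G" for x
  proof -
    obtain y z where "y \<in> span B" "z \<in> G" "x = y + z" using sum by blast
    moreover then obtain c where "y = (\<Sum>b\<in>B. c b *\<^sub>R b)" using B(1) by (auto simp: span_finite)
    ultimately show ?thesis by (intro exI[of _ c]) simp
  qed
  then obtain a where a: "\<And>x. x - (\<Sum>b\<in>B. a x b *\<^sub>R b) \<in> G" by metis
  define C where "C = 1 + (\<Sum>b\<in>B. D b)"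
  have DC: "D b \<le> C" if "b \<in> B" for b
    using member_le_sum[OF that, of D] B(1) D(1) by (fastforce simp: C_def intro: less_imp_le)
  have "0 < C" unfolding C_def using D(1) by (intro add_pos_nonneg sum_nonneg) (auto intro: less_imp_le)
  moreover have "\<bar>a x b - a y b\<bar> \<le> C * norm (x - y)" if "b \<in> B" for b x y
  proof -
    let ?z = "(x - (\<Sum>b\<in>B. a x b *\<^sub>R b)) - (y - (\<Sum>b\<in>B. a y b *\<^sub>R b))"
    have "\<bar>a x b - a y b\<bar> \<le> D b * norm (?z + (\<Sum>b\<in>B. (a x b - a y b) *\<^sub>R b))"
      using that a G by (intro D(2)) (auto intro: subspace_diff)
    also have "?z + (\<Sum>b\<in>B. (a x b - a y b) *\<^sub>R b) = x - y"
      by (simp add: scaleR_left_diff_distrib sum_subtractf)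
    also have "D b * norm (x - y) \<le> C * norm (x - y)" by (intro mult_right_mono DC that) simp
    finally show ?thesis .
  qed
  \<comment> \<open>Two representations of one vector differ by a representation of 0, whose
    coefficients vanish by the bound \<open>D\<close>.\<close>
  moreover have "a (z + (\<Sum>b\<in>B. c b *\<^sub>R b)) b = c b" if "b \<in> B" "z \<in> G" for b c z
  proof -
    let ?x = "z + (\<Sum>b\<in>B. c b *\<^sub>R b)"
    have "\<bar>a ?x b - c b\<bar> \<le> D b * norm ((?x - (\<Sum>b\<in>B. a ?x b *\<^sub>R b)) - z + (\<Sum>b\<in>B. (a ?x b - c b) *\<^sub>R b))"
      by (rule D(2)[OF that(1) subspace_diff[OF G(1) a that(2)]])
    also have "(?x - (\<Sum>b\<in>B. a ?x b *\<^sub>R b)) - z + (\<Sum>b\<in>B. (a ?x b - c b) *\<^sub>R b) = 0"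
      by (simp add: scaleR_left_diff_distrib sum_subtractf)
    finally show ?thesis by simp
  qed
  ultimately show ?thesis using a by (intro exI[of _ "\<lambda>b x. a x b"] exI[of _ C]) auto
qed

subsection \<open>Shifts along a finite-dimensional subspace\<close>

lemma emeasure_cube:
  fixes B :: "'b set" and y :: "'b \<Rightarrow> real"
  assumes "finite B" "0 \<le> l"
  shows "emeasure (PiM B (\<lambda>_. lborel)) (\<Pi>\<^sub>E b\<in>B. {y b..y b + l}) = ennreal l ^ card B"
    and "emeasure (PiM B (\<lambda>_. lborel)) (\<Pi>\<^sub>E b\<in>B. {y b<..<y b + l}) = ennreal l ^ card B"
proof -
  interpret product_sigma_finite "\<lambda>_::'b. lborel :: real measure" by standard
  show "emeasure (PiM B (\<lambda>_. lborel)) (\<Pi>\<^sub>E b\<in>B. {y b..y b + l}) = ennreal l ^ card B"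
    "emeasure (PiM B (\<lambda>_. lborel)) (\<Pi>\<^sub>E b\<in>B. {y b<..<y b + l}) = ennreal l ^ card B"
    using assms by (auto simp: emeasure_PiM)
qed

text \<open>Average over cubes of side \<open>2 * r\<close> around the image points: the part of \<open>A\<close> that \<open>t\<close> maps into such a
  cube has diameter at most \<open>2 * r * L\<close>, hence lies in a cube of that side.\<close>

lemma expanding_map_integral_bound:
  fixes B :: "'b set" and f g :: "('b \<Rightarrow> real) \<Rightarrow> ennreal" and t :: "('b \<Rightarrow> real) \<Rightarrow> 'b \<Rightarrow> real"
  defines "N \<equiv> PiM B (\<lambda>_. lborel :: real measure)"
  assumes B: "finite B" and "0 < r" and "0 \<le> L"
    and A [measurable]: "A \<in> sets N" and f [measurable]: "f \<in> borel_measurable N" and g [measurable]: "g \<in> borel_measurable N"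
    and t [measurable]: "\<And>b. b \<in> B \<Longrightarrow> (\<lambda>c. t c b) \<in> borel_measurable N"
    and exp: "\<And>c c' s. c \<in> A \<Longrightarrow> c' \<in> A \<Longrightarrow> (\<And>b. b \<in> B \<Longrightarrow> \<bar>t c b - t c' b\<bar> \<le> s) \<Longrightarrow> 0 \<le> s \<Longrightarrow>
      (\<forall>b\<in>B. \<bar>c b - c' b\<bar> \<le> L * s)"
    and le: "\<And>c z. c \<in> A \<Longrightarrow> z \<in> space N \<Longrightarrow> (\<And>b. b \<in> B \<Longrightarrow> \<bar>z b - t c b\<bar> < r) \<Longrightarrow> f c \<le> g z"
  shows "(\<integral>\<^sup>+c. f c * indicator A c \<partial>N) \<le> ennreal L ^ card B * (\<integral>\<^sup>+z. g z \<partial>N)"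
proof -
  interpret product_sigma_finite "\<lambda>_::'b. lborel :: real measure" by standard
  have sf: "sigma_finite_measure N" unfolding N_def by (rule sigma_finite[OF B])
  interpret pair_sigma_finite N N using sf by (simp add: pair_sigma_finite_def)
  define near where "near = (\<lambda>c z. \<forall>b\<in>B. \<bar>z b - t c b\<bar> < r)"
  have comp [measurable]: "(\<lambda>c. c b) \<in> borel_measurable N" if "b \<in> B" for b
    unfolding N_def using that by measurable
  have near_m [measurable]: "Measurable.pred (N \<Otimes>\<^sub>M N) (\<lambda>(c, z). near c z)"
    unfolding near_def using B by measurable
  have near1 [measurable]: "Measurable.pred N (near c)" for c
    unfolding near_def using B by measurable
  let ?J = "\<lambda>c z. if near c z then 1 else 0 :: ennreal"
  let ?I = "\<lambda>c z. indicator A c * ?J c z"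
  have cube: "(\<integral>\<^sup>+z. ?J c z \<partial>N) = ennreal (2 * r) ^ card B" for c
  proof -
    have "{z. near c z} \<inter> space N = (\<Pi>\<^sub>E b\<in>B. {t c b - r<..<(t c b - r) + 2 * r})"
      by (auto simp: near_def N_def space_PiM PiE_iff abs_less_iff algebra_simps)
    then have "(\<integral>\<^sup>+z. ?J c z \<partial>N) = (\<integral>\<^sup>+z. indicator (\<Pi>\<^sub>E b\<in>B. {t c b - r<..<(t c b - r) + 2 * r}) z \<partial>N)"
      by (intro nn_integral_cong) (auto simp: indicator_def)
    also have "\<dots> = emeasure N (\<Pi>\<^sub>E b\<in>B. {t c b - r<..<(t c b - r) + 2 * r})"
      unfolding N_def using B by (intro nn_integral_indicator sets_PiM_I_finite) auto
    also have "\<dots> = ennreal (2 * r) ^ card B"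
      unfolding N_def using B \<open>0 < r\<close> by (intro emeasure_cube) auto
    finally show ?thesis .
  qed
  have fibre: "(\<integral>\<^sup>+c. ?I c z \<partial>N) \<le> ennreal (2 * r * L) ^ card B" for z
  proof -
    let ?D = "{c \<in> A. near c z}"
    show ?thesis
    proof (cases "?D = {}")
      case True
      then have "(\<integral>\<^sup>+c. ?I c z \<partial>N) = (\<integral>\<^sup>+c. 0 \<partial>N)"
        by (intro nn_integral_cong) (auto simp: indicator_def)
      then show ?thesis by simp
    next
      case False
      have D: "\<bar>c b - c' b\<bar> \<le> 2 * r * L" if "c \<in> ?D" "c' \<in> ?D" "b \<in> B" for c c' b
      proof -
        have "\<bar>t c b - t c' b\<bar> \<le> 2 * r" if "b \<in> B" for b
        proof -
          have "\<bar>z b - t c b\<bar> < r" "\<bar>z b - t c' b\<bar> < r"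
            using \<open>c \<in> ?D\<close> \<open>c' \<in> ?D\<close> that by (auto simp: near_def)
          then show ?thesis by linarith
        qed
        then show ?thesis using exp[of c c' "2 * r"] that \<open>0 < r\<close> by (auto simp: mult_ac)
      qed
      define i where "i = (\<lambda>b. Inf ((\<lambda>c. c b) ` ?D))"
      have "?D \<subseteq> (\<Pi>\<^sub>E b\<in>B. {i b..i b + 2 * r * L})"
      proof
        fix c assume c: "c \<in> ?D"
        have "i b \<le> c b \<and> c b \<le> i b + 2 * r * L" if b: "b \<in> B" for b
        proof
          have lo: "c b - 2 * r * L \<le> c' b" if "c' \<in> ?D" for c' using D[OF c that b] by linarith
          then show "i b \<le> c b" unfolding i_def
            using c by (intro cInf_lower imageI bdd_belowI[of _ "c b - 2 * r * L"]) auto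
          have "c b - 2 * r * L \<le> i b" unfolding i_def
            using False lo by (intro cInf_greatest) blast+
          then show "c b \<le> i b + 2 * r * L" by simp
        qed
        moreover have "c \<in> extensional B"
          using c sets.sets_into_space[OF A] by (auto simp: N_def space_PiM PiE_def)
        ultimately show "c \<in> (\<Pi>\<^sub>E b\<in>B. {i b..i b + 2 * r * L})" by (auto simp: PiE_iff)
      qed
      then have "(\<integral>\<^sup>+c. ?I c z \<partial>N) \<le> (\<integral>\<^sup>+c. indicator (\<Pi>\<^sub>E b\<in>B. {i b..i b + 2 * r * L}) c \<partial>N)"
        by (intro nn_integral_mono) (auto simp: indicator_def)
      also have "\<dots> = emeasure N (\<Pi>\<^sub>E b\<in>B. {i b..i b + 2 * r * L})"
        unfolding N_def using B by (intro nn_integral_indicator sets_PiM_I_finite) auto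
      also have "\<dots> = ennreal (2 * r * L) ^ card B"
        unfolding N_def using B \<open>0 < r\<close> \<open>0 \<le> L\<close> by (intro emeasure_cube) auto
      finally show ?thesis .
    qed
  qed
  let ?v = "ennreal (2 * r) ^ card B"
  \<comment> \<open>The pairs \<open>(c, z)\<close> with \<open>z\<close> within \<open>r\<close> of
    \<open>t c\<close> are counted in two ways: for fixed \<open>c\<close> they fill a cube of
    volume \<open>?v\<close>, for fixed \<open>z\<close> those with \<open>c\<close> in
    \<open>A\<close> have volume at most \<open>L ^ card B * ?v\<close>.\<close>
  have "?v * (\<integral>\<^sup>+c. f c * indicator A c \<partial>N) = (\<integral>\<^sup>+c. f c * indicator A c * ?v \<partial>N)"
    by (subst nn_integral_multc) (auto simp: mult.commute)
  also have "\<dots> = (\<integral>\<^sup>+c. (\<integral>\<^sup>+z. f c * ?I c z \<partial>N) \<partial>N)"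
  proof (rule nn_integral_cong)
    fix c
    have "(\<integral>\<^sup>+z. f c * ?I c z \<partial>N) = (\<integral>\<^sup>+z. (f c * indicator A c) * ?J c z \<partial>N)" by (simp only: mult.assoc)
    also have "\<dots> = f c * indicator A c * ?v" unfolding cube[of c, symmetric] by (intro nn_integral_cmult) measurable
    finally show "f c * indicator A c * ?v = (\<integral>\<^sup>+z. f c * ?I c z \<partial>N)" by simp
  qed
  also have "\<dots> \<le> (\<integral>\<^sup>+c. (\<integral>\<^sup>+z. g z * ?I c z \<partial>N) \<partial>N)"
    using le by (intro nn_integral_mono) (auto simp: indicator_def near_def)
  also have "\<dots> = (\<integral>\<^sup>+z. (\<integral>\<^sup>+c. g z * ?I c z \<partial>N) \<partial>N)"
    by (rule Fubini') measurable
  also have "\<dots> = (\<integral>\<^sup>+z. g z * (\<integral>\<^sup>+c. ?I c z \<partial>N) \<partial>N)"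
    by (intro nn_integral_cong nn_integral_cmult) measurable
  also have "\<dots> \<le> (\<integral>\<^sup>+z. g z * ennreal (2 * r * L) ^ card B \<partial>N)"
    by (intro nn_integral_mono mult_left_mono fibre) auto
  also have "\<dots> = ?v * (ennreal L ^ card B * (\<integral>\<^sup>+z. g z \<partial>N))"
    using \<open>0 < r\<close> \<open>0 \<le> L\<close>
    by (subst nn_integral_multc) (auto simp: ennreal_mult power_mult_distrib mult_ac)
  finally have "?v * (\<integral>\<^sup>+c. f c * indicator A c \<partial>N) \<le> ?v * (ennreal L ^ card B * (\<integral>\<^sup>+z. g z \<partial>N))" .
  moreover have "?v \<noteq> 0" "?v \<noteq> \<top>" using \<open>0 < r\<close> by (auto simp: ennreal_power)
  ultimately show ?thesis
    by (metis ennreal_mult_le_mult_iff)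
qed

section \<open>Laws disintegrated along the subspace, and their shifts\<close>

lemma lincomb_measurable [measurable]:
  fixes B :: "'e::{real_normed_vector, second_countable_topology} set"
  assumes "finite B"
  shows "(\<lambda>c. \<Sum>b\<in>B. c b *\<^sub>R b) \<in> PiM B (\<lambda>_. lborel) \<rightarrow>\<^sub>M borel"
  by measurable

text \<open>In the coordinates of \<open>B\<close> the conditional densities become densities on
  \<open>\<real>^B\<close>, where volumes can be counted. The second claim gives the mass of
  \<open>Q\<close>, against which error terms constant over the fibres are integrated.\<close>

lemma emeasure_disintegration:
  fixes p Q :: "'e::{real_normed_vector, second_countable_topology} measure"
  assumes B: "finite B" and G: "subspace G" and Q: "sets Q = sets (restrict_space borel G)"
    and \<kappa>: "\<kappa> \<in> restrict_space borel G \<rightarrow>\<^sub>M prob_algebra (restrict_space borel (span B))"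
    and p: "p = Q \<bind> (\<lambda>\<eta>. distr (\<kappa> \<eta>) borel (\<lambda>y. \<eta> + y))"
    and dens: "\<And>\<eta>. \<eta> \<in> G \<Longrightarrow> \<kappa> \<eta> = density (lebesgue_span B) (\<lambda>y. ennreal (\<rho> (\<eta> + y)))"
    and \<rho>: "\<rho> \<in> borel_measurable borel" and X: "X \<in> sets borel"
  shows "emeasure p X = (\<integral>\<^sup>+\<eta>. (\<integral>\<^sup>+c. ennreal (\<rho> (\<eta> + (\<Sum>b\<in>B. c b *\<^sub>R b))) *
      indicator X (\<eta> + (\<Sum>b\<in>B. c b *\<^sub>R b)) \<partial>PiM B (\<lambda>_. lborel)) \<partial>Q)"
    and "emeasure p UNIV = emeasure Q (space Q)"
proof -
  let ?N = "PiM B (\<lambda>_. lborel :: real measure)" and ?\<sigma> = "\<lambda>c. \<Sum>b\<in>B. c b *\<^sub>R b"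
  let ?F = "restrict_space borel (span B)"
  have [measurable]: "\<rho> \<in> borel_measurable borel" "X \<in> sets borel" by fact+
  have [measurable]: "?\<sigma> \<in> ?N \<rightarrow>\<^sub>M borel" by (rule lincomb_measurable[OF B])
  have \<sigma>: "?\<sigma> \<in> ?N \<rightarrow>\<^sub>M ?F"
    by (rule measurable_restrict_space2) (simp_all add: span_sum span_scale span_base)
  have spQ: "space Q = G" using sets_eq_imp_space_eq[OF Q] by (simp add: space_restrict_space)
  have ne: "space Q \<noteq> {}" using spQ subspace_0[OF G] by auto
  have \<kappa>Q: "\<kappa> \<in> Q \<rightarrow>\<^sub>M subprob_algebra ?F"
    using \<kappa> by (intro measurable_prob_algebraD) (simp cong: measurable_cong_sets add: Q)
  have kernel: "(\<lambda>\<eta>. distr (\<kappa> \<eta>) borel (\<lambda>y. \<eta> + y)) \<in> Q \<rightarrow>\<^sub>M subprob_algebra borel"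
  proof (rule measurable_distr2[OF _ \<kappa>Q])
    have 1: "fst \<in> Q \<Otimes>\<^sub>M ?F \<rightarrow>\<^sub>M borel"
      by (rule measurable_compose[OF measurable_fst]) (simp cong: measurable_cong_sets add: Q measurable_restrict_space1)
    have 2: "snd \<in> Q \<Otimes>\<^sub>M ?F \<rightarrow>\<^sub>M borel"
      by (rule measurable_compose[OF measurable_snd]) (simp add: measurable_restrict_space1)
    show "(\<lambda>(\<eta>, y). \<eta> + y) \<in> Q \<Otimes>\<^sub>M ?F \<rightarrow>\<^sub>M borel"
      using 1 2 by (simp add: case_prod_beta borel_measurable_add)
  qed
  have em: "emeasure (distr (\<kappa> \<eta>) borel (\<lambda>y. \<eta> + y)) X =
      (\<integral>\<^sup>+c. ennreal (\<rho> (\<eta> + ?\<sigma> c)) * indicator X (\<eta> + ?\<sigma> c) \<partial>?N)" if \<eta>: "\<eta> \<in> G" for \<eta>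
  proof -
    have sets\<kappa>: "sets (\<kappa> \<eta>) = sets ?F" by (simp add: dens[OF \<eta>] lebesgue_span_def)
    have setsl: "sets (lebesgue_span B) = sets ?F" by (simp add: lebesgue_span_def)
    have m: "(\<lambda>y. \<eta> + y) \<in> ?F \<rightarrow>\<^sub>M borel" by (rule measurable_restrict_space1) measurable
    have "emeasure (distr (\<kappa> \<eta>) borel (\<lambda>y. \<eta> + y)) X = (\<integral>\<^sup>+x. indicator X x \<partial>distr (\<kappa> \<eta>) borel (\<lambda>y. \<eta> + y))"
      by simp
    also have "\<dots> = (\<integral>\<^sup>+y. indicator X (\<eta> + y) \<partial>\<kappa> \<eta>)"
      using m sets\<kappa> by (intro nn_integral_distr) (auto cong: measurable_cong_sets)
    also have "\<dots> = (\<integral>\<^sup>+y. ennreal (\<rho> (\<eta> + y)) * indicator X (\<eta> + y) \<partial>lebesgue_span B)"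
      unfolding dens[OF \<eta>]
      by (intro nn_integral_density; subst measurable_cong_sets[OF setsl refl], rule measurable_restrict_space1) measurable
    also have "\<dots> = (\<integral>\<^sup>+c. ennreal (\<rho> (\<eta> + ?\<sigma> c)) * indicator X (\<eta> + ?\<sigma> c) \<partial>?N)"
      unfolding lebesgue_span_def
    proof (rule nn_integral_distr[OF \<sigma>])
      have "(\<lambda>y. ennreal (\<rho> (\<eta> + y)) * indicator X (\<eta> + y)) \<in> borel_measurable ?F"
        by (rule measurable_restrict_space1) measurable
      then show "(\<lambda>y. ennreal (\<rho> (\<eta> + y)) * indicator X (\<eta> + y)) \<in>
        borel_measurable (distr ?N ?F ?\<sigma>)" by simp
    qed
    finally show ?thesis .
  qed
  show "emeasure p X = (\<integral>\<^sup>+\<eta>. (\<integral>\<^sup>+c. ennreal (\<rho> (\<eta> + ?\<sigma> c)) * indicator X (\<eta> + ?\<sigma> c) \<partial>?N) \<partial>Q)"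
    unfolding p using ne kernel X by (subst emeasure_bind) (auto simp: spQ em intro!: nn_integral_cong)
  have "emeasure (distr (\<kappa> \<eta>) borel (\<lambda>y. \<eta> + y)) UNIV = 1" if "\<eta> \<in> G" for \<eta>
  proof -
    have "\<kappa> \<eta> \<in> space (prob_algebra ?F)" using measurable_space[OF \<kappa>] that by (simp add: space_restrict_space)
    then have k: "prob_space (\<kappa> \<eta>)" "sets (\<kappa> \<eta>) = sets ?F" by (auto simp: space_prob_algebra)
    have "(\<lambda>y. \<eta> + y) \<in> ?F \<rightarrow>\<^sub>M borel" by (rule measurable_restrict_space1) measurable
    then have "prob_space (distr (\<kappa> \<eta>) borel (\<lambda>y. \<eta> + y))"
      using k by (intro prob_space.prob_space_distr) (auto cong: measurable_cong_sets)
    then show ?thesis using prob_space.emeasure_space_1 by fastforce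
  qed
  then have "(\<integral>\<^sup>+\<eta>. emeasure (distr (\<kappa> \<eta>) borel (\<lambda>y. \<eta> + y)) UNIV \<partial>Q) = (\<integral>\<^sup>+\<eta>. 1 \<partial>Q)"
    by (intro nn_integral_cong) (simp add: spQ)
  then show "emeasure p UNIV = emeasure Q (space Q)"
    unfolding p using ne kernel by (subst emeasure_bind) auto
qed

text \<open>A chord bound for a convex function on \<open>[0, 1]\<close>, proved by induction with
  the sharper slope \<open>2 ^ n - 1\<close>. It makes the volume factor of the shift linear in the
  size of the shift.\<close>

lemma power_one_add_le:
  fixes u :: real
  assumes "0 \<le> u" "u \<le> 1"
  shows "(1 + u) ^ n \<le> 1 + 2 ^ n * u"
proof -
  have "(1 + u) ^ n \<le> 1 + (2 ^ n - 1) * u"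
  proof (induction n)
    case (Suc n)
    have "(1 + u) ^ Suc n \<le> (1 + (2 ^ n - 1) * u) * (1 + u)"
      using Suc assms by (simp add: mult.commute mult_left_mono)
    also have "\<dots> = 1 + 2 ^ n * u + (2 ^ n - 1) * (u * u)" by (simp add: algebra_simps)
    also have "(2 ^ n - 1) * (u * u) \<le> (2 ^ n - 1) * (u * 1)"
      using assms by (intro mult_left_mono) auto
    finally show ?case by (simp add: algebra_simps)
  qed simp
  also have "\<dots> \<le> 1 + 2 ^ n * u" using assms by (simp add: algebra_simps)
  finally show ?thesis .
qed

text \<open>On a fibre \<open>\<eta> + span B\<close> the shift adds to the coordinates those of
  \<open>\<Phi>\<close>, a perturbation of the identity whose Lipschitz constant in the maximum norm
  is \<open>x \<le> 1 / 2\<close>. Its inverse thus has Lipschitz constant at most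
  \<open>L = 1 + 2 * x\<close>, which gives the factor in front. A point \<open>z\<close> within
  \<open>r\<close> of the shifted coordinates differs from the original point by at most
  \<open>s * r + e\<close>, so the density changes by at most \<open>M * (s * r + e)\<close>; this
  error is integrated over a cube of side \<open>2 * W\<close> only, because \<open>K\<close> is
  bounded. Finally \<open>r\<close> tends to 0.\<close>

lemma shift_bound_compact:
  fixes p Q :: "'e::{banach, second_countable_topology} measure" and \<Phi> :: "'e \<Rightarrow> 'e"
  defines "\<sigma> \<equiv> \<lambda>B c. \<Sum>b\<in>B. c b *\<^sub>R b"
  assumes B: "finite B" and G: "subspace G" and Q: "sets Q = sets (restrict_space borel G)"
    and \<kappa>: "\<kappa> \<in> restrict_space borel G \<rightarrow>\<^sub>M prob_algebra (restrict_space borel (span B))"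
    and p: "p = Q \<bind> (\<lambda>\<eta>. distr (\<kappa> \<eta>) borel (\<lambda>y. \<eta> + y))" and prob: "prob_space p" and sets_p: "sets p = sets borel"
    and dens: "\<And>\<eta>. \<eta> \<in> G \<Longrightarrow> \<kappa> \<eta> = density (lebesgue_span B) (\<lambda>y. ennreal (\<rho> (\<eta> + y)))"
    and \<rho>0: "\<And>\<xi>. 0 \<le> \<rho> \<xi>" and \<rho>: "\<And>\<xi> \<xi>'. \<bar>\<rho> \<xi> - \<rho> \<xi>'\<bar> \<le> M * norm (\<xi> - \<xi>')" and "0 \<le> M"
    and a1: "\<And>b x y. b \<in> B \<Longrightarrow> \<bar>a b x - a b y\<bar> \<le> D * norm (x - y)" and "0 < D"
    and a2: "\<And>b c z. b \<in> B \<Longrightarrow> z \<in> G \<Longrightarrow> a b (z + \<sigma> B c) = c b"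
    and K: "compact K" and KR: "\<And>\<xi>. \<xi> \<in> K \<Longrightarrow> norm \<xi> \<le> R" and "0 \<le> R"
    and \<Phi>c: "continuous_on K \<Phi>" and \<Phi>F: "\<And>\<xi>. \<xi> \<in> K \<Longrightarrow> \<Phi> \<xi> \<in> span B" and \<Phi>e: "\<And>\<xi>. \<xi> \<in> K \<Longrightarrow> norm (\<Phi> \<xi>) \<le> e"
    and \<Phi>L: "\<And>\<xi> \<xi>'. \<xi> \<in> K \<Longrightarrow> \<xi>' \<in> K \<Longrightarrow> norm (\<Phi> \<xi> - \<Phi> \<xi>') \<le> e * norm (\<xi> - \<xi>')"
    and e: "0 \<le> e" "e \<le> 1" and xe: "D * e * (\<Sum>b\<in>B. norm b) \<le> 1 / 2"
    and \<Gamma>: "compact \<Gamma>" "\<Gamma> \<noteq> {}"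
  shows "measure p {\<xi>\<in>K. \<xi> + \<Phi> \<xi> \<in> \<Gamma>} \<le>
    (1 + 2 * (D * e * (\<Sum>b\<in>B. norm b))) ^ card B * (measure p \<Gamma> + M * e * (2 * (1 + D * (R + 1))) ^ card B)"
proof -
  interpret p: prob_space p by fact
  have space_p: "space p = UNIV" using sets_eq_imp_space_eq[OF sets_p] by simp
  define N where "N = PiM B (\<lambda>_. lborel :: real measure)"
  define \<tau> where "\<tau> = \<sigma> B"
  define s where "s = (\<Sum>b\<in>B. norm b)"
  define x where "x = D * e * s"
  define L where "L = 1 + 2 * x"
  \<comment> \<open>The coordinates of a shifted point, whose norm is at most \<open>R + 1\<close>,
    are bounded by \<open>D * (R + 1)\<close>; the additional 1 leaves room for
    \<open>r \<le> 1\<close>.\<close>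
  define W where "W = 1 + D * (R + 1)"
  define T where "T = (\<lambda>\<xi>. \<xi> + \<Phi> \<xi>)"
  define A0 where "A0 = {\<xi>\<in>K. T \<xi> \<in> \<Gamma>}"
  have s0: "0 \<le> s" unfolding s_def by (rule sum_nonneg) simp
  have x: "0 \<le> x" "x \<le> 1 / 2" using e s0 \<open>0 < D\<close> xe by (auto simp: x_def s_def)
  have W0: "0 \<le> W" using \<open>0 < D\<close> \<open>0 \<le> R\<close> by (simp add: W_def)
  have closedK: "closed K" using K by (rule compact_imp_closed)
  have "closed A0" unfolding A0_def T_def
    using \<Phi>c closedK compact_imp_closed[OF \<Gamma>(1)] continuous_closed_preimage[of K "\<lambda>\<xi>. \<xi> + \<Phi> \<xi>" \<Gamma>]
    by (simp add: continuous_on_add vimage_def Int_def conj_commute)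
  then have A0 [measurable]: "A0 \<in> sets borel" by simp
  have infm [measurable]: "(\<lambda>\<xi>. infdist \<xi> \<Gamma>) \<in> borel_measurable borel" by (rule lips_measurable[OF lips_infdist])
  have \<tau>_diff: "\<tau> c - \<tau> c' = \<tau> (\<lambda>b. c b - c' b)" for c c'
    by (simp add: \<tau>_def \<sigma>_def scaleR_left_diff_distrib sum_subtractf)
  have \<tau>_bound: "norm (\<tau> c) \<le> s * m" if "\<And>b. b \<in> B \<Longrightarrow> \<bar>c b\<bar> \<le> m" for c m
  proof -
    have "norm (\<tau> c) \<le> (\<Sum>b\<in>B. m * norm b)"
      unfolding \<tau>_def \<sigma>_def using that by (intro sum_norm_le) (simp add: mult_right_mono)
    then show ?thesis by (simp add: s_def sum_distrib_left mult.commute)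
  qed
  have "M-lipschitz_on UNIV \<rho>" using \<rho> \<open>0 \<le> M\<close> by (intro lipschitz_onI) (auto simp: dist_norm)
  then have \<rho>m [measurable]: "\<rho> \<in> borel_measurable borel"
    by (intro borel_measurable_continuous_onI lipschitz_on_continuous_on)
  have \<tau>m [measurable]: "\<tau> \<in> N \<rightarrow>\<^sub>M borel" unfolding \<tau>_def \<sigma>_def N_def by (rule lincomb_measurable[OF B])
  have am [measurable]: "a b \<in> borel_measurable borel" if "b \<in> B" for b
  proof -
    have "D-lipschitz_on UNIV (a b)" using a1[OF that] \<open>0 < D\<close> by (intro lipschitz_onI) (auto simp: dist_norm)
    then show ?thesis by (intro borel_measurable_continuous_onI lipschitz_on_continuous_on)
  qed
  have T_eq: "T (\<eta> + \<tau> c) = \<eta> + \<tau> (\<lambda>b. c b + a b (\<Phi> (\<eta> + \<tau> c)))" if K: "\<eta> + \<tau> c \<in> K" for \<eta> c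
  proof -
    obtain d where d: "\<Phi> (\<eta> + \<tau> c) = \<tau> d"
      using \<Phi>F[OF K] B by (auto simp: span_finite \<tau>_def \<sigma>_def)
    have "a b (\<tau> d) = d b" if "b \<in> B" for b
      using a2[OF that subspace_0[OF G], of d] by (simp add: \<tau>_def)
    then have "\<tau> (\<lambda>b. c b + a b (\<tau> d)) = \<tau> (\<lambda>b. c b + d b)"
      by (auto simp: \<tau>_def \<sigma>_def intro!: sum.cong)
    then show ?thesis unfolding T_def d by (simp add: \<tau>_def \<sigma>_def scaleR_left_distrib sum.distrib)
  qed
  have fibre: "(\<integral>\<^sup>+c. ennreal (\<rho> (\<eta> + \<tau> c)) * indicator A0 (\<eta> + \<tau> c) \<partial>N) \<le>
      ennreal L ^ card B * ((\<integral>\<^sup>+c. ennreal (\<rho> (\<eta> + \<tau> c)) * indicator {\<xi>. infdist \<xi> \<Gamma> \<le> s * r} (\<eta> + \<tau> c) \<partial>N)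
        + ennreal (M * (s * r + e)) * ennreal (2 * W) ^ card B)"
    if \<eta>: "\<eta> \<in> G" and r: "0 < r" "r \<le> 1" for \<eta> r
  proof -
    \<comment> \<open>The extension by 0 makes the shifted coordinates measurable everywhere and
      agrees with \<open>\<Phi>\<close> at the points that count.\<close>
    define \<Phi>' where "\<Phi>' = (\<lambda>\<xi>. indicator K \<xi> *\<^sub>R \<Phi> \<xi>)"
    have [measurable]: "\<Phi>' \<in> borel_measurable borel"
      unfolding \<Phi>'_def using \<Phi>c closedK by (intro borel_measurable_continuous_on_indicator) auto
    define t where "t = (\<lambda>c b. c b + a b (\<Phi>' (\<eta> + \<tau> c)))"
    define A where "A = {c \<in> space N. \<eta> + \<tau> c \<in> A0}"
    define Z where "Z = (\<Pi>\<^sub>E b\<in>B. {- W..- W + 2 * W})"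
    define g where "g = (\<lambda>z. ennreal (\<rho> (\<eta> + \<tau> z) + M * (s * r + e)) *
      (indicator {\<xi>. infdist \<xi> \<Gamma> \<le> s * r} (\<eta> + \<tau> z) * indicator Z z))"
    have Zm [measurable]: "Z \<in> sets N" unfolding Z_def N_def using B by (intro sets_PiM_I_finite) auto
    have nbhd [measurable]: "{\<xi>. infdist \<xi> \<Gamma> \<le> s * r} \<in> sets borel" by measurable
    have Am [measurable]: "A \<in> sets N" unfolding A_def by measurable
    have comp [measurable]: "(\<lambda>c. c b) \<in> borel_measurable N" if "b \<in> B" for b
      unfolding N_def using that by measurable
    have "(\<integral>\<^sup>+c. ennreal (\<rho> (\<eta> + \<tau> c)) * indicator A c \<partial>N) \<le> ennreal L ^ card B * (\<integral>\<^sup>+z. g z \<partial>N)"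
      unfolding N_def
    proof (rule expanding_map_integral_bound[OF B r(1), where t=t], fold N_def)
      show "0 \<le> L" using x by (simp add: L_def)
      show "A \<in> sets N" "(\<lambda>c. ennreal (\<rho> (\<eta> + \<tau> c))) \<in> borel_measurable N" by measurable
      show "g \<in> borel_measurable N" unfolding g_def by measurable
      show "(\<lambda>c. t c b) \<in> borel_measurable N" if "b \<in> B" for b unfolding t_def using that by measurable
    next
      fix c c' q assume c: "c \<in> A" "c' \<in> A" and q: "\<And>b. b \<in> B \<Longrightarrow> \<bar>t c b - t c' b\<bar> \<le> q" "0 \<le> q"
      show "\<forall>b\<in>B. \<bar>c b - c' b\<bar> \<le> L * q"
      proof (cases "B = {}")
        case False
        \<comment> \<open>The estimate is made at a coordinate with the largest difference: there
          the perturbation takes away at most \<open>x * m\<close>, so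
          \<open>m \<le> q + x * m\<close>.\<close>
        define m where "m = Max ((\<lambda>b. \<bar>c b - c' b\<bar>) ` B)"
        have le_m: "\<bar>c b - c' b\<bar> \<le> m" if "b \<in> B" for b unfolding m_def using B that by simp
        have "m \<in> (\<lambda>b. \<bar>c b - c' b\<bar>) ` B" unfolding m_def using B False by (intro Max_in) auto
        then obtain b where b: "b \<in> B" "m = \<bar>c b - c' b\<bar>" by blast
        have K: "\<eta> + \<tau> c \<in> K" "\<eta> + \<tau> c' \<in> K" using c by (auto simp: A_def A0_def)
        have "\<bar>a b (\<Phi> (\<eta> + \<tau> c)) - a b (\<Phi> (\<eta> + \<tau> c'))\<bar> \<le> D * norm (\<Phi> (\<eta> + \<tau> c) - \<Phi> (\<eta> + \<tau> c'))"
          by (rule a1[OF b(1)])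
        also have "\<dots> \<le> D * (e * norm ((\<eta> + \<tau> c) - (\<eta> + \<tau> c')))"
          using \<open>0 < D\<close> by (intro mult_left_mono \<Phi>L K) auto
        also have "(\<eta> + \<tau> c) - (\<eta> + \<tau> c') = \<tau> (\<lambda>b. c b - c' b)" by (simp add: \<tau>_diff)
        also have "D * (e * norm (\<tau> (\<lambda>b. c b - c' b))) \<le> D * (e * (s * m))"
          using \<open>0 < D\<close> e le_m by (intro mult_left_mono \<tau>_bound) auto
        also have "\<dots> = x * m" by (simp add: x_def mult_ac)
        finally have "m \<le> q + x * m"
          using q(1)[OF b(1)] b(2) K by (simp add: t_def \<Phi>'_def)
        moreover have "0 \<le> m" using b by simp
        ultimately have "m * (1 - x) \<le> q" by (simp add: algebra_simps)
        then have "m * (1 - x) * L \<le> q * L" using x by (intro mult_right_mono) (auto simp: L_def)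
        moreover have "1 \<le> (1 - x) * L" using x by (simp add: L_def algebra_simps mult_left_le)
        then have "m * 1 \<le> m * ((1 - x) * L)" using \<open>0 \<le> m\<close> by (intro mult_left_mono)
        ultimately have "m \<le> L * q" by (simp add: mult_ac)
        then show ?thesis using le_m by (auto intro: order_trans)
      qed simp
    next
      fix c z assume c: "c \<in> A" and z: "z \<in> space N" and near: "\<And>b. b \<in> B \<Longrightarrow> \<bar>z b - t c b\<bar> < r"
      have K: "\<eta> + \<tau> c \<in> K" "T (\<eta> + \<tau> c) \<in> \<Gamma>" using c by (auto simp: A_def A0_def)
      have T: "T (\<eta> + \<tau> c) = \<eta> + \<tau> (t c)" using T_eq[OF K(1)] K by (simp add: t_def \<Phi>'_def)
      have nT: "norm ((\<eta> + \<tau> z) - T (\<eta> + \<tau> c)) \<le> s * r"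
        unfolding T using near by (simp add: \<tau>_diff less_imp_le \<tau>_bound)
      have "infdist (\<eta> + \<tau> z) \<Gamma> \<le> s * r"
        using nT by (intro infdist_le2[OF K(2)]) (simp add: dist_norm)
      moreover have "\<bar>z b\<bar> \<le> W" if b: "b \<in> B" for b
      proof -
        have "a b 0 = 0" using a2[OF b subspace_0[OF G], of "\<lambda>_. 0"] by (simp add: \<sigma>_def)
        moreover have "a b (T (\<eta> + \<tau> c)) = t c b"
          unfolding T using a2[OF b \<eta>, of "t c"] by (simp only: \<tau>_def)
        ultimately have "\<bar>t c b\<bar> \<le> D * norm (T (\<eta> + \<tau> c))"
          using a1[OF b, of "T (\<eta> + \<tau> c)" 0] by simp
        also have "\<dots> \<le> D * (R + 1)"
          using norm_triangle_ineq[of "\<eta> + \<tau> c" "\<Phi> (\<eta> + \<tau> c)"] KR[OF K(1)] \<Phi>e[OF K(1)] e \<open>0 < D\<close>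
          by (intro mult_left_mono) (auto simp: T_def)
        finally show ?thesis using near[OF b] r unfolding W_def by linarith
      qed
      then have "z \<in> Z" using z by (force simp: Z_def N_def space_PiM PiE_iff abs_le_iff)
      moreover have "\<rho> (\<eta> + \<tau> c) \<le> \<rho> (\<eta> + \<tau> z) + M * (s * r + e)"
      proof -
        have "norm ((\<eta> + \<tau> c) - (\<eta> + \<tau> z)) \<le> s * r + e"
          using norm_triangle_ineq4[of "T (\<eta> + \<tau> c) - (\<eta> + \<tau> z)" "\<Phi> (\<eta> + \<tau> c)"] nT \<Phi>e[OF K(1)]
          by (simp add: T_def norm_minus_commute algebra_simps)
        then have "M * norm ((\<eta> + \<tau> c) - (\<eta> + \<tau> z)) \<le> M * (s * r + e)"
          using \<open>0 \<le> M\<close> by (rule mult_left_mono)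
        then show ?thesis using \<rho>[of "\<eta> + \<tau> c" "\<eta> + \<tau> z"] by linarith
      qed
      ultimately show "ennreal (\<rho> (\<eta> + \<tau> c)) \<le> g z" by (simp add: g_def ennreal_leI)
    qed
    also have "(\<integral>\<^sup>+z. g z \<partial>N) \<le> (\<integral>\<^sup>+z. ennreal (\<rho> (\<eta> + \<tau> z)) * indicator {\<xi>. infdist \<xi> \<Gamma> \<le> s * r} (\<eta> + \<tau> z)
        + ennreal (M * (s * r + e)) * indicator Z z \<partial>N)"
      using \<rho>0 \<open>0 \<le> M\<close> e s0 r by (intro nn_integral_mono) (auto simp: g_def indicator_def ennreal_plus)
    also have "\<dots> = (\<integral>\<^sup>+z. ennreal (\<rho> (\<eta> + \<tau> z)) * indicator {\<xi>. infdist \<xi> \<Gamma> \<le> s * r} (\<eta> + \<tau> z) \<partial>N)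
        + ennreal (M * (s * r + e)) * emeasure N Z"
      by (subst nn_integral_add) (auto simp: nn_integral_cmult_indicator)
    also have "emeasure N Z = ennreal (2 * W) ^ card B"
      unfolding N_def Z_def using B W0 by (intro emeasure_cube) auto
    finally show ?thesis
      by (simp add: A_def indicator_def mult_left_mono cong: nn_integral_cong_simp)
  qed
  have sf: "sigma_finite_measure N"
  proof -
    interpret product_sigma_finite "\<lambda>_::'e. lborel :: real measure" by standard
    show ?thesis unfolding N_def by (rule sigma_finite[OF B])
  qed
  have Q_one: "emeasure Q (space Q) = 1"
    using emeasure_disintegration(2)[OF B G Q \<kappa> p dens \<rho>m sets.top] p.emeasure_space_1 space_p by simp
  have p_eq: "emeasure p X = (\<integral>\<^sup>+\<eta>. (\<integral>\<^sup>+c. ennreal (\<rho> (\<eta> + \<tau> c)) * indicator X (\<eta> + \<tau> c) \<partial>N) \<partial>Q)"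
    if "X \<in> sets borel" for X
    using emeasure_disintegration(1)[OF B G Q \<kappa> p dens \<rho>m that] by (simp add: \<tau>_def \<sigma>_def N_def)
  have total: "measure p A0 \<le> L ^ card B * (measure p {\<xi>. infdist \<xi> \<Gamma> \<le> s * r} + M * (s * r + e) * (2 * W) ^ card B)"
    if r: "0 < r" "r \<le> 1" for r
  proof -
    interpret sigma_finite_measure N by (rule sf)
    let ?X = "{\<xi>. infdist \<xi> \<Gamma> \<le> s * r}"
    have X [measurable]: "?X \<in> sets borel" by measurable
    have [measurable]: "(\<lambda>\<eta>. \<eta>) \<in> Q \<rightarrow>\<^sub>M borel"
      by (simp cong: measurable_cong_sets add: Q measurable_restrict_space1)
    have m: "(\<lambda>\<eta>. \<integral>\<^sup>+c. ennreal (\<rho> (\<eta> + \<tau> c)) * indicator ?X (\<eta> + \<tau> c) \<partial>N) \<in> borel_measurable Q"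
      by measurable
    have spQ: "space Q = G" using sets_eq_imp_space_eq[OF Q] by (simp add: space_restrict_space)
    let ?c = "ennreal (M * (s * r + e)) * ennreal (2 * W) ^ card B"
    have nonneg: "0 \<le> L" "0 \<le> M * (s * r + e)" "0 \<le> 2 * W"
      using x r e s0 \<open>0 \<le> M\<close> W0 by (auto simp: L_def)
    have "emeasure p A0 \<le> (\<integral>\<^sup>+\<eta>. ennreal L ^ card B *
       ((\<integral>\<^sup>+c. ennreal (\<rho> (\<eta> + \<tau> c)) * indicator ?X (\<eta> + \<tau> c) \<partial>N) + ?c) \<partial>Q)"
      unfolding p_eq[OF A0] using fibre r by (intro nn_integral_mono) (auto simp: spQ)
    also have "\<dots> = ennreal L ^ card B * (emeasure p ?X + ?c)"
      using m by (subst nn_integral_cmult) (auto simp: nn_integral_add p_eq[OF X] Q_one)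
    also have "\<dots> = ennreal (L ^ card B * (measure p ?X + M * (s * r + e) * (2 * W) ^ card B))"
      by (simp only: p.emeasure_eq_measure ennreal_power ennreal_mult[symmetric] ennreal_plus[symmetric]
        mult_nonneg_nonneg zero_le_power add_nonneg_nonneg measure_nonneg nonneg)
    finally show ?thesis
      by (simp only: p.emeasure_eq_measure ennreal_le_iff
        mult_nonneg_nonneg zero_le_power add_nonneg_nonneg measure_nonneg nonneg)
  qed
  \<comment> \<open>The closed neighbourhoods of \<open>\<Gamma>\<close> decrease to
    \<open>\<Gamma>\<close> itself because \<open>\<Gamma>\<close> is closed and nonempty.\<close>
  have lim: "(\<lambda>n. L ^ card B * (measure p {\<xi>. infdist \<xi> \<Gamma> \<le> s * (1 / real (Suc n))} + M * (s * (1 / real (Suc n)) + e) * (2 * W) ^ card B))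
     \<longlonglongrightarrow> L ^ card B * (measure p \<Gamma> + M * (s * 0 + e) * (2 * W) ^ card B)"
  proof -
    let ?A = "\<lambda>n. {\<xi>. infdist \<xi> \<Gamma> \<le> s * (1 / real (Suc n))}"
    have inv: "(\<lambda>n. 1 / real (Suc n)) \<longlonglongrightarrow> 0" using LIMSEQ_inverse_real_of_nat by (simp add: inverse_eq_divide)
    have "(\<Inter>n. ?A n) = \<Gamma>"
    proof safe
      fix \<xi> assume "\<xi> \<in> (\<Inter>n. ?A n)"
      then have "infdist \<xi> \<Gamma> \<le> s * 0"
        by (intro LIMSEQ_le_const[OF tendsto_mult[OF tendsto_const inv]]) auto
      then show "\<xi> \<in> \<Gamma>" using \<Gamma> infdist_nonneg[of \<xi> \<Gamma>] in_closed_iff_infdist_zero[of \<Gamma> \<xi>] by (auto simp: compact_imp_closed)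
    qed (use s0 in auto)
    moreover have "(\<lambda>n. measure p (?A n)) \<longlonglongrightarrow> measure p (\<Inter>n. ?A n)"
    proof (rule p.finite_Lim_measure_decseq)
      have "?A n \<in> p.events" for n unfolding sets_p by measurable
      then show "range ?A \<subseteq> p.events" by blast
      have "s * (1 / real (Suc (Suc n))) \<le> s * (1 / real (Suc n))" for n
        using s0 by (intro mult_left_mono) (auto simp: field_simps)
      then show "decseq ?A" by (intro decseq_SucI) (auto intro: order_trans)
    qed
    ultimately show ?thesis by (intro tendsto_intros inv) simp
  qed
  have "measure p A0 \<le> L ^ card B * (measure p \<Gamma> + M * (s * 0 + e) * (2 * W) ^ card B)"
    by (rule LIMSEQ_le_const[OF lim]) (intro exI[of _ 0] allI impI total; simp)
  then show ?thesis by (simp add: A0_def T_def L_def x_def W_def s_def)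
qed

text \<open>A compact set inside the preimage of \<open>X\<close> is shifted onto a compact subset
  of \<open>X\<close>, to which the compact case applies; inner regularity then gives the preimage
  itself. The constants are uniform in \<open>U\<close> because \<open>M\<close>, the coordinate
  bound \<open>D\<close> and the radius \<open>R\<close> of \<open>K\<close> are.\<close>

lemma DLP_shift_bound:
  fixes p :: "'x::metric_space \<Rightarrow> 'e::{banach, second_countable_topology} measure"
  assumes dlp: "DLP p F" and K: "compact K" and p: "\<And>U. p U \<in> space (prob_algebra borel)"
  shows "\<exists>c>0. \<exists>e0>0. \<forall>U \<Phi> e X. 0 \<le> e \<and> e \<le> e0 \<and> continuous_on K \<Phi> \<and>
      (\<forall>\<xi>\<in>K. \<Phi> \<xi> \<in> F \<and> norm (\<Phi> \<xi>) \<le> e) \<and>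
      (\<forall>\<xi>\<in>K. \<forall>\<xi>'\<in>K. norm (\<Phi> \<xi> - \<Phi> \<xi>') \<le> e * norm (\<xi> - \<xi>')) \<and> X \<in> sets borel \<longrightarrow>
      {\<xi>\<in>K. \<xi> + \<Phi> \<xi> \<in> X} \<in> sets borel \<and>
      measure (p U) {\<xi>\<in>K. \<xi> + \<Phi> \<xi> \<in> X} \<le> measure (p U) X + c * e"
proof -
  from dlp obtain G B \<kappa> \<rho> M where
    G: "subspace G" "closed G" "F \<inter> G = {0}" "\<forall>x. \<exists>y\<in>F. \<exists>z\<in>G. x = y + z" and
    B: "finite B" "independent B" "span B = F" and
    \<kappa>: "\<forall>U. \<kappa> U \<in> restrict_space borel G \<rightarrow>\<^sub>M prob_algebra (restrict_space borel F)" and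
    pU: "\<forall>U. p U = distr (p U) (restrict_space borel G) (proj_along G F) \<bind>
                     (\<lambda>\<eta>. distr (\<kappa> U \<eta>) borel (\<lambda>y. \<eta> + y))" and
    \<rho>0: "\<forall>U \<xi>. 0 \<le> \<rho> U \<xi>" and "M > 0" and
    \<rho>: "\<forall>U U' \<xi> \<xi>'. \<bar>\<rho> U \<xi> - \<rho> U' \<xi>'\<bar> \<le> M * (dist U U' + norm (\<xi> - \<xi>'))" and
    dens: "\<forall>U. \<forall>\<eta>\<in>G. \<kappa> U \<eta> = density (lebesgue_span B) (\<lambda>y. ennreal (\<rho> U (\<eta> + y)))"
    unfolding DLP_def by (elim exE conjE) (rule that; assumption)
  obtain a D where "0 < D" and a: "\<forall>b\<in>B. \<forall>x y. \<bar>a b x - a b y\<bar> \<le> D * norm (x - y)"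
    "\<forall>b\<in>B. \<forall>c. \<forall>z\<in>G. a b (z + (\<Sum>b\<in>B. c b *\<^sub>R b)) = c b"
    using bounded_coordinates[OF B(1,2) G(1,2)] unfolding B(3) using G(3,4) by auto
  have a1: "\<And>b x y. b \<in> B \<Longrightarrow> \<bar>a b x - a b y\<bar> \<le> D * norm (x - y)"
    and a2: "\<And>b c z. b \<in> B \<Longrightarrow> z \<in> G \<Longrightarrow> a b (z + (\<Sum>b\<in>B. c b *\<^sub>R b)) = c b"
    using a by blast+
  obtain R where R: "0 < R" "\<And>\<xi>. \<xi> \<in> K \<Longrightarrow> norm \<xi> \<le> R"
    using compact_imp_bounded[OF K] by (auto simp: bounded_pos)
  define y where "y = D * (\<Sum>b\<in>B. norm b)"
  have y0: "0 \<le> y" using \<open>0 < D\<close> unfolding y_def by (intro mult_nonneg_nonneg sum_nonneg) auto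
  define V where "V = M * (2 * (1 + D * (R + 1))) ^ card B"
  have V0: "0 \<le> V" using \<open>0 < M\<close> \<open>0 < D\<close> \<open>0 < R\<close> by (simp add: V_def)
  \<comment> \<open>This keeps \<open>y * e\<close> below 1 / 2, where the shift is invertible on
    the fibres, and \<open>e\<close> below 1.\<close>
  define e0 where "e0 = 1 / (2 * (1 + y))"
  \<comment> \<open>The coefficients come from multiplying out the compact bound, with
    \<open>2 * (y * e)\<close> and the measure of \<open>\<Gamma>\<close> estimated by 1; the
    leading 1 makes \<open>c\<close> positive.\<close>
  define c where "c = 1 + (2 ^ card B * (2 * y) + (1 + 2 ^ card B) * V)"
  have "0 < e0" using y0 by (simp add: e0_def)
  have "0 < c" unfolding c_def using y0 V0 by (intro add_pos_nonneg add_nonneg_nonneg) auto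
  have main: "{\<xi>\<in>K. \<xi> + \<Phi> \<xi> \<in> X} \<in> sets borel \<and> measure (p U) {\<xi>\<in>K. \<xi> + \<Phi> \<xi> \<in> X} \<le> measure (p U) X + c * e"
    if e: "0 \<le> e" "e \<le> e0" and \<Phi>c: "continuous_on K \<Phi>" and \<Phi>: "\<And>\<xi>. \<xi> \<in> K \<Longrightarrow> \<Phi> \<xi> \<in> F"
      "\<And>\<xi>. \<xi> \<in> K \<Longrightarrow> norm (\<Phi> \<xi>) \<le> e"
      "\<And>\<xi> \<xi>'. \<xi> \<in> K \<Longrightarrow> \<xi>' \<in> K \<Longrightarrow> norm (\<Phi> \<xi> - \<Phi> \<xi>') \<le> e * norm (\<xi> - \<xi>')"
      and X: "X \<in> sets borel" for U e \<Phi> X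
  proof -
    have prob: "prob_space (p U)" and sets_p: "sets (p U) = sets borel"
      using p[of U] by (auto simp: space_prob_algebra)
    interpret p: prob_space "p U" by (rule prob)
    have T: "continuous_on K (\<lambda>\<xi>. \<xi> + \<Phi> \<xi>)" by (intro continuous_intros \<Phi>c)
    have A': "{\<xi>\<in>K. \<xi> + \<Phi> \<xi> \<in> Y} \<in> sets borel" if X: "Y \<in> sets borel" for Y
    proof -
      have "(\<lambda>\<xi>. \<xi> + \<Phi> \<xi>) -` Y \<inter> space (restrict_space borel K) \<in> sets (restrict_space borel K)"
        by (rule measurable_sets[OF borel_measurable_continuous_on_restrict[OF T] X])
      moreover have "(\<lambda>\<xi>. \<xi> + \<Phi> \<xi>) -` Y \<inter> space (restrict_space borel K) = {\<xi>\<in>K. \<xi> + \<Phi> \<xi> \<in> Y}"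
        by (auto simp: space_restrict_space)
      ultimately show ?thesis using K compact_imp_closed
        by (metis borel_closed sets.Int_space_eq2 sets_restrict_space_iff)
    qed
    note A = A'[OF X]
    have ye: "y * e \<le> 1 / 2"
    proof -
      have "y * e \<le> y * e0" using y0 e by (intro mult_left_mono)
      also have "\<dots> \<le> 1 / 2" using y0 by (simp add: e0_def field_simps)
      finally show ?thesis .
    qed
    have "e0 \<le> 1" using y0 by (simp add: e0_def field_simps)
    then have e1: "e \<le> 1" using e by simp
    have cpt: "measure (p U) {\<xi>\<in>K. \<xi> + \<Phi> \<xi> \<in> \<Gamma>} \<le> measure (p U) \<Gamma> + c * e" if \<Gamma>: "compact \<Gamma>" "\<Gamma> \<noteq> {}" for \<Gamma>
    proof -
      have \<rho>U: "\<bar>\<rho> U \<xi> - \<rho> U \<xi>'\<bar> \<le> M * norm (\<xi> - \<xi>')" for \<xi> \<xi>' using \<rho>[rule_format, of U \<xi> U \<xi>'] by simp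
      have "measure (p U) {\<xi>\<in>K. \<xi> + \<Phi> \<xi> \<in> \<Gamma>} \<le> (1 + 2 * (D * e * (\<Sum>b\<in>B. norm b))) ^ card B *
          (measure (p U) \<Gamma> + M * e * (2 * (1 + D * (R + 1))) ^ card B)"
      proof (rule shift_bound_compact[OF B(1) G(1) _ _ pU[rule_format] prob sets_p dens[rule_format] \<rho>0[rule_format] \<rho>U _ a1 _ a2 K R(2) _ \<Phi>c _ \<Phi>(2,3) _ _ _ \<Gamma>])
        show "D * e * (\<Sum>b\<in>B. norm b) \<le> 1 / 2" using ye by (simp add: y_def mult_ac)
      qed (use \<kappa> B(3) \<Phi>(1) e e1 \<open>0 < M\<close> \<open>0 < D\<close> \<open>0 < R\<close> in auto)
      also have "\<dots> = (1 + 2 * (y * e)) ^ card B * (measure (p U) \<Gamma> + V * e)"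
        by (simp add: y_def V_def mult_ac)
      also have "\<dots> \<le> (1 + 2 ^ card B * (2 * (y * e))) * (measure (p U) \<Gamma> + V * e)"
        using ye y0 e V0 by (intro mult_right_mono power_one_add_le) auto
      also have "\<dots> = measure (p U) \<Gamma> + 2 ^ card B * (2 * (y * e)) * measure (p U) \<Gamma> + (1 + 2 ^ card B * (2 * (y * e))) * (V * e)"
        by (simp add: algebra_simps)
      also have "\<dots> \<le> measure (p U) \<Gamma> + 2 ^ card B * (2 * (y * e)) * 1 + (1 + 2 ^ card B * 1) * (V * e)"
        using ye y0 e V0 by (intro add_mono mult_mono order_refl) auto
      also have "\<dots> \<le> measure (p U) \<Gamma> + c * e" using e by (simp add: c_def algebra_simps)
      finally show ?thesis .
    qed
    have fin: "emeasure (p U) (space (p U)) \<noteq> \<infinity>" by simp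
    have "emeasure (p U) {\<xi>\<in>K. \<xi> + \<Phi> \<xi> \<in> X} \<le> ennreal (measure (p U) X + c * e)"
      unfolding inner_regular[OF sets_p fin A]
    proof (rule SUP_least, clarify)
      fix C assume C: "C \<subseteq> {\<xi>\<in>K. \<xi> + \<Phi> \<xi> \<in> X}" "compact C"
      show "emeasure (p U) C \<le> ennreal (measure (p U) X + c * e)"
      proof (cases "C = {}")
        case False
        let ?\<Gamma> = "(\<lambda>\<xi>. \<xi> + \<Phi> \<xi>) ` C"
        have \<Gamma>: "compact ?\<Gamma>" "?\<Gamma> \<noteq> {}"
          using C False continuous_on_subset[OF T] by (auto intro!: compact_continuous_image)
        have \<Gamma>b: "?\<Gamma> \<in> sets borel" by (intro borel_closed compact_imp_closed \<Gamma>)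
        have "measure (p U) C \<le> measure (p U) {\<xi>\<in>K. \<xi> + \<Phi> \<xi> \<in> ?\<Gamma>}"
          using C A'[OF \<Gamma>b] sets_p by (intro p.finite_measure_mono) auto
        also have "\<dots> \<le> measure (p U) ?\<Gamma> + c * e" by (rule cpt[OF \<Gamma>])
        also have "\<dots> \<le> measure (p U) X + c * e"
          using C X sets_p by (intro add_right_mono p.finite_measure_mono) auto
        finally show ?thesis by (simp add: p.emeasure_eq_measure ennreal_leI)
      qed simp
    qed
    moreover have "0 \<le> measure (p U) X + c * e" using e \<open>0 < c\<close> by simp
    ultimately show ?thesis using A by (simp add: p.emeasure_eq_measure del: ennreal_plus)
  qed
  show ?thesis
    using \<open>0 < c\<close> \<open>0 < e0\<close> main by (intro exI[of _ c] exI[of _ e0] conjI allI impI) blast+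
qed

subsection \<open>The Markov operator\<close>

text \<open>The open null sets cover the complement of the support, and by Lindelof's theorem
  countably many of them already do.\<close>

lemma emeasure_outside_measure_supp:
  fixes \<mu> :: "'a::second_countable_topology measure"
  assumes sets: "sets \<mu> = sets borel" and supp: "measure_supp \<mu> \<subseteq> K"
  shows "emeasure \<mu> (- K) = 0"
proof -
  let ?\<G> = "{G. open G \<and> emeasure \<mu> G = 0}"
  have "open G" if "G \<in> ?\<G>" for G using that by simp
  then obtain \<H> where \<H>: "\<H> \<subseteq> ?\<G>" "countable \<H>" "\<Union>\<H> = \<Union>?\<G>" by (rule Lindelof)
  have "x \<in> \<Union>?\<G>" if "x \<notin> K" for x
  proof -
    have "x \<notin> measure_supp \<mu>" using that supp by blast
    then obtain G where "open G" "x \<in> G" "\<not> 0 < emeasure \<mu> G" unfolding measure_supp_def by blast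
    then show ?thesis by auto
  qed
  then have sub: "- K \<subseteq> (\<Union>G\<in>\<H>. G)" using \<H>(3) by auto
  have null: "(\<Union>G\<in>\<H>. G) \<in> null_sets \<mu>"
  proof (rule null_sets_UN'[OF \<H>(2)])
    fix G assume "G \<in> \<H>"
    then have "open G" "emeasure \<mu> G = 0" using \<H>(1) by auto
    then show "G \<in> null_sets \<mu>" using sets by (intro null_setsI) auto
  qed
  have "emeasure \<mu> (- K) \<le> emeasure \<mu> (\<Union>G\<in>\<H>. G)" using sub null by (intro emeasure_mono) auto
  then show ?thesis using null by (simp add: null_setsD1)
qed

locale rds =
  fixes S :: "'x::{metric_space, second_countable_topology} \<Rightarrow> 'e::{banach, second_countable_topology} \<Rightarrow> 'x"
    and p :: "'x \<Rightarrow> 'e measure" and K :: "'e set"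
  assumes compact_space: "compact (UNIV :: 'x set)"
    and p_measurable [measurable]: "p \<in> borel \<rightarrow>\<^sub>M prob_algebra borel"
    and compact_K: "compact K"
    and S_lipschitz: "\<exists>L. \<forall>U U'. \<forall>\<xi>\<in>K. \<forall>\<xi>'\<in>K. dist (S U \<xi>) (S U' \<xi>') \<le> L * (dist U U' + norm (\<xi> - \<xi>'))"
    and supp_p: "\<And>U. measure_supp (p U) \<subseteq> K"
begin

text \<open>A Borel extension of \<open>S\<close> beyond \<open>K\<close>. The value
  \<open>U\<close> is arbitrary and does not influence any law, since \<open>p U\<close> is carried
  by \<open>K\<close>.\<close>

definition S' :: "'x \<Rightarrow> 'e \<Rightarrow> 'x" where
  "S' U \<xi> = (if \<xi> \<in> K then S U \<xi> else U)"

definition P :: "('x \<Rightarrow> real) \<Rightarrow> 'x \<Rightarrow> real" where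
  "P f U = (\<integral>\<xi>. f (S' U \<xi>) \<partial>p U)"

lemma p_prob: "p U \<in> space (prob_algebra borel)"
  using measurable_space[OF p_measurable, of U] by simp

lemma prob_p: "prob_space (p U)" and sets_p [simp, measurable_cong]: "sets (p U) = sets borel"
  using p_prob[of U] by (auto simp: space_prob_algebra)

lemma space_p [simp]: "space (p U) = UNIV"
  using sets_eq_imp_space_eq[OF sets_p] by simp

lemma closed_K: "closed K"
  using compact_K by (rule compact_imp_closed)

lemma K_borel [measurable]: "K \<in> sets borel"
  using closed_K by simp

lemma AE_K: "AE \<xi> in p U. \<xi> \<in> K"
  by (rule AE_I[of _ _ "- K"]) (auto simp: emeasure_outside_measure_supp[OF sets_p supp_p])

lemma measure_K: "measure (p U) K = 1"
  using prob_space.prob_eq_1[OF prob_p, of K U] AE_K by simp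

lemma continuous_S: "continuous_on (UNIV \<times> K) (\<lambda>(U, \<xi>). S U \<xi>)"
proof -
  obtain L where L: "\<And>U U' \<xi> \<xi>'. \<xi> \<in> K \<Longrightarrow> \<xi>' \<in> K \<Longrightarrow> dist (S U \<xi>) (S U' \<xi>') \<le> L * (dist U U' + norm (\<xi> - \<xi>'))"
    using S_lipschitz by blast
  show ?thesis
  proof (rule lipschitz_on_continuous_on[of "2 * \<bar>L\<bar>"], rule lipschitz_onI)
    fix a b :: "'x \<times> 'e" assume ab: "a \<in> UNIV \<times> K" "b \<in> UNIV \<times> K"
    have "dist (S (fst a) (snd a)) (S (fst b) (snd b)) \<le> L * (dist (fst a) (fst b) + norm (snd a - snd b))"
      using ab by (intro L) auto
    also have "\<dots> \<le> \<bar>L\<bar> * (dist (fst a) (fst b) + norm (snd a - snd b))" by (intro mult_right_mono) auto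
    also have "\<dots> \<le> \<bar>L\<bar> * (dist a b + dist a b)"
      using dist_fst_le[of a b] dist_snd_le[of a b] by (intro mult_left_mono add_mono) (auto simp: dist_norm)
    finally show "dist (case a of (U, \<xi>) \<Rightarrow> S U \<xi>) (case b of (U, \<xi>) \<Rightarrow> S U \<xi>) \<le> 2 * \<bar>L\<bar> * dist a b"
      by (simp add: case_prod_beta)
  qed auto
qed

lemma S'_measurable [measurable]: "(\<lambda>(U, \<xi>). S' U \<xi>) \<in> borel \<Otimes>\<^sub>M borel \<rightarrow>\<^sub>M borel"
proof -
  have "(\<lambda>z. if z \<in> UNIV \<times> K then (\<lambda>(U, \<xi>). S U \<xi>) z else fst z) \<in> borel_measurable borel"
    using closed_K continuous_S
    by (intro borel_measurable_continuous_on_if) (auto intro!: borel_closed closed_Times continuous_intros)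
  moreover have "(\<lambda>z. if z \<in> UNIV \<times> K then (\<lambda>(U, \<xi>). S U \<xi>) z else fst z) = (\<lambda>(U, \<xi>). S' U \<xi>)"
    by (auto simp: S'_def)
  ultimately show ?thesis by (simp add: borel_prod)
qed

lemma S'_measurable1 [measurable]: "S' U \<in> borel \<rightarrow>\<^sub>M borel"
  using measurable_Pair2[OF S'_measurable, of U] by simp

lemma P1_eq: "P1 S p K U = distr (p U) borel (S' U)"
proof (rule measure_eqI)
  fix A assume "A \<in> sets (P1 S p K U)"
  then have A [measurable]: "A \<in> sets borel" by (simp add: P1_def)
  have S'K: "S' U \<in> restrict_space (p U) K \<rightarrow>\<^sub>M borel"
    by (rule measurable_restrict_space1) measurable
  have "P1 S p K U = distr (restrict_space (p U) K) borel (S' U)"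
    unfolding P1_def by (rule distr_cong) (auto simp: space_restrict_space S'_def)
  then have "emeasure (P1 S p K U) A = emeasure (restrict_space (p U) K) (S' U -` A \<inter> K)"
    using S'K by (simp add: emeasure_distr space_restrict_space)
  also have "\<dots> = emeasure (p U) (S' U -` A \<inter> K)" by (rule emeasure_restrict_space) auto
  also have "\<dots> = emeasure (p U) (S' U -` A)"
  proof (rule emeasure_eq_AE)
    show "AE \<xi> in p U. (\<xi> \<in> S' U -` A \<inter> K) = (\<xi> \<in> S' U -` A)" using AE_K by eventually_elim simp
    show "S' U -` A \<inter> K \<in> sets (p U)" "S' U -` A \<in> sets (p U)"
      using measurable_sets_borel[OF S'_measurable1 A] by auto
  qed
  finally show "emeasure (P1 S p K U) A = emeasure (distr (p U) borel (S' U)) A"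
    by (simp add: emeasure_distr)
qed (simp add: P1_def)

lemma P1_measurable [measurable]: "P1 S p K \<in> borel \<rightarrow>\<^sub>M prob_algebra borel"
proof -
  have "(\<lambda>U. distr (p U) borel (S' U)) \<in> borel \<rightarrow>\<^sub>M prob_algebra borel"
    by (rule measurable_distr_prob_space2) measurable
  then show ?thesis by (simp add: P1_eq[abs_def])
qed

lemma integral_P1: "f \<in> borel_measurable borel \<Longrightarrow> (\<integral>x. f x \<partial>P1 S p K U) = P f U"
  unfolding P1_eq P_def by (rule integral_distr) measurable

lemma integrable_S': "(f :: 'x \<Rightarrow> real) \<in> borel_measurable borel \<Longrightarrow> (\<And>x. \<bar>f x\<bar> \<le> c) \<Longrightarrow> integrable (p U) (\<lambda>\<xi>. f (S' U \<xi>))"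
  using prob_p[of U] by (intro finite_measure.integrable_const_bound[where B=c]) (auto simp: prob_space_def)

lemma lips_bounded: "f \<in> lips \<Longrightarrow> \<exists>c>0. \<forall>x::'x. \<bar>f x\<bar> \<le> c"
  using compact_imp_bounded[OF compact_continuous_image[OF lips_continuous compact_space]]
  by (force simp: bounded_pos)

lemma lips_integrable_S': "f \<in> lips \<Longrightarrow> integrable (p U) (\<lambda>\<xi>. f (S' U \<xi>))"
  using lips_bounded integrable_S'[OF lips_measurable] by meson

lemma P_add: "f \<in> lips \<Longrightarrow> g \<in> lips \<Longrightarrow> P (\<lambda>x. f x + g x) U = P f U + P g U"
  unfolding P_def by (intro Bochner_Integration.integral_add lips_integrable_S')

lemma P_cmult: "P (\<lambda>x. c * f x) U = c * P f U"
  unfolding P_def by simp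

lemma P_const [simp]: "P (\<lambda>_. c) U = c"
  unfolding P_def using prob_space.prob_space[OF prob_p] by simp

lemma P_mono: "f \<in> lips \<Longrightarrow> g \<in> lips \<Longrightarrow> (\<And>x. f x \<le> g x) \<Longrightarrow> P f U \<le> P g U"
  unfolding P_def by (intro integral_mono lips_integrable_S')

lemma P_oscillation:
  assumes f: "f \<in> lips" and w: "\<And>x y. \<bar>f x - f y\<bar> \<le> w"
  shows "\<bar>P f U - P f U'\<bar> \<le> w"
proof -
  have "P f U - P f U' \<le> w" for U U'
  proof -
    have "P f U \<le> f y + w" for y
      using P_mono[OF f lips_const[of "f y + w"], of U] w[of _ y] by (simp add: abs_le_iff algebra_simps)
    then have "P f U - w \<le> f y" for y by (simp add: algebra_simps)
    then have "P f U - w \<le> P f U'"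
      using P_mono[OF lips_const[of "P f U - w"] f, of U'] by simp
    then show ?thesis by simp
  qed
  then show ?thesis by (simp add: abs_le_iff)
qed

end

subsection \<open>The Lasota-Yorke inequality\<close>

lemma measure_diff_le_tv_dist:
  assumes "prob_space \<mu>" "prob_space \<nu>" and A: "A \<in> sets \<mu>"
  shows "measure \<mu> A - measure \<nu> A \<le> tv_dist \<mu> \<nu>"
proof -
  interpret \<mu>: prob_space \<mu> by fact
  interpret \<nu>: prob_space \<nu> by fact
  have "\<bar>measure \<mu> B - measure \<nu> B\<bar> \<le> 1" for B
    using \<mu>.prob_le_1[of B] \<nu>.prob_le_1[of B] measure_nonneg[of \<mu> B] measure_nonneg[of \<nu> B] by linarith
  then have "bdd_above ((\<lambda>\<Gamma>. \<bar>measure \<mu> \<Gamma> - measure \<nu> \<Gamma>\<bar>) ` sets \<mu>)" by (intro bdd_aboveI2)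
  then have "\<bar>measure \<mu> A - measure \<nu> A\<bar> \<le> tv_dist \<mu> \<nu>"
    unfolding tv_dist_def using A by (intro cSUP_upper)
  then show ?thesis by linarith
qed

text \<open>The suprema are turned into pointwise bounds. \<open>Lip_on\<close> sees only pairs at
  distance at most 1; for more distant pairs the bound on the norm is used at both points, whence
  the constant \<open>2 * C\<close>.\<close>

lemma LAC_unfold:
  fixes S :: "'x::metric_space \<Rightarrow> 'e::real_normed_vector \<Rightarrow> 'x"
  assumes "LAC S K F"
  obtains C \<delta> q \<Phi> where "0 < C" "0 < \<delta>" "0 < q" "q < (1::real)"
    "\<And>U U'. dist U U' \<le> \<delta> \<Longrightarrow> continuous_on K (\<Phi> U U')"
    "\<And>U U' \<xi>. dist U U' \<le> \<delta> \<Longrightarrow> \<xi> \<in> K \<Longrightarrow> \<Phi> U U' \<xi> \<in> F"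
    "\<And>U U' \<xi>. dist U U' \<le> \<delta> \<Longrightarrow> \<xi> \<in> K \<Longrightarrow> norm (\<Phi> U U' \<xi>) \<le> C * dist U U'"
    "\<And>U U' \<xi> \<xi>'. dist U U' \<le> \<delta> \<Longrightarrow> \<xi> \<in> K \<Longrightarrow> \<xi>' \<in> K \<Longrightarrow>
      norm (\<Phi> U U' \<xi> - \<Phi> U U' \<xi>') \<le> 2 * C * dist U U' * norm (\<xi> - \<xi>')"
    "\<And>U U' \<xi>. dist U U' \<le> \<delta> \<Longrightarrow> \<xi> \<in> K \<Longrightarrow> \<xi> + \<Phi> U U' \<xi> \<in> K \<Longrightarrow>
      dist (S U \<xi>) (S U' (\<xi> + \<Phi> U U' \<xi>)) \<le> q * dist U U'"
proof -
  from assms obtain C \<delta> q \<Phi> where pos: "0 < C" "0 < \<delta>" "0 < q" "q < 1"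
    and cont: "continuous_on ({(U, U'). dist U U' \<le> \<delta>} \<times> K) (\<lambda>((U, U'), \<xi>). \<Phi> U U' \<xi>)"
    and all: "\<forall>U U'. dist U U' \<le> \<delta> \<longrightarrow>
           (\<forall>\<xi>\<in>K. \<Phi> U U' \<xi> \<in> F) \<and>
           (SUP \<xi>\<in>K. ennreal (norm (\<Phi> U U' \<xi>))) + Lip_on K (\<Phi> U U') \<le> ennreal (C * dist U U') \<and>
           (SUP \<xi>\<in>{\<xi>\<in>K. \<xi> + \<Phi> U U' \<xi> \<in> K}. ennreal (dist (S U \<xi>) (S U' (\<xi> + \<Phi> U U' \<xi>))))
             \<le> ennreal (q * dist U U')"
    unfolding LAC_def by (elim exE conjE) (rule that; assumption)
  have \<Phi>_le: "norm (\<Phi> U U' \<xi>) \<le> C * dist U U'" if d: "dist U U' \<le> \<delta>" and \<xi>: "\<xi> \<in> K" for U U' \<xi>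
  proof -
    have "ennreal (norm (\<Phi> U U' \<xi>)) \<le> (SUP \<xi>\<in>K. ennreal (norm (\<Phi> U U' \<xi>)))" using \<xi> by (rule SUP_upper)
    also have "\<dots> \<le> (SUP \<xi>\<in>K. ennreal (norm (\<Phi> U U' \<xi>))) + Lip_on K (\<Phi> U U')" by simp
    also have "\<dots> \<le> ennreal (C * dist U U')" using all d by blast
    finally show ?thesis using pos by simp
  qed
  show ?thesis
  proof (rule that[OF pos, of \<Phi>])
    fix U U' :: 'x assume d: "dist U U' \<le> \<delta>"
    have "continuous_on K (\<lambda>\<xi>. (\<lambda>((U, U'), \<xi>). \<Phi> U U' \<xi>) ((U, U'), \<xi>))"
      using d by (intro continuous_on_compose2[OF cont] continuous_intros) auto
    then show "continuous_on K (\<Phi> U U')" by simp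
    show "\<Phi> U U' \<xi> \<in> F" if "\<xi> \<in> K" for \<xi> using all d that by blast
    show "norm (\<Phi> U U' \<xi>) \<le> C * dist U U'" if "\<xi> \<in> K" for \<xi> by (rule \<Phi>_le[OF d that])
    show "dist (S U \<xi>) (S U' (\<xi> + \<Phi> U U' \<xi>)) \<le> q * dist U U'" if "\<xi> \<in> K" "\<xi> + \<Phi> U U' \<xi> \<in> K" for \<xi>
    proof -
      have "ennreal (dist (S U \<xi>) (S U' (\<xi> + \<Phi> U U' \<xi>))) \<le>
          (SUP \<xi>\<in>{\<xi>\<in>K. \<xi> + \<Phi> U U' \<xi> \<in> K}. ennreal (dist (S U \<xi>) (S U' (\<xi> + \<Phi> U U' \<xi>))))"
        using that by (intro SUP_upper) simp
      also have "\<dots> \<le> ennreal (q * dist U U')" using all d by blast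
      finally show ?thesis using pos by simp
    qed
    fix \<xi> \<xi>' assume \<xi>: "\<xi> \<in> K" "\<xi>' \<in> K"
    have Cd: "0 \<le> C * dist U U'" using pos by simp
    consider "\<xi> = \<xi>'" | "0 < norm (\<xi> - \<xi>')" "norm (\<xi> - \<xi>') \<le> 1" | "1 < norm (\<xi> - \<xi>')" by fastforce
    then show "norm (\<Phi> U U' \<xi> - \<Phi> U U' \<xi>') \<le> 2 * C * dist U U' * norm (\<xi> - \<xi>')"
    proof cases
      case 2
      have "ennreal (norm (\<Phi> U U' \<xi> - \<Phi> U U' \<xi>') / norm (\<xi> - \<xi>')) \<le> Lip_on K (\<Phi> U U')"
        unfolding Lip_on_def using \<xi> 2 by (intro SUP_upper2[of "(\<xi>, \<xi>')"]) auto
      also have "\<dots> \<le> (SUP \<xi>\<in>K. ennreal (norm (\<Phi> U U' \<xi>))) + Lip_on K (\<Phi> U U')" by simp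
      also have "\<dots> \<le> ennreal (C * dist U U')" using all d by blast
      finally have "norm (\<Phi> U U' \<xi> - \<Phi> U U' \<xi>') / norm (\<xi> - \<xi>') \<le> C * dist U U'" using Cd by simp
      then have "norm (\<Phi> U U' \<xi> - \<Phi> U U' \<xi>') \<le> C * dist U U' * norm (\<xi> - \<xi>')"
        using 2 by (simp add: field_simps)
      also have "\<dots> \<le> 2 * C * dist U U' * norm (\<xi> - \<xi>')" using pos by (intro mult_right_mono) auto
      finally show ?thesis .
    next
      case 3
      have "norm (\<Phi> U U' \<xi> - \<Phi> U U' \<xi>') \<le> 2 * C * dist U U'"
        using norm_triangle_ineq4[of "\<Phi> U U' \<xi>" "\<Phi> U U' \<xi>'"] \<Phi>_le[OF d \<xi>(1)] \<Phi>_le[OF d \<xi>(2)] by simp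
      also have "\<dots> \<le> 2 * C * dist U U' * norm (\<xi> - \<xi>')"
        using mult_left_mono[of 1 "norm (\<xi> - \<xi>')" "2 * C * dist U U'"] 3 pos by simp
      finally show ?thesis .
    qed simp
  qed
qed

context rds begin

text \<open>For nearby \<open>U\<close> and \<open>U'\<close> the laws \<open>p U'\<close> and the image of \<open>p U\<close> under \<open>\<xi> \<mapsto> \<xi> + \<Phi> U U' \<xi>\<close> differ by
  \<open>O(dist U U')\<close> in variation, and on the shifted noise \<open>S\<close> contracts.\<close>

lemma lasota_yorke:
  assumes lac: "LAC S K F" and dlp: "DLP p F"
    and tv: "\<forall>U U'. \<forall>A\<in>sets borel. measure (p U) A \<le> measure (p U') A + C0 * dist U U'" and "0 < C0"
  shows "\<exists>q C. 0 < q \<and> q < 1 \<and> 0 < C \<and>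
    (\<forall>f L w U U'. (\<forall>x y. \<bar>f x - f y\<bar> \<le> L * dist x y) \<and> 0 \<le> L \<and> (\<forall>x y. \<bar>f x - f y\<bar> \<le> w) \<longrightarrow>
      \<bar>P f U - P f U'\<bar> \<le> (q * L + C * w) * dist U U')"
proof -
  obtain C \<delta> q \<Phi> where pos: "0 < C" "0 < \<delta>" "0 < q" "q < 1"
    and \<Phi>_cont: "\<And>U U'. dist U U' \<le> \<delta> \<Longrightarrow> continuous_on K (\<Phi> U U')"
    and \<Phi>_F: "\<And>U U' \<xi>. dist U U' \<le> \<delta> \<Longrightarrow> \<xi> \<in> K \<Longrightarrow> \<Phi> U U' \<xi> \<in> F"
    and \<Phi>_le: "\<And>U U' \<xi>. dist U U' \<le> \<delta> \<Longrightarrow> \<xi> \<in> K \<Longrightarrow> norm (\<Phi> U U' \<xi>) \<le> C * dist U U'"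
    and \<Phi>_lip: "\<And>U U' \<xi> \<xi>'. dist U U' \<le> \<delta> \<Longrightarrow> \<xi> \<in> K \<Longrightarrow> \<xi>' \<in> K \<Longrightarrow>
      norm (\<Phi> U U' \<xi> - \<Phi> U U' \<xi>') \<le> 2 * C * dist U U' * norm (\<xi> - \<xi>')"
    and \<Phi>_S: "\<And>U U' \<xi>. dist U U' \<le> \<delta> \<Longrightarrow> \<xi> \<in> K \<Longrightarrow> \<xi> + \<Phi> U U' \<xi> \<in> K \<Longrightarrow>
      dist (S U \<xi>) (S U' (\<xi> + \<Phi> U U' \<xi>)) \<le> q * dist U U'"
    by (rule LAC_unfold[OF lac]) blast
  obtain c e0 where "0 < c" "0 < e0" and shift0: "\<forall>U \<Phi> e X. 0 \<le> e \<and> e \<le> e0 \<and> continuous_on K \<Phi> \<and>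
      (\<forall>\<xi>\<in>K. \<Phi> \<xi> \<in> F \<and> norm (\<Phi> \<xi>) \<le> e) \<and>
      (\<forall>\<xi>\<in>K. \<forall>\<xi>'\<in>K. norm (\<Phi> \<xi> - \<Phi> \<xi>') \<le> e * norm (\<xi> - \<xi>')) \<and> X \<in> sets borel \<longrightarrow>
      {\<xi>\<in>K. \<xi> + \<Phi> \<xi> \<in> X} \<in> sets borel \<and>
      measure (p U) {\<xi>\<in>K. \<xi> + \<Phi> \<xi> \<in> X} \<le> measure (p U) X + c * e"
    using DLP_shift_bound[OF dlp compact_K p_prob] by (elim exE conjE) (rule that; assumption)
  \<comment> \<open>Up to distance \<open>d0\<close> the shift is defined, and
    \<open>2 * C * dist U U'\<close>, which bounds its norm and its Lipschitz constant, stays below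
    \<open>e0\<close>.\<close>
  define d0 where "d0 = min \<delta> (e0 / (2 * C))"
  define c1 where "c1 = c * (2 * C) + C0"
  have "0 < d0" using pos \<open>0 < e0\<close> by (simp add: d0_def)
  have "0 < c1" unfolding c1_def using \<open>0 < c\<close> pos \<open>0 < C0\<close> by (intro add_pos_pos) auto
  have shift: "{\<xi>\<in>K. \<xi> + \<Phi> U U' \<xi> \<in> X} \<in> sets borel"
      "measure (p U) {\<xi>\<in>K. \<xi> + \<Phi> U U' \<xi> \<in> X} \<le> measure (p U') X + c1 * dist U U'"
    if d: "dist U U' \<le> d0" and X: "X \<in> sets borel" for U U' X
  proof -
    have \<delta>: "dist U U' \<le> \<delta>" and e0: "2 * C * dist U U' \<le> e0"
      using d pos by (auto simp: d0_def field_simps)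
    have "norm (\<Phi> U U' \<xi>) \<le> 2 * C * dist U U'" if "\<xi> \<in> K" for \<xi>
    proof -
      have "C * dist U U' \<le> 2 * C * dist U U'" using pos by simp
      then show ?thesis using \<Phi>_le[OF \<delta> that] by simp
    qed
    then have *: "{\<xi>\<in>K. \<xi> + \<Phi> U U' \<xi> \<in> X} \<in> sets borel \<and>
        measure (p U) {\<xi>\<in>K. \<xi> + \<Phi> U U' \<xi> \<in> X} \<le> measure (p U) X + c * (2 * C * dist U U')"
      using \<Phi>_cont[OF \<delta>] \<Phi>_F[OF \<delta>] \<Phi>_lip[OF \<delta>] e0 X pos
      by (intro shift0[rule_format]) auto
    then show "{\<xi>\<in>K. \<xi> + \<Phi> U U' \<xi> \<in> X} \<in> sets borel" by simp
    show "measure (p U) {\<xi>\<in>K. \<xi> + \<Phi> U U' \<xi> \<in> X} \<le> measure (p U') X + c1 * dist U U'"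
      using * tv[rule_format, OF X, of U U'] by (simp add: c1_def algebra_simps)
  qed
  have near: "P f U - P f U' \<le> (q * L + 2 * c1 * w) * dist U U'"
    if f: "\<forall>x y. \<bar>f x - f y\<bar> \<le> L * dist x y" "0 \<le> L" "\<forall>x y. \<bar>f x - f y\<bar> \<le> w" and d: "dist U U' \<le> d0" for f L w U U'
  proof -
    have lip: "f \<in> lips" unfolding lips_def using f by (auto intro!: exI[of _ L] lipschitz_onI simp: dist_real_def)
    have w0: "0 \<le> w" using f(3) by (metis abs_ge_zero order_trans)
    have fm [measurable]: "f \<in> borel_measurable borel" using lip by (rule lips_measurable)
    \<comment> \<open>Subtracting the minimum brings the integrand into \<open>[0, w]\<close>, as
      the comparison of integrals requires.\<close>
    obtain x0 where x0: "\<And>x. f x0 \<le> f x"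
      using continuous_attains_inf[OF compact_space _ lips_continuous[OF lip]] by auto
    define T where "T = (\<lambda>\<xi>. if \<xi> \<in> K then \<xi> + \<Phi> U U' \<xi> else \<xi>)"
    have \<delta>: "dist U U' \<le> \<delta>" using d by (simp add: d0_def)
    have Tm [measurable]: "T \<in> borel_measurable borel"
      unfolding T_def using \<Phi>_cont[OF \<delta>]
      by (intro borel_measurable_continuous_on_if continuous_intros) auto
    define \<nu> where "\<nu> = distr (p U) borel T"
    have \<nu>: "prob_space \<nu>" unfolding \<nu>_def by (rule prob_space.prob_space_distr[OF prob_p]) measurable
    have sets_\<nu>: "sets \<nu> = sets borel" by (simp add: \<nu>_def)
    have \<nu>_le: "measure \<nu> X \<le> measure (p U') X + c1 * dist U U'" if X: "X \<in> sets borel" for X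
    proof -
      interpret prob_space "p U" by (rule prob_p)
      have "measure \<nu> X = measure (p U) (T -` X)"
        unfolding \<nu>_def using X by (subst measure_distr) auto
      also have "\<dots> = measure (p U) {\<xi>\<in>K. \<xi> + \<Phi> U U' \<xi> \<in> X}"
      proof (rule finite_measure_eq_AE)
        show "AE \<xi> in p U. (\<xi> \<in> T -` X) = (\<xi> \<in> {\<xi>\<in>K. \<xi> + \<Phi> U U' \<xi> \<in> X})"
          using AE_K by eventually_elim (simp add: T_def)
        show "T -` X \<in> events" "{\<xi>\<in>K. \<xi> + \<Phi> U U' \<xi> \<in> X} \<in> events"
          using measurable_sets_borel[OF Tm X] shift(1)[OF d X] by auto
      qed
      also have "\<dots> \<le> measure (p U') X + c1 * dist U U'" by (rule shift(2)[OF d X])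
      finally show ?thesis .
    qed
    \<comment> \<open>The value 0 outside \<open>K\<close> discards the noise that is shifted out of
      \<open>K\<close>; its contribution is restored below by
      \<open>w * indicator (- K)\<close>.\<close>
    define h where "h = (\<lambda>\<xi>. if \<xi> \<in> K then f (S' U' \<xi>) - f x0 else 0)"
    have hm [measurable]: "h \<in> borel_measurable borel" unfolding h_def by measurable
    have h: "0 \<le> h \<xi> \<and> h \<xi> \<le> w" for \<xi>
      using x0 f(3) w0 by (auto simp: h_def abs_le_iff)
    interpret pU: prob_space "p U" by (rule prob_p)
    interpret pU': prob_space "p U'" by (rule prob_p)
    have int1: "integrable (p U) (\<lambda>\<xi>. f (S' U \<xi>) - f x0)" using lips_integrable_S'[OF lip, of U] by simp
    have int2: "integrable (p U) (\<lambda>\<xi>. h (T \<xi>))"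
      using h by (intro pU.integrable_const_bound[where B=w]) auto
    have int3: "integrable (p U) (\<lambda>\<xi>. indicator (- K) (T \<xi>) :: real)"
      by (intro pU.integrable_const_bound[where B=1]) auto
    have "P f U - f x0 = (\<integral>\<xi>. f (S' U \<xi>) - f x0 \<partial>p U)"
      unfolding P_def using lips_integrable_S'[OF lip, of U] by (simp add: pU.prob_space[unfolded space_p])
    also have "\<dots> \<le> (\<integral>\<xi>. h (T \<xi>) + (L * (q * dist U U') + w * indicator (- K) (T \<xi>)) \<partial>p U)"
    proof (rule integral_mono_AE)
      show "AE \<xi> in p U. f (S' U \<xi>) - f x0 \<le> h (T \<xi>) + (L * (q * dist U U') + w * indicator (- K) (T \<xi>))"
        using AE_K
      proof eventually_elim
        fix \<xi> assume \<xi>: "\<xi> \<in> K"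
        show "f (S' U \<xi>) - f x0 \<le> h (T \<xi>) + (L * (q * dist U U') + w * indicator (- K) (T \<xi>))"
        proof (cases "T \<xi> \<in> K")
          case True
          have "f (S' U \<xi>) - f (S' U' (T \<xi>)) \<le> L * dist (S' U \<xi>) (S' U' (T \<xi>))"
            using f(1) by (meson abs_le_D1)
          also have "\<dots> \<le> L * (q * dist U U')"
            using \<Phi>_S[OF \<delta> \<xi>] True \<xi> f(2) by (intro mult_left_mono) (auto simp: S'_def T_def)
          finally show ?thesis using True by (simp add: h_def)
        next
          case False
          have "f (S' U \<xi>) - f x0 \<le> w" using f(3) by (meson abs_le_D1)
          moreover have "0 \<le> L * (q * dist U U')" using f(2) pos by simp
          ultimately show ?thesis using False h[of "T \<xi>"] by simp
        qed
      qed
    qed (use int1 int2 int3 in auto)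
    also have "\<dots> = (\<integral>\<xi>. h (T \<xi>) \<partial>p U) + L * (q * dist U U') + w * (\<integral>\<xi>. indicator (- K) (T \<xi>) \<partial>p U)"
      using int2 int3 by (simp add: pU.prob_space[unfolded space_p])
    also have "(\<integral>\<xi>. h (T \<xi>) \<partial>p U) = (\<integral>\<xi>. h \<xi> \<partial>\<nu>)"
      unfolding \<nu>_def by (rule integral_distr[symmetric]) measurable
    also have "(\<integral>\<xi>. indicator (- K) (T \<xi>) \<partial>p U) = (\<integral>\<xi>. (indicator (- K) \<xi> :: real) \<partial>\<nu>)"
      unfolding \<nu>_def by (subst integral_distr) auto
    also have "\<dots> = measure \<nu> (- K)" by (simp add: \<nu>_def)
    also have "(\<integral>\<xi>. h \<xi> \<partial>\<nu>) \<le> (\<integral>\<xi>. h \<xi> \<partial>p U') + c1 * dist U U' * w"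
      using h by (intro integral_le_add_of_measure_le_add[OF \<nu> prob_p] \<nu>_le) (auto simp: sets_\<nu> \<nu>_def)
    \<comment> \<open>\<open>p U'\<close> does not charge \<open>- K\<close>, so only the error of
      the comparison is left. Together with the error for \<open>h\<close> this gives the factor 2
      in \<open>2 * c1\<close>.\<close>
    also have "w * measure \<nu> (- K) \<le> w * (c1 * dist U U')"
      using \<nu>_le[of "- K"] pU'.prob_compl[of K] measure_K[of U'] w0
      by (intro mult_left_mono) (simp_all add: Compl_eq_Diff_UNIV)
    also have "(\<integral>\<xi>. h \<xi> \<partial>p U') = (\<integral>\<xi>. f (S' U' \<xi>) - f x0 \<partial>p U')"
      using AE_K[of U'] by (intro integral_cong_AE) (auto simp: h_def elim!: eventually_mono)
    also have "\<dots> = P f U' - f x0"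
      unfolding P_def using lips_integrable_S'[OF lip, of U'] by (simp add: pU'.prob_space[unfolded space_p])
    finally show ?thesis using w0 by (simp add: algebra_simps)
  qed
  show ?thesis
  \<comment> \<open>The term \<open>1 / d0\<close> serves the pairs at distance more than
    \<open>d0\<close>, for which the trivial bound \<open>w\<close> is at most
    \<open>1 / d0 * w * dist U U'\<close>.\<close>
  proof (rule exI[of _ q], rule exI[of _ "2 * c1 + 1 / d0"], intro conjI allI impI)
    fix f :: "'x \<Rightarrow> real" and L w U U'
    assume "(\<forall>x y. \<bar>f x - f y\<bar> \<le> L * dist x y) \<and> 0 \<le> L \<and> (\<forall>x y. \<bar>f x - f y\<bar> \<le> w)"
    then have f: "\<forall>x y. \<bar>f x - f y\<bar> \<le> L * dist x y" "0 \<le> L" "\<forall>x y. \<bar>f x - f y\<bar> \<le> w" by auto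
    have w0: "0 \<le> w" using f(3) by (metis abs_ge_zero order_trans)
    show "\<bar>P f U - P f U'\<bar> \<le> (q * L + (2 * c1 + 1 / d0) * w) * dist U U'"
    proof (cases "dist U U' \<le> d0")
      case True
      have "\<bar>P f U - P f U'\<bar> \<le> (q * L + 2 * c1 * w) * dist U U'"
        using near[OF f, of U U'] near[OF f, of U' U] True by (simp add: dist_commute abs_le_iff)
      also have "\<dots> \<le> (q * L + (2 * c1 + 1 / d0) * w) * dist U U'"
        using w0 \<open>0 < d0\<close> by (intro mult_right_mono) (auto simp: algebra_simps)
      finally show ?thesis .
    next
      case False
      have lip: "f \<in> lips" unfolding lips_def using f by (auto intro!: exI[of _ L] lipschitz_onI simp: dist_real_def)
      have "\<bar>P f U - P f U'\<bar> \<le> w" using P_oscillation[OF lip] f(3) by blast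
      also have "\<dots> \<le> 1 / d0 * w * dist U U'"
        using mult_right_mono[of d0 "dist U U'" w] False w0 \<open>0 < d0\<close> by (simp add: field_simps)
      also have "\<dots> \<le> (q * L + (2 * c1 + 1 / d0) * w) * dist U U'"
        using w0 \<open>0 < c1\<close> f(2) pos by (intro mult_right_mono) (auto simp: algebra_simps)
      finally show ?thesis .
    qed
  qed (use pos \<open>0 < c1\<close> \<open>0 < d0\<close> in \<open>auto intro!: add_pos_pos\<close>)
qed

end

subsection \<open>Exponential mixing\<close>

lemma bind_in_prob_algebra:
  assumes "M \<in> space (prob_algebra A)" "N \<in> A \<rightarrow>\<^sub>M prob_algebra B"
  shows "M \<bind> N \<in> space (prob_algebra B)"
  using measurable_space[OF measurable_bind_prob_space[OF measurable_ident_sets[OF refl] assms(2)] assms(1)] .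

lemma integral_bind_prob:
  fixes f :: "'b \<Rightarrow> real"
  assumes M: "M \<in> space (prob_algebra A)" and N: "N \<in> A \<rightarrow>\<^sub>M prob_algebra B"
    and f: "f \<in> borel_measurable B" and bound: "\<And>x. \<bar>f x\<bar> \<le> c"
  shows "(\<integral>x. f x \<partial>(M \<bind> N)) = (\<integral>x. (\<integral>y. f y \<partial>N x) \<partial>M)"
proof -
  have MN: "M \<bind> N \<in> space (prob_algebra B)" using M N by (rule bind_in_prob_algebra)
  have sets: "sets M = sets A" and pM: "prob_space M" using M by (auto simp: space_prob_algebra)
  have sp: "space M = space A" using sets by (rule sets_eq_imp_space_eq)
  have N' [measurable]: "N \<in> M \<rightarrow>\<^sub>M subprob_algebra B"
    using measurable_prob_algebraD[OF N] sets by (simp cong: measurable_cong_sets)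
  have pN: "prob_space (N x)" "sets (N x) = sets B" if "x \<in> space M" for x
    using measurable_space[OF N] that sp by (auto simp: space_prob_algebra)
  have [measurable]: "f \<in> borel_measurable B" by fact
  \<comment> \<open>Adding \<open>c\<close> makes the function nonnegative, so that the rule for
    nonnegative integrals over a bind applies.\<close>
  let ?g = "\<lambda>x. f x + c"
  have g0: "0 \<le> ?g x" "?g x \<le> 2 * c" for x using bound[of x] by (auto simp: abs_le_iff)
  have int: "integrable Q f" if "prob_space Q" "sets Q = sets B" for Q
  proof -
    interpret prob_space Q by fact
    show ?thesis using bound that f by (intro integrable_const_bound[where B=c]) (auto cong: measurable_cong_sets)
  qed
  have eq: "(\<integral>x. ?g x \<partial>Q) = (\<integral>x. f x \<partial>Q) + c" if Q: "prob_space Q" "sets Q = sets B" for Q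
  proof -
    interpret prob_space Q by (rule Q(1))
    show ?thesis using int[OF Q] by (simp add: prob_space)
  qed
  have nn: "(\<integral>\<^sup>+x. ennreal (?g x) \<partial>Q) = ennreal ((\<integral>x. f x \<partial>Q) + c)" if Q: "prob_space Q" "sets Q = sets B" for Q
  proof -
    interpret prob_space Q by (rule Q(1))
    show ?thesis unfolding eq[OF Q, symmetric] using int[OF Q] g0 by (intro nn_integral_eq_integral) auto
  qed
  have F_bound: "\<bar>\<integral>y. f y \<partial>N x\<bar> \<le> c" if "x \<in> space M" for x
  proof -
    interpret prob_space "N x" by (rule pN[OF that])
    have "\<bar>\<integral>y. f y \<partial>N x\<bar> \<le> (\<integral>y. \<bar>f y\<bar> \<partial>N x)" by (rule integral_abs_bound)
    also have "\<dots> \<le> (\<integral>y. c \<partial>N x)" using int[OF pN[OF that]] bound by (intro integral_mono) auto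
    finally show ?thesis by (simp add: prob_space)
  qed
  interpret M: prob_space M by (rule pM)
  have F [measurable]: "(\<lambda>x. \<integral>y. f y \<partial>N x) \<in> borel_measurable M" by measurable
  have intF: "integrable M (\<lambda>x. \<integral>y. f y \<partial>N x)"
    using F_bound by (intro M.integrable_const_bound[where B=c]) auto
  have "ennreal ((\<integral>x. f x \<partial>(M \<bind> N)) + c) = (\<integral>\<^sup>+x. ennreal (?g x) \<partial>(M \<bind> N))"
    using MN by (intro nn[symmetric]) (auto simp: space_prob_algebra)
  also have "\<dots> = (\<integral>\<^sup>+x. (\<integral>\<^sup>+y. ennreal (?g y) \<partial>N x) \<partial>M)"
    by (intro nn_integral_bind[where B=B]) measurable
  also have "\<dots> = (\<integral>\<^sup>+x. ennreal ((\<integral>y. f y \<partial>N x) + c) \<partial>M)"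
    using pN by (intro nn_integral_cong nn) auto
  also have "\<dots> = ennreal (\<integral>x. (\<integral>y. f y \<partial>N x) + c \<partial>M)"
  proof (rule nn_integral_eq_integral)
    show "AE x in M. 0 \<le> (\<integral>y. f y \<partial>N x) + c"
      using F_bound by (intro AE_I2) (fastforce simp: abs_le_iff)
  qed (use intF in simp)
  also have "(\<integral>x. (\<integral>y. f y \<partial>N x) + c \<partial>M) = (\<integral>x. (\<integral>y. f y \<partial>N x) \<partial>M) + c"
    using intF by (simp add: M.prob_space)
  finally have *: "ennreal ((\<integral>x. f x \<partial>(M \<bind> N)) + c) = ennreal ((\<integral>x. (\<integral>y. f y \<partial>N x) \<partial>M) + c)" .
  have nonneg: "0 \<le> (\<integral>x. f x \<partial>Q) + c" if Q: "prob_space Q" "sets Q = sets B" for Q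
    unfolding eq[OF Q, symmetric] using g0 by (intro integral_nonneg_AE AE_I2) auto
  have "0 \<le> (\<integral>x. (\<integral>y. f y \<partial>N x) + c \<partial>M)"
    using pN by (intro integral_nonneg_AE AE_I2 nonneg) auto
  then have "0 \<le> (\<integral>x. (\<integral>y. f y \<partial>N x) \<partial>M) + c" using intF by (simp add: M.prob_space)
  moreover have "0 \<le> (\<integral>x. f x \<partial>(M \<bind> N)) + c"
    using MN by (intro nonneg) (auto simp: space_prob_algebra)
  ultimately show "(\<integral>x. f x \<partial>(M \<bind> N)) = (\<integral>x. (\<integral>y. f y \<partial>N x) \<partial>M)"
    using * by simp
qed

text \<open>\<open>L\<close> and \<open>w\<close> are any admissible bounds rather than optimal
  constants, so estimates can be chained without computing suprema.\<close>

definition lip_osc :: "('x::metric_space \<Rightarrow> real) \<Rightarrow> real \<Rightarrow> real \<Rightarrow> bool" where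
  "lip_osc f L w \<longleftrightarrow> (\<forall>x y. \<bar>f x - f y\<bar> \<le> L * dist x y) \<and> 0 \<le> L \<and> (\<forall>x y. \<bar>f x - f y\<bar> \<le> w)"

lemma lip_osc_lips: "lip_osc f L w \<Longrightarrow> f \<in> lips"
  unfolding lips_def lip_osc_def by (auto intro!: exI[of _ L] lipschitz_onI simp: dist_real_def)

lemma lip_osc_nonneg: "lip_osc f L w \<Longrightarrow> 0 \<le> L \<and> 0 \<le> w"
  unfolding lip_osc_def by (metis abs_ge_zero order_trans)

text \<open>From here on (LAC), (DLP) and the variation bound of (DN) enter only through
  \<open>P_lip_osc\<close>.\<close>

locale rds_mixing = rds S p K
  for S :: "'x::{metric_space, second_countable_topology} \<Rightarrow> 'e::{banach, second_countable_topology} \<Rightarrow> 'x"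
    and p :: "'x \<Rightarrow> 'e measure" and K :: "'e set" +
  fixes q C :: real
  assumes q: "0 < q" "q < 1" and C: "0 < C"
    and P_lip_osc: "\<And>f L w. lip_osc f L w \<Longrightarrow> lip_osc (P f) (q * L + C * w) w"
    and gcp: "GCP S p K"
begin

text \<open>The sum of the geometric series \<open>C + q * C + q^2 * C + ...\<close>. Being a fixed
  point of \<open>c = q * c + C\<close>, it bounds the influence of the oscillation on the Lipschitz
  constant for all iterates at once.\<close>

definition C1 :: real where "C1 = C / (1 - q)"

lemma C1: "0 < C1" "q * C1 + C = C1"
  using q C by (auto simp: C1_def field_simps)

lemma lips_lip_osc:
  assumes "f \<in> lips" shows "\<exists>L w. lip_osc (f :: 'x \<Rightarrow> real) L w"
proof -
  obtain c where c: "\<And>x. \<bar>f x\<bar> \<le> c" using lips_bounded[OF assms] by auto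
  have "\<bar>f x - f y\<bar> \<le> 2 * c" for x y using c[of x] c[of y] by linarith
  moreover obtain L where "L-lipschitz_on UNIV f" using assms by (auto simp: lips_def)
  ultimately show ?thesis
    unfolding lip_osc_def lipschitz_on_def by (auto simp: dist_real_def)
qed

lemma P_lips: "f \<in> lips \<Longrightarrow> P f \<in> lips"
  using lips_lip_osc P_lip_osc lip_osc_lips by blast

lemma Pn_lips: "f \<in> lips \<Longrightarrow> (P ^^ n) f \<in> lips"
  by (induction n) (auto intro: P_lips)

lemma Pn_lip_osc: "lip_osc f L w \<Longrightarrow> lip_osc ((P ^^ n) f) (q ^ n * L + C1 * w) w"
proof (induction n)
  case 0
  then have f: "lip_osc f L w" and "0 \<le> C1 * w" using C1 lip_osc_nonneg[OF 0] by auto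
  then have "L * dist x y \<le> (L + C1 * w) * dist x y" for x y by (intro mult_right_mono) auto
  then show ?case using f \<open>0 \<le> C1 * w\<close> unfolding lip_osc_def by (fastforce intro: order_trans)
next
  case (Suc n)
  have "q * (q ^ n * L + C1 * w) + C * w = q ^ Suc n * L + (q * C1 + C) * w" by (simp add: algebra_simps)
  then show ?case using P_lip_osc[OF Suc.IH[OF Suc.prems]] C1(2) by simp
qed

lemma Pn_const [simp]: "(P ^^ n) (\<lambda>_. c) = (\<lambda>_. c)"
  by (induction n) (auto simp: P_const)

lemma Pn_mono: "f \<in> lips \<Longrightarrow> g \<in> lips \<Longrightarrow> (\<And>x. f x \<le> g x) \<Longrightarrow> (P ^^ n) f x \<le> (P ^^ n) g x"
  by (induction n arbitrary: x) (auto intro: P_mono Pn_lips)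

lemma Pn_add: "f \<in> lips \<Longrightarrow> g \<in> lips \<Longrightarrow> (P ^^ n) (\<lambda>x. f x + g x) = (\<lambda>x. (P ^^ n) f x + (P ^^ n) g x)"
  by (induction n) (auto simp: P_add Pn_lips)

lemma Pn_cmult: "(P ^^ n) (\<lambda>x. c * f x) = (\<lambda>x. c * (P ^^ n) f x)"
  by (induction n) (auto simp: P_cmult)

text \<open>By continuity \<open>f (S U \<xi>')\<close> exceeds half its value at
  \<open>\<xi>\<close> for all \<open>\<xi>'\<close> in \<open>K\<close> near \<open>\<xi>\<close>,
  and these points have positive mass because \<open>\<xi>\<close> lies in the support.\<close>

lemma P_positive:
  assumes f: "f \<in> lips" "\<And>x. 0 \<le> f x" and \<xi>: "\<xi> \<in> K" "\<xi> \<in> measure_supp (p U)" and pos: "0 < f (S U \<xi>)"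
  shows "0 < P f U"
proof -
  interpret prob_space "p U" by (rule prob_p)
  let ?e = "f (S U \<xi>) / 2"
  have "continuous_on K (\<lambda>\<xi>. f ((\<lambda>(U, \<xi>). S U \<xi>) (U, \<xi>)))"
    by (intro continuous_on_compose2[OF lips_continuous[OF f(1)]] continuous_on_compose2[OF continuous_S]
      continuous_intros) auto
  then have "continuous_on K (\<lambda>\<xi>. f (S U \<xi>))" by simp
  then obtain G where G: "open G" "G \<inter> K = (\<lambda>\<xi>. f (S U \<xi>)) -` {?e<..} \<inter> K"
    using continuous_on_open_invariant[of K "\<lambda>\<xi>. f (S U \<xi>)"] open_greaterThan by metis
  have [measurable]: "G \<in> sets borel" using G by simp
  have "\<xi> \<in> G" using G \<xi> pos by auto
  then have "0 < emeasure (p U) G" using \<xi> G unfolding measure_supp_def by blast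
  then have "0 < ?e * measure (p U) G" using pos by (simp add: emeasure_eq_measure)
  also have "\<dots> = (\<integral>\<xi>. ?e * indicator G \<xi> \<partial>p U)" by simp
  also have "\<dots> \<le> P f U"
    unfolding P_def
  proof (rule integral_mono_AE)
    show "AE \<xi> in p U. ?e * indicator G \<xi> \<le> f (S' U \<xi>)"
      using AE_K
    proof eventually_elim
      fix \<xi>' assume "\<xi>' \<in> K"
      then show "?e * indicator G \<xi>' \<le> f (S' U \<xi>')"
        using G f(2) by (cases "\<xi>' \<in> G") (auto simp: S'_def set_eq_iff intro: less_imp_le)
    qed
  qed (use lips_integrable_S'[OF f(1)] in \<open>auto simp: less_top[symmetric]\<close>)
  finally show ?thesis .
qed

text \<open>A Lipschitz tent function stands in for the indicator of the ball, so that its iterates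
  are continuous. The paths of (GCP) make the iterate positive at every point, and compactness turns
  this into a positive minimum \<open>a\<close>.\<close>

lemma uniformly_reachable:
  assumes "0 < \<epsilon>"
  shows "\<exists>m\<ge>1. \<exists>U_hat a. 0 < a \<and> a \<le> 1 \<and> (\<exists>\<phi>\<in>lips. (\<forall>x. 0 \<le> \<phi> x \<and> \<phi> x \<le> 1) \<and>
    (\<forall>x. dist x U_hat \<ge> \<epsilon> \<longrightarrow> \<phi> x = 0) \<and> (\<forall>U. a \<le> (P ^^ m) \<phi> U))"
proof -
  obtain m U_hat where "m \<ge> 1" and path: "\<forall>U. \<exists>\<xi> :: nat \<Rightarrow> 'e. \<exists>u :: nat \<Rightarrow> 'x.
        u 0 = U \<and>
        (\<forall>k\<in>{1..m}. \<xi> k \<in> K \<and> u k = S (u (k - 1)) (\<xi> k) \<and> \<xi> k \<in> measure_supp (p (u (k - 1)))) \<and>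
        dist (u m) U_hat < \<epsilon>"
    using gcp \<open>0 < \<epsilon>\<close> unfolding GCP_def by blast
  define \<phi> where "\<phi> = (\<lambda>x. max 0 (1 - (1 / \<epsilon>) * infdist x {U_hat}))"
  have \<phi>: "\<phi> \<in> lips" unfolding \<phi>_def by (rule lips_max_infdist)
  have \<phi>01: "0 \<le> \<phi> x" "\<phi> x \<le> 1" for x
    using \<open>0 < \<epsilon>\<close> infdist_nonneg[of x "{U_hat}"] by (auto simp: \<phi>_def)
  have \<phi>0: "\<phi> x = 0" if "dist x U_hat \<ge> \<epsilon>" for x using that \<open>0 < \<epsilon>\<close> by (simp add: \<phi>_def field_simps)
  have pos: "0 < (P ^^ m) \<phi> U" for U
  proof -
    from path obtain \<xi> u where u: "u 0 = U"
      "\<And>k. k \<in> {1..m} \<Longrightarrow> \<xi> k \<in> K \<and> u k = S (u (k - 1)) (\<xi> k) \<and> \<xi> k \<in> measure_supp (p (u (k - 1)))"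
      "dist (u m) U_hat < \<epsilon>" by meson
    \<comment> \<open>Backward induction along the path: \<open>k\<close> is the number of steps
      that remain until time \<open>m\<close>.\<close>
    have "0 < (P ^^ k) \<phi> (u (m - k))" if "k \<le> m" for k
      using that
    proof (induction k)
      case 0
      then show ?case using u(3) \<open>0 < \<epsilon>\<close> by (simp add: \<phi>_def field_simps)
    next
      case (Suc k)
      let ?j = "m - k"
      have j: "?j \<in> {1..m}" "m - Suc k = ?j - 1" using Suc.prems by auto
      have "0 < P ((P ^^ k) \<phi>) (u (?j - 1))"
      proof (rule P_positive)
        show "0 \<le> (P ^^ k) \<phi> x" for x using Pn_mono[OF lips_const \<phi>, of 0 k x] \<phi>01 by simp
        show "\<xi> ?j \<in> K" "\<xi> ?j \<in> measure_supp (p (u (?j - 1)))" using u(2)[OF j(1)] by auto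
        show "0 < (P ^^ k) \<phi> (S (u (?j - 1)) (\<xi> ?j))" using u(2)[OF j(1)] Suc by auto
      qed (rule Pn_lips[OF \<phi>])
      then show ?case unfolding j(2) by (simp only: funpow.simps comp_apply)
    qed
    from this[of m] show ?thesis using u(1) by simp
  qed
  obtain x1 where x1: "\<And>x. (P ^^ m) \<phi> x1 \<le> (P ^^ m) \<phi> x"
    using continuous_attains_inf[OF compact_space _ lips_continuous[OF Pn_lips[OF \<phi>, of m]]] by auto
  have "(P ^^ m) \<phi> x1 \<le> 1" using Pn_mono[OF \<phi> lips_const, of 1 m x1] \<phi>01 by simp
  then show ?thesis using \<open>m \<ge> 1\<close> pos[of x1] \<phi> \<phi>01 \<phi>0 x1 by blast
qed

text \<open>With weight at least \<open>a\<close> the iterate sees values near \<open>U_hat\<close>,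
  which are at most \<open>f U_hat + L * \<epsilon>\<close>; the remaining values are at most the
  maximum. The same bound for \<open>- f\<close> gives a lower bound, and \<open>f U_hat\<close>
  cancels in the difference of the two.\<close>

lemma oscillation_contraction:
  assumes "0 < \<epsilon>"
  shows "\<exists>m\<ge>1. \<exists>a. 0 < a \<and> a \<le> 1 \<and> (\<forall>f L w U U'. lip_osc f L w \<longrightarrow>
    \<bar>(P ^^ m) f U - (P ^^ m) f U'\<bar> \<le> (1 - a) * w + 2 * a * (L * \<epsilon>))"
proof -
  obtain m U_hat a \<phi> where m: "m \<ge> 1" and a: "0 < a" "a \<le> 1" and \<phi>: "\<phi> \<in> lips"
    "\<And>x. 0 \<le> \<phi> x" "\<And>x. \<phi> x \<le> 1" "\<And>x. dist x U_hat \<ge> \<epsilon> \<Longrightarrow> \<phi> x = 0" "\<And>U. a \<le> (P ^^ m) \<phi> U"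
    using uniformly_reachable[OF assms] by (elim exE bexE conjE) (rule that; blast)
  have upper: "(P ^^ m) f U \<le> Mx - a * (Mx - f U_hat - L * \<epsilon>)"
    if f: "lip_osc f L w" and Mx: "\<And>x. f x \<le> Mx" for f L w U Mx
  proof -
    have lip: "f \<in> lips" by (rule lip_osc_lips[OF f])
    have L0: "0 \<le> L" using lip_osc_nonneg[OF f] by simp
    \<comment> \<open>If the difference is negative, the claim already follows from
      \<open>f \<le> Mx\<close>; the maximum with 0 includes this case.\<close>
    define b where "b = max 0 (Mx - f U_hat - L * \<epsilon>)"
    have "f x \<le> Mx + (- b) * \<phi> x" for x
    proof (cases "dist x U_hat \<ge> \<epsilon>")
      case True
      then show ?thesis using \<phi>(4) Mx by simp
    next
      case False
      have "f x - f U_hat \<le> L * dist x U_hat" using f unfolding lip_osc_def by (meson abs_le_D1)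
      also have "\<dots> \<le> L * \<epsilon>" using False L0 by (intro mult_left_mono) auto
      finally have "b \<le> Mx - f x" using Mx[of x] by (simp add: b_def)
      moreover have "b * \<phi> x \<le> b" using \<phi>(3)[of x] by (simp add: b_def mult_left_le)
      ultimately show ?thesis by simp
    qed
    then have "(P ^^ m) f U \<le> (P ^^ m) (\<lambda>x. Mx + (- b) * \<phi> x) U"
      using lip \<phi>(1) by (intro Pn_mono lips_add lips_const lips_cmult)
    also have "\<dots> = Mx + (- b) * (P ^^ m) \<phi> U"
      using Pn_add[OF lips_const[of Mx] lips_cmult[OF \<phi>(1), of "- b"], of m]
      by (simp only: Pn_const Pn_cmult)
    also have "\<dots> \<le> Mx - b * a" using mult_left_mono[OF \<phi>(5)[of U], of b] by (simp add: b_def)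
    also have "\<dots> \<le> Mx - a * (Mx - f U_hat - L * \<epsilon>)"
      using a mult_left_mono[of "Mx - f U_hat - L * \<epsilon>" b a] by (simp add: b_def mult.commute)
    finally show ?thesis .
  qed
  have "(P ^^ m) f U - (P ^^ m) f U' \<le> (1 - a) * w + 2 * a * (L * \<epsilon>)" if f: "lip_osc f L w" for f L w U U'
  proof -
    have lip: "f \<in> lips" by (rule lip_osc_lips[OF f])
    obtain x1 where x1: "\<And>x. f x \<le> f x1"
      using continuous_attains_sup[OF compact_space _ lips_continuous[OF lip]] by auto
    obtain x0 where x0: "\<And>x. f x0 \<le> f x"
      using continuous_attains_inf[OF compact_space _ lips_continuous[OF lip]] by auto
    have neg: "lip_osc (\<lambda>x. - 1 * f x) L w" using f by (auto simp: lip_osc_def abs_minus_commute)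
    have "(P ^^ m) f U \<le> f x1 - a * (f x1 - f U_hat - L * \<epsilon>)" by (rule upper[OF f x1])
    moreover have "(P ^^ m) (\<lambda>x. - 1 * f x) U' \<le> - 1 * f x0 - a * (- 1 * f x0 - - 1 * f U_hat - L * \<epsilon>)"
      using x0 by (intro upper[OF neg]) simp
    then have "- (P ^^ m) f U' \<le> - f x0 - a * (f U_hat - f x0 - L * \<epsilon>)"
      unfolding Pn_cmult by simp
    ultimately have "(P ^^ m) f U - (P ^^ m) f U' \<le> (1 - a) * (f x1 - f x0) + 2 * a * (L * \<epsilon>)"
      by (simp add: algebra_simps)
    also have "(1 - a) * (f x1 - f x0) \<le> (1 - a) * w"
    proof (rule mult_left_mono)
      show "f x1 - f x0 \<le> w" using f unfolding lip_osc_def by (meson abs_le_D1)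
    qed (use a in simp)
    finally show ?thesis by simp
  qed
  then show ?thesis using m a by (intro exI[of _ m] conjI exI[of _ a] allI impI) (auto simp: abs_le_iff)
qed

text \<open>In the norm \<open>w + \<beta> * L\<close> some iterate is a contraction: \<open>\<beta>\<close> is chosen so small that the growth \<open>C1 * w\<close> of
  the Lipschitz constant costs at most half of the gain \<open>a * w\<close>, and the error \<open>2 * a * L * \<epsilon>\<close> is
  proportional to \<open>\<beta>\<close> because \<open>\<epsilon>\<close> can be fixed before \<open>a\<close>.\<close>

lemma block_contraction:
  "\<exists>m\<ge>1. \<exists>\<beta>>0. \<exists>\<theta>. 0 < \<theta> \<and> \<theta> < 1 \<and> (\<forall>f L w. lip_osc f L w \<longrightarrow>
     (\<exists>L' w'. lip_osc ((P ^^ m) f) L' w' \<and> w' + \<beta> * L' \<le> \<theta> * (w + \<beta> * L)))"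
proof -
  \<comment> \<open>With this \<open>\<epsilon>\<close> and \<open>\<beta> = a / (2 * C1)\<close>
    one has \<open>2 * a * \<epsilon> = \<beta> * (1 - q) / 2\<close>, so that
    \<open>\<beta> * L\<close> gets the coefficient
    \<open>q + (1 - q) / 2 = (1 + q) / 2\<close>.\<close>
  define \<epsilon> where "\<epsilon> = (1 - q) / (8 * C1)"
  have "0 < \<epsilon>" using q C1 by (simp add: \<epsilon>_def)
  then obtain m a where m: "m \<ge> 1" and a: "0 < a" "a \<le> 1"
    and osc: "\<And>f L w U U'. lip_osc f L w \<Longrightarrow> \<bar>(P ^^ m) f U - (P ^^ m) f U'\<bar> \<le> (1 - a) * w + 2 * a * (L * \<epsilon>)"
    using oscillation_contraction by blast
  define \<beta> where "\<beta> = a / (2 * C1)"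
  define \<theta> where "\<theta> = max (1 - a / 2) ((1 + q) / 2)"
  have \<beta>: "0 < \<beta>" using a C1 by (simp add: \<beta>_def)
  have "lip_osc ((P ^^ m) f) (q ^ m * L + C1 * w) ((1 - a) * w + 2 * a * (L * \<epsilon>)) \<and>
      ((1 - a) * w + 2 * a * (L * \<epsilon>)) + \<beta> * (q ^ m * L + C1 * w) \<le> \<theta> * (w + \<beta> * L)"
    if f: "lip_osc f L w" for f L w
  proof
    have nonneg: "0 \<le> L" "0 \<le> w" using lip_osc_nonneg[OF f] by auto
    show "lip_osc ((P ^^ m) f) (q ^ m * L + C1 * w) ((1 - a) * w + 2 * a * (L * \<epsilon>))"
      using Pn_lip_osc[OF f, of m] osc[OF f] unfolding lip_osc_def by blast
    have "q ^ m \<le> q" using power_decreasing[of 1 m q] m q by simp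
    then have "q ^ m * L \<le> q * L" using nonneg by (intro mult_right_mono)
    then have "\<beta> * (q ^ m * L + C1 * w) \<le> \<beta> * (q * L + C1 * w)" using \<beta> by (intro mult_left_mono add_right_mono) auto
    then have "((1 - a) * w + 2 * a * (L * \<epsilon>)) + \<beta> * (q ^ m * L + C1 * w) \<le>
        (1 - a) * w + 2 * a * (L * \<epsilon>) + \<beta> * (q * L + C1 * w)" by simp
    also have "\<dots> = (1 - a / 2) * w + (1 + q) / 2 * (\<beta> * L)"
    proof -
      have "\<beta> * C1 = a / 2" using C1 by (simp add: \<beta>_def)
      moreover have "2 * a * \<epsilon> = \<beta> * (1 - q) / 2" using C1 by (simp add: \<beta>_def \<epsilon>_def field_simps)
      moreover have "(1 - a) * w + 2 * a * (L * \<epsilon>) + \<beta> * (q * L + C1 * w) =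
         (1 - a) * w + (2 * a * \<epsilon>) * L + \<beta> * q * L + (\<beta> * C1) * w" by (simp add: algebra_simps)
      ultimately show ?thesis by (simp only:) (simp add: field_simps)
    qed
    also have "\<dots> \<le> \<theta> * w + \<theta> * (\<beta> * L)"
      using nonneg \<beta> by (intro add_mono mult_right_mono) (auto simp: \<theta>_def)
    finally show "((1 - a) * w + 2 * a * (L * \<epsilon>)) + \<beta> * (q ^ m * L + C1 * w) \<le> \<theta> * (w + \<beta> * L)"
      by (simp add: algebra_simps)
  qed
  moreover have "0 < \<theta>" "\<theta> < 1" using a q by (auto simp: \<theta>_def)
  ultimately show ?thesis using m \<beta> by blast
qed

lemma oscillation_decay:
  "\<exists>A>0. \<exists>\<gamma>>0. \<forall>f L w n U U'. lip_osc f L w \<longrightarrow>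
    \<bar>(P ^^ n) f U - (P ^^ n) f U'\<bar> \<le> A * (w + L) * exp (- \<gamma> * real n)"
proof -
  obtain m \<beta> \<theta> where m: "m \<ge> 1" and \<beta>: "0 < \<beta>" and \<theta>: "0 < \<theta>" "\<theta> < 1"
    and block: "\<And>f L w. lip_osc f L w \<Longrightarrow> \<exists>L' w'. lip_osc ((P ^^ m) f) L' w' \<and> w' + \<beta> * L' \<le> \<theta> * (w + \<beta> * L)"
    using block_contraction by blast
  have blocks: "\<exists>L' w'. lip_osc ((P ^^ (m * j)) f) L' w' \<and> w' + \<beta> * L' \<le> \<theta> ^ j * (w + \<beta> * L)"
    if "lip_osc f L w" for f L w j
  proof (induction j)
    case (Suc j)
    then obtain L' w' where 1: "lip_osc ((P ^^ (m * j)) f) L' w'" "w' + \<beta> * L' \<le> \<theta> ^ j * (w + \<beta> * L)" by blast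
    then obtain L'' w'' where 2: "lip_osc ((P ^^ m) ((P ^^ (m * j)) f)) L'' w''" "w'' + \<beta> * L'' \<le> \<theta> * (w' + \<beta> * L')"
      using block by blast
    have "w'' + \<beta> * L'' \<le> \<theta> * (\<theta> ^ j * (w + \<beta> * L))"
      using 2(2) mult_left_mono[OF 1(2), of \<theta>] \<theta> by (meson less_imp_le order_trans)
    moreover have "(P ^^ m) ((P ^^ (m * j)) f) = (P ^^ (m * Suc j)) f" by (simp add: funpow_add)
    ultimately show ?case using 2(1) by (auto simp: mult.assoc)
  qed (use that in auto)
  define \<gamma> where "\<gamma> = - ln \<theta> / real m"
  \<comment> \<open>The factor \<open>1 / \<theta>\<close> pays for the incomplete last block,
    during which the oscillation does not grow, and \<open>1 + \<beta>\<close> passes from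
    \<open>w + \<beta> * L\<close> to \<open>w + L\<close>.\<close>
  define A where "A = (1 + \<beta>) / \<theta>"
  have "0 < \<gamma>" using \<theta> m by (simp add: \<gamma>_def field_simps)
  have "0 < A" using \<theta> \<beta> by (simp add: A_def)
  have "\<bar>(P ^^ n) f U - (P ^^ n) f U'\<bar> \<le> A * (w + L) * exp (- \<gamma> * real n)" if f: "lip_osc f L w" for f L w n U U'
  proof -
    define j where "j = n div m"
    have nonneg: "0 \<le> L" "0 \<le> w" using lip_osc_nonneg[OF f] by auto
    obtain L' w' where 1: "lip_osc ((P ^^ (m * j)) f) L' w'" "w' + \<beta> * L' \<le> \<theta> ^ j * (w + \<beta> * L)"
      using blocks[OF f] by blast
    have "(P ^^ n) f = (P ^^ (n mod m)) ((P ^^ (m * j)) f)"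
      unfolding j_def by (metis comp_apply funpow_add mod_mult_div_eq)
    then have "\<bar>(P ^^ n) f U - (P ^^ n) f U'\<bar> \<le> w'"
      using Pn_lip_osc[OF 1(1), of "n mod m"] by (simp add: lip_osc_def)
    also have "\<dots> \<le> \<theta> ^ j * (w + \<beta> * L)" using 1 lip_osc_nonneg[OF 1(1)] \<beta> by (smt (verit) mult_nonneg_nonneg)
    also have "\<dots> \<le> (exp (- \<gamma> * real n) / \<theta>) * ((1 + \<beta>) * (w + L))"
    proof (rule mult_mono)
      have "n < m * Suc j" unfolding j_def using m by (simp add: dividend_less_times_div)
      then have "real n \<le> real m * (real j + 1)" by (metis less_imp_le of_nat_Suc of_nat_le_iff of_nat_mult add.commute)
      then have "\<gamma> * real n \<le> \<gamma> * (real m * (real j + 1))" using \<open>0 < \<gamma>\<close> by (intro mult_left_mono) auto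
      also have "\<dots> = - ln \<theta> * (real j + 1)" using m by (simp add: \<gamma>_def)
      finally have "exp (ln \<theta> * (real j + 1)) \<le> exp (- \<gamma> * real n)" by simp
      moreover have "exp (ln \<theta> * (real j + 1)) = \<theta> ^ Suc j"
        using \<theta> exp_of_nat_mult[of "Suc j" "ln \<theta>"] by (simp add: mult.commute add.commute)
      ultimately have "\<theta> ^ Suc j \<le> exp (- \<gamma> * real n)" by (simp only:)
      then show "\<theta> ^ j \<le> exp (- \<gamma> * real n) / \<theta>" using \<theta> by (simp add: field_simps)
      show "w + \<beta> * L \<le> (1 + \<beta>) * (w + L)" using nonneg \<beta> by (simp add: algebra_simps)
    qed (use \<theta> \<beta> nonneg in auto)
    also have "\<dots> = A * (w + L) * exp (- \<gamma> * real n)" by (simp add: A_def)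
    finally show ?thesis .
  qed
  then show ?thesis using \<open>0 < A\<close> \<open>0 < \<gamma>\<close> by blast
qed

section \<open>Convergence of the iterates and the stationary measure\<close>

lemma Pn_near: "lip_osc g L w \<Longrightarrow> \<bar>(P ^^ k) g x - g y\<bar> \<le> w"
proof -
  assume g: "lip_osc g L w"
  have lip: "g \<in> lips" by (rule lip_osc_lips[OF g])
  have le: "g z \<le> g y + w \<and> g y - w \<le> g z" for z
    using g unfolding lip_osc_def by (metis abs_le_iff add.commute diff_le_eq le_diff_eq minus_diff_eq)
  have "(P ^^ k) g x \<le> g y + w" using Pn_mono[OF lip lips_const, of "g y + w" k x] le by simp
  moreover have "g y - w \<le> (P ^^ k) g x" using Pn_mono[OF lips_const lip, of "g y - w" k x] le by simp
  ultimately show ?thesis by (simp add: abs_le_iff)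
qed

lemma integral_bind_P1:
  assumes M: "M \<in> space (prob_algebra borel)" and f: "f \<in> lips"
  shows "(\<integral>x. f x \<partial>(M \<bind> P1 S p K)) = (\<integral>x. P f x \<partial>M)"
proof -
  obtain c where "\<And>x. \<bar>f x\<bar> \<le> c" using lips_bounded[OF f] by auto
  then have "(\<integral>x. f x \<partial>(M \<bind> P1 S p K)) = (\<integral>x. (\<integral>y. f y \<partial>P1 S p K x) \<partial>M)"
    by (rule integral_bind_prob[OF M P1_measurable lips_measurable[OF f]])
  then show ?thesis by (simp add: integral_P1[OF lips_measurable[OF f]])
qed

lemma Pk_prob: "Pk S p K k U \<in> space (prob_algebra borel)"
proof (induction k)
  case 0
  show ?case by (simp add: space_prob_algebra prob_space_return)
next
  case (Suc k)
  show ?case using bind_in_prob_algebra[OF Suc P1_measurable] by simp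
qed

lemma integral_Pk: "f \<in> lips \<Longrightarrow> (\<integral>x. f x \<partial>Pk S p K k U) = (P ^^ k) f U"
proof (induction k arbitrary: f)
  case 0
  then show ?case using lips_measurable by (simp add: integral_return)
next
  case (Suc k)
  then show ?case using integral_bind_P1[OF Pk_prob Suc.prems] Suc.IH[OF P_lips] by (simp add: funpow_swap1)
qed

lemma stationary_integral:
  assumes \<nu>: "stationary_measure S p K \<nu>" and f: "f \<in> lips"
  shows "(\<integral>x. (P ^^ n) f x \<partial>\<nu>) = (\<integral>x. f x \<partial>\<nu>)"
  using f
proof (induction n)
  case (Suc n)
  have \<nu>': "\<nu> \<in> space (prob_algebra borel)" "\<nu> \<bind> P1 S p K = \<nu>" using \<nu> by (auto simp: stationary_measure_def)
  show ?case using integral_bind_P1[OF \<nu>'(1) Pn_lips[OF Suc.prems, of n]] Suc \<nu>'(2) by simp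
qed simp

text \<open>Later iterates are averages of \<open>(P ^^ n) f\<close> and so differ from it by at
  most its oscillation. This makes the iterates Cauchy, with a limit that does not depend on the
  starting point. Invariance results from dropping the first iterate, and uniqueness from
  integrating the rate against another stationary measure.\<close>

lemma exists_mixing_stationary_measure:
  "\<exists>\<mu> A \<gamma>. stationary_measure S p K \<mu> \<and> (\<forall>\<nu>. stationary_measure S p K \<nu> \<longrightarrow> \<nu> = \<mu>) \<and> 0 < A \<and> 0 < \<gamma> \<and>
    (\<forall>f L w n U. lip_osc f L w \<longrightarrow> \<bar>(P ^^ n) f U - (\<integral>x. f x \<partial>\<mu>)\<bar> \<le> A * (w + L) * exp (- \<gamma> * real n))"
proof -
  obtain A \<gamma> where A: "0 < A" and \<gamma>: "0 < \<gamma>"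
    and decay: "\<And>f L w n U U'. lip_osc f L w \<Longrightarrow> \<bar>(P ^^ n) f U - (P ^^ n) f U'\<bar> \<le> A * (w + L) * exp (- \<gamma> * real n)"
    using oscillation_decay by blast
  define x0 :: 'x where "x0 = undefined"
  have lim0: "(\<lambda>n. c * exp (- \<gamma> * real n)) \<longlonglongrightarrow> 0" for c
  proof -
    have "(\<lambda>n. exp (- \<gamma>) ^ n) \<longlonglongrightarrow> 0" using \<gamma> by (intro LIMSEQ_realpow_zero) auto
    then have "(\<lambda>n. c * exp (- \<gamma>) ^ n) \<longlonglongrightarrow> c * 0" by (intro tendsto_mult tendsto_const)
    then show ?thesis by (simp add: exp_of_nat_mult[symmetric] mult.commute)
  qed
  have near: "\<bar>(P ^^ n) f U - (P ^^ (n + k)) f U'\<bar> \<le> A * (w + L) * exp (- \<gamma> * real n)"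
    if f: "lip_osc f L w" for f L w n k U U'
  proof -
    have "lip_osc ((P ^^ n) f) (q ^ n * L + C1 * w) (A * (w + L) * exp (- \<gamma> * real n))"
      using Pn_lip_osc[OF f, of n] decay[OF f, of n] unfolding lip_osc_def by blast
    then have "\<bar>(P ^^ k) ((P ^^ n) f) U' - (P ^^ n) f U\<bar> \<le> A * (w + L) * exp (- \<gamma> * real n)"
      by (rule Pn_near)
    then show ?thesis by (simp add: funpow_add add.commute[of n k] abs_minus_commute)
  qed
  define \<l> where "\<l> = (\<lambda>f. lim (\<lambda>n. (P ^^ n) f x0))"
  have lim: "(\<lambda>n. (P ^^ n) f x0) \<longlonglongrightarrow> \<l> f" if lip: "f \<in> lips" for f
  proof -
    obtain L w where f: "lip_osc f L w" using lips_lip_osc[OF lip] by blast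
    have "Cauchy (\<lambda>n. (P ^^ n) f x0)"
    proof (rule metric_CauchyI)
      fix e :: real assume "0 < e"
      then have "eventually (\<lambda>n. A * (w + L) * exp (- \<gamma> * real n) < e / 2) sequentially"
        using order_tendstoD(2)[OF lim0, of "e / 2"] by simp
      then obtain N where N: "A * (w + L) * exp (- \<gamma> * real N) < e / 2" by (auto simp: eventually_sequentially)
      have "\<bar>(P ^^ N) f x0 - (P ^^ n) f x0\<bar> < e / 2" if "n \<ge> N" for n
        using near[OF f, of N x0 "n - N" x0] N that by simp
      then have "dist ((P ^^ n) f x0) ((P ^^ n') f x0) < e" if "n \<ge> N" "n' \<ge> N" for n n'
        using that by (smt (verit) dist_real_def field_sum_of_halves)
      then show "\<exists>M. \<forall>m\<ge>M. \<forall>n\<ge>M. dist ((P ^^ m) f x0) ((P ^^ n) f x0) < e" by blast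
    qed
    then show ?thesis unfolding \<l>_def by (simp add: Cauchy_convergent convergent_LIMSEQ_iff[symmetric])
  qed
  have rate: "\<bar>(P ^^ n) f U - \<l> f\<bar> \<le> A * (w + L) * exp (- \<gamma> * real n)" if f: "lip_osc f L w" for f L w n U
  proof (rule LIMSEQ_le_const2)
    have "(\<lambda>k. (P ^^ (k + n)) f x0) \<longlonglongrightarrow> \<l> f" by (rule LIMSEQ_ignore_initial_segment[OF lim[OF lip_osc_lips[OF f]]])
    then show "(\<lambda>k. \<bar>(P ^^ n) f U - (P ^^ (n + k)) f x0\<bar>) \<longlonglongrightarrow> \<bar>(P ^^ n) f U - \<l> f\<bar>"
      by (intro tendsto_intros) (simp add: add.commute)
  qed (use near[OF f] in auto)
  have "\<exists>\<mu>\<in>space (prob_algebra borel). \<forall>f\<in>lips. \<l> f = (\<integral>x. f x \<partial>\<mu>)"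
  proof (rule positive_functional_representation[OF compact_space])
    show "\<l> (\<lambda>x. f x + g x) = \<l> f + \<l> g" if "f \<in> lips" "g \<in> lips" for f g
      using tendsto_add[OF lim[OF that(1)] lim[OF that(2)]] lim[OF lips_add[OF that]]
      by (simp add: Pn_add that LIMSEQ_unique)
    show "\<l> (\<lambda>x. c * f x) = c * \<l> f" if "f \<in> lips" for f c
      using tendsto_mult[OF tendsto_const lim[OF that], of c] lim[OF lips_cmult[OF that, of c]]
      by (simp add: Pn_cmult LIMSEQ_unique)
    show "0 \<le> \<l> f" if "f \<in> lips" "\<And>x. 0 \<le> f x" for f
    proof (rule LIMSEQ_le_const[OF lim[OF that(1)]])
      show "\<exists>N. \<forall>n\<ge>N. 0 \<le> (P ^^ n) f x0" using Pn_mono[OF lips_const that(1), of 0 _ x0] that(2) by simp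
    qed
    show "\<l> (\<lambda>_. 1) = 1" using lim[OF lips_const, of 1] by (simp add: LIMSEQ_unique LIMSEQ_const_iff)
  qed
  then obtain \<mu> where \<mu>: "\<mu> \<in> space (prob_algebra borel)" and rep: "\<And>f. f \<in> lips \<Longrightarrow> \<l> f = (\<integral>x. f x \<partial>\<mu>)" by blast
  have "\<mu> \<bind> P1 S p K = \<mu>"
  proof (rule prob_measure_eqI_lips[OF bind_in_prob_algebra[OF \<mu> P1_measurable] \<mu>])
    fix f :: "'x \<Rightarrow> real" assume f: "f \<in> lips"
    have "(\<lambda>n. (P ^^ Suc n) f x0) \<longlonglongrightarrow> \<l> f" by (rule LIMSEQ_Suc[OF lim[OF f]])
    then have "\<l> (P f) = \<l> f" using lim[OF P_lips[OF f]] by (simp add: LIMSEQ_unique funpow_swap1)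
    then show "(\<integral>x. f x \<partial>(\<mu> \<bind> P1 S p K)) = (\<integral>x. f x \<partial>\<mu>)"
      using integral_bind_P1[OF \<mu> f] rep f P_lips by simp
  qed
  then have stat: "stationary_measure S p K \<mu>" using \<mu> by (simp add: stationary_measure_def)
  have unique: "\<nu> = \<mu>" if \<nu>: "stationary_measure S p K \<nu>" for \<nu>
  proof -
    have \<nu>': "\<nu> \<in> space (prob_algebra borel)" using \<nu> by (simp add: stationary_measure_def)
    then interpret \<nu>: prob_space \<nu> by (simp add: space_prob_algebra)
    have sets\<nu>: "sets \<nu> = sets borel" using \<nu>' by (simp add: space_prob_algebra)
    show ?thesis
    proof (rule prob_measure_eqI_lips[OF \<nu>' \<mu>])
      fix f :: "'x \<Rightarrow> real" assume lip: "f \<in> lips"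
      obtain L w where f: "lip_osc f L w" using lips_lip_osc[OF lip] by blast
      have int: "integrable \<nu> g" if g: "g \<in> lips" for g :: "'x \<Rightarrow> real"
      proof -
        obtain c where "\<And>x. \<bar>g x\<bar> \<le> c" using lips_bounded[OF g] by auto
        then show ?thesis using lips_measurable[OF g] sets\<nu>
          by (intro \<nu>.integrable_const_bound[where B=c]) (auto cong: measurable_cong_sets)
      qed
      have "\<bar>(\<integral>x. f x \<partial>\<nu>) - \<l> f\<bar> \<le> A * (w + L) * exp (- \<gamma> * real n)" for n
      proof -
        have i: "integrable \<nu> (\<lambda>x. (P ^^ n) f x - \<l> f)" using int[OF Pn_lips[OF lip]] by simp
        have "(\<integral>x. f x \<partial>\<nu>) - \<l> f = (\<integral>x. (P ^^ n) f x - \<l> f \<partial>\<nu>)"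
          using stationary_integral[OF \<nu> lip, of n] int[OF Pn_lips[OF lip, of n]] by (simp add: \<nu>.prob_space)
        also have "\<bar>\<dots>\<bar> \<le> (\<integral>x. \<bar>(P ^^ n) f x - \<l> f\<bar> \<partial>\<nu>)" by (rule integral_abs_bound)
        also have "\<dots> \<le> (\<integral>x. A * (w + L) * exp (- \<gamma> * real n) \<partial>\<nu>)"
          using i rate[OF f] by (intro integral_mono) auto
        finally show ?thesis by (simp add: \<nu>.prob_space)
      qed
      then have "\<bar>(\<integral>x. f x \<partial>\<nu>) - \<l> f\<bar> \<le> 0" by (intro LIMSEQ_le_const[OF lim0]) auto
      then show "(\<integral>x. f x \<partial>\<nu>) = (\<integral>x. f x \<partial>\<mu>)" using rep[OF lip] by simp
    qed
  qed
  have "\<bar>(P ^^ n) f U - (\<integral>x. f x \<partial>\<mu>)\<bar> \<le> A * (w + L) * exp (- \<gamma> * real n)" if f: "lip_osc f L w" for f L w n U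
    using rate[OF f] rep[OF lip_osc_lips[OF f]] by simp
  then show ?thesis using stat unique A \<gamma> by blast
qed

end

subsection \<open>Trajectories\<close>

lemma sum_dist_Suc: "sum_dist (Suc n) x y = sum_dist n x y + dist (x n) (y n)"
  by (simp add: sum_dist_def)

lemma sum_dist_nonneg [simp]: "0 \<le> sum_dist n x y"
  by (simp add: sum_dist_def sum_nonneg)

lemma dist_le_sum_dist: "i < n \<Longrightarrow> dist (x i) (y i) \<le> sum_dist n x y"
  unfolding sum_dist_def by (rule member_le_sum) auto

lemma sum_dist_cong: "(\<And>i. i < n \<Longrightarrow> x i = x' i \<and> y i = y' i) \<Longrightarrow> sum_dist n x y = sum_dist n x' y'"
  unfolding sum_dist_def by (intro sum.cong) auto

lemma sum_dist_lipschitz_cong: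
  assumes "\<And>x y. \<bar>f x - f y\<bar> \<le> L * sum_dist n x y" "\<And>i. i < n \<Longrightarrow> x i = y i"
  shows "f x = (f y :: real)"
proof -
  have "sum_dist n x y = 0" using assms(2) by (simp add: sum_dist_def)
  then show ?thesis using assms(1)[of x y] by simp
qed

text \<open>On the full product over \<open>nat\<close> the product sets generate the Borel sets, so
  continuity suffices there. The map \<open>e\<close> pads a tuple with \<open>undefined\<close>, at
  coordinates that \<open>f\<close> does not see.\<close>

lemma sum_dist_lipschitz_measurable:
  fixes f :: "(nat \<Rightarrow> 'x::{metric_space, second_countable_topology}) \<Rightarrow> real"
  assumes f: "\<And>x y. \<bar>f x - f y\<bar> \<le> L * sum_dist n x y"
  shows "f \<in> borel_measurable (PiM {..<n} (\<lambda>_. borel))"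
proof -
  have coord: "((\<lambda>y. y i) \<longlongrightarrow> x i) (at x)" for i and x :: "nat \<Rightarrow> 'x"
    using continuous_on_product_coordinates[of i, where ?'b='x] by (simp add: continuous_on_def)
  have "continuous_on UNIV f"
    unfolding continuous_on_def
  proof
    fix x :: "nat \<Rightarrow> 'x"
    have "((\<lambda>y. L * sum_dist n y x) \<longlongrightarrow> L * sum_dist n x x) (at x)"
      unfolding sum_dist_def
      by (intro tendsto_intros coord[of _ x])
    then have "((\<lambda>y. L * sum_dist n y x) \<longlongrightarrow> 0) (at x)" by (simp add: sum_dist_def)
    then have "((\<lambda>y. f y - f x) \<longlongrightarrow> 0) (at x)"
      by (rule Lim_null_comparison[rotated]) (use f in simp)
    then show "(f \<longlongrightarrow> f x) (at x)" by (simp add: LIM_zero_iff)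
  qed
  then have "f \<in> borel_measurable borel" by (rule borel_measurable_continuous_onI)
  then have f_m: "f \<in> borel_measurable (PiM UNIV (\<lambda>_. borel))"
    by (simp cong: measurable_cong_sets add: sets_PiM_equal_borel)
  define e where "e = (\<lambda>(x :: nat \<Rightarrow> 'x) i. if i < n then x i else undefined)"
  have "e \<in> PiM {..<n} (\<lambda>_. borel) \<rightarrow>\<^sub>M PiM UNIV (\<lambda>_. borel)"
  proof (rule measurable_PiM_single')
    show "(\<lambda>x. e x i) \<in> PiM {..<n} (\<lambda>_. borel) \<rightarrow>\<^sub>M borel" for i
      by (cases "i < n") (auto simp: e_def)
  qed auto
  then have "(\<lambda>x. f (e x)) \<in> borel_measurable (PiM {..<n} (\<lambda>_. borel))"
    using f_m by (rule measurable_compose)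
  moreover have "f (e x) = f x" for x by (rule sum_dist_lipschitz_cong[OF f]) (simp add: e_def)
  ultimately show ?thesis by simp
qed

section \<open>Functions of a segment reduced to its first point\<close>

context rds_mixing begin

text \<open>The conditional expectation of \<open>f\<close> given the coordinates below
  \<open>n\<close>.\<close>

definition integrate_last :: "nat \<Rightarrow> ((nat \<Rightarrow> 'x) \<Rightarrow> real) \<Rightarrow> (nat \<Rightarrow> 'x) \<Rightarrow> real" where
  "integrate_last n f x = P (\<lambda>s. f (x(n := s))) (x (n - 1))"

text \<open>For a function of \<open>n + 1\<close> coordinates, the conditional expectation given
  the first one. In the base case only coordinate 0 counts, and the constant sequence stands for any
  extension.\<close>

primrec reduce :: "nat \<Rightarrow> ((nat \<Rightarrow> 'x) \<Rightarrow> real) \<Rightarrow> 'x \<Rightarrow> real" where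
  "reduce 0 f = (\<lambda>s. f (\<lambda>_. s))"
| "reduce (Suc n) f = reduce n (integrate_last (Suc n) f)"

lemma lip_osc_update:
  assumes f: "\<And>x y. \<bar>f x - f y\<bar> \<le> L * sum_dist (Suc n) x y" and W: "\<And>x. \<bar>f x\<bar> \<le> W" and "0 \<le> L"
  shows "lip_osc (\<lambda>s. f (x(n := s))) L (2 * W)"
proof -
  have "sum_dist n (x(n := s)) (x(n := t)) = 0" for s t by (simp add: sum_dist_def)
  then have "\<bar>f (x(n := s)) - f (x(n := t))\<bar> \<le> L * dist s t" for s t
    using f[of "x(n := s)" "x(n := t)"] by (simp add: sum_dist_Suc)
  moreover have "\<bar>f y - f z\<bar> \<le> 2 * W" for y z using W[of y] W[of z] by linarith
  ultimately show ?thesis using \<open>0 \<le> L\<close> by (simp add: lip_osc_def)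
qed

text \<open>The remaining coordinates act in two ways: directly through \<open>f\<close>, with
  constant \<open>L\<close>, and through coordinate \<open>n - 1\<close> as the starting point of
  the last step, where \<open>P_lip_osc\<close> gives \<open>q * L + C * (2 * W)\<close>.\<close>

lemma integrate_last_lipschitz:
  assumes f: "\<And>x y. \<bar>f x - f y\<bar> \<le> L * sum_dist (Suc n) x y" and W: "\<And>x. \<bar>f x\<bar> \<le> W" and L: "0 \<le> L" and n: "0 < n"
  shows "\<bar>integrate_last n f x - integrate_last n f y\<bar> \<le> (L + q * L + C * (2 * W)) * sum_dist n x y"
    and "\<bar>integrate_last n f x\<bar> \<le> W"
proof -
  let ?h = "\<lambda>x s. f (x(n := s))"
  have h: "lip_osc (?h x) L (2 * W)" for x by (rule lip_osc_update[OF f W L])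
  have lip: "?h x \<in> lips" for x using lip_osc_lips[OF h] .
  have W0: "0 \<le> W" using W[of undefined] by linarith
  have diff: "P (?h x) v \<le> P (?h y) v + L * sum_dist n x y" for x y v
  proof -
    have "?h x s \<le> ?h y s + L * sum_dist n x y" for s
    proof -
      have "sum_dist (Suc n) (x(n := s)) (y(n := s)) = sum_dist n x y"
        unfolding sum_dist_Suc by (simp add: sum_dist_def)
      then show ?thesis using f[of "x(n := s)" "y(n := s)"] by (simp add: abs_le_iff)
    qed
    then have "P (?h x) v \<le> P (\<lambda>s. ?h y s + L * sum_dist n x y) v" by (intro P_mono lip lips_add lips_const)
    then show ?thesis by (simp add: P_add lip)
  qed
  have "\<bar>P (?h x) (x (n - 1)) - P (?h x) (y (n - 1))\<bar> \<le> (q * L + C * (2 * W)) * dist (x (n - 1)) (y (n - 1))"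
    using P_lip_osc[OF h] by (simp add: lip_osc_def)
  also have "\<dots> \<le> (q * L + C * (2 * W)) * sum_dist n x y"
    using n q C L W0 by (intro mult_left_mono dist_le_sum_dist) auto
  finally show "\<bar>integrate_last n f x - integrate_last n f y\<bar> \<le> (L + q * L + C * (2 * W)) * sum_dist n x y"
    using diff[of x "y (n - 1)" y] diff[of y "y (n - 1)" x]
    unfolding integrate_last_def by (simp add: algebra_simps abs_le_iff sum_dist_def dist_commute)
  have "- W \<le> f y" "f y \<le> W" for y using W[of y] by (auto simp: abs_le_iff)
  then have "P (\<lambda>_. - W) (x (n - 1)) \<le> P (?h x) (x (n - 1))" "P (?h x) (x (n - 1)) \<le> P (\<lambda>_. W) (x (n - 1))"
    by (intro P_mono lip lips_const; simp)+
  then show "\<bar>integrate_last n f x\<bar> \<le> W" by (simp add: integrate_last_def abs_le_iff)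
qed

text \<open>The order of the quantifiers matters: one \<open>G\<close> serves all \<open>f\<close>,
  so the final constant \<open>C\<^sub>s\<close> does not depend on the test function.\<close>

lemma reduce_lip_osc:
  assumes "0 \<le> W" "0 \<le> L"
  shows "\<exists>G\<ge>0. \<forall>f. (\<forall>x y. \<bar>f x - f y\<bar> \<le> L * sum_dist (Suc n) x y) \<and> (\<forall>x. \<bar>f x\<bar> \<le> W) \<longrightarrow>
    lip_osc (reduce n f) G (2 * W)"
  using \<open>0 \<le> L\<close>
proof (induction n arbitrary: L)
  case 0
  have "lip_osc (\<lambda>s. f (\<lambda>_. s)) L (2 * W)"
    if f: "\<And>x y. \<bar>f x - f y\<bar> \<le> L * sum_dist (Suc 0) x y" "\<And>x. \<bar>f x\<bar> \<le> W" for f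
  proof -
    have "f (\<lambda>_. s) = f (undefined(0 := s))" for s by (rule sum_dist_lipschitz_cong[OF f(1)]) simp
    then show ?thesis using lip_osc_update[OF f 0] by simp
  qed
  then show ?case using 0 by (intro exI[of _ L]) auto
next
  case (Suc n)
  let ?L = "L + q * L + C * (2 * W)"
  have "0 \<le> ?L" using Suc.prems q C assms(1) by auto
  then obtain G where "G \<ge> 0" and G: "\<And>f. (\<forall>x y. \<bar>f x - f y\<bar> \<le> ?L * sum_dist (Suc n) x y) \<Longrightarrow> (\<forall>x. \<bar>f x\<bar> \<le> W) \<Longrightarrow>
      lip_osc (reduce n f) G (2 * W)" using Suc.IH[of ?L] by blast
  then show ?case
    using integrate_last_lipschitz[OF _ _ Suc.prems, of _ "Suc n" W]
    by (intro exI[of _ G] conjI allI impI) auto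
qed

end

text \<open>Measurability for every measure that makes the first fields measurable; this is applied both to
  the whole space and to the past of a given time.\<close>

lemma (in rds) trajectory_measurable:
  assumes \<F>0: "U0 \<in> \<F> 0 \<rightarrow>\<^sub>M borel"
    and \<F>: "\<And>k. k \<ge> 1 \<Longrightarrow> (\<lambda>(U, \<omega>). \<zeta> k U \<omega>) \<in> borel \<Otimes>\<^sub>M \<F> k \<rightarrow>\<^sub>M borel"
    and \<zeta>K: "\<And>k U \<omega>. k \<ge> 1 \<Longrightarrow> \<omega> \<in> \<Omega> \<Longrightarrow> \<zeta> k U \<omega> \<in> K"
    and N: "space N = \<Omega>" "\<And>i. i \<le> k \<Longrightarrow> space (\<F> i) = \<Omega>" "\<And>i. i \<le> k \<Longrightarrow> sets (\<F> i) \<subseteq> sets N"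
  shows "trajectory S \<zeta> U0 k \<in> N \<rightarrow>\<^sub>M borel"
  using N(2,3)
proof (induction k)
  case 0
  have "(\<lambda>\<omega>. \<omega>) \<in> N \<rightarrow>\<^sub>M \<F> 0" using 0 N(1) by (intro measurableI) (auto simp: sets.Int_space_eq2)
  then have "(\<lambda>\<omega>. U0 \<omega>) \<in> N \<rightarrow>\<^sub>M borel" using \<F>0 by (rule measurable_compose)
  then show ?case by (simp add: measurable_def)
next
  case (Suc k)
  have V [measurable]: "trajectory S \<zeta> U0 k \<in> N \<rightarrow>\<^sub>M borel" using Suc by auto
  have id: "(\<lambda>\<omega>. \<omega>) \<in> N \<rightarrow>\<^sub>M \<F> (Suc k)" using Suc.prems[of "Suc k"] N(1) by (intro measurableI) auto
  have [measurable]: "(\<lambda>\<omega>. \<zeta> (Suc k) (trajectory S \<zeta> U0 k \<omega>) \<omega>) \<in> N \<rightarrow>\<^sub>M borel"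
    using measurable_compose[OF measurable_Pair[OF V id] \<F>[of "Suc k"]] by simp
  have "(\<lambda>\<omega>. S' (trajectory S \<zeta> U0 k \<omega>) (\<zeta> (Suc k) (trajectory S \<zeta> U0 k \<omega>) \<omega>)) \<in> N \<rightarrow>\<^sub>M borel"
    by measurable
  moreover have "S' (trajectory S \<zeta> U0 k \<omega>) (\<zeta> (Suc k) (trajectory S \<zeta> U0 k \<omega>) \<omega>) = trajectory S \<zeta> U0 (Suc k) \<omega>"
    if "\<omega> \<in> space N" for \<omega> using \<zeta>K[of "Suc k"] that N(1) by (simp add: S'_def)
  ultimately show ?case by (simp cong: measurable_cong)
qed

section \<open>The Markov property along trajectories\<close>

context rds_mixing begin

text \<open>The first \<open>n\<close> entries of the segment depend only on the fields up to time
  \<open>j = k + n - 1\<close>, while the last one is a function of these entries and of the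
  independent next field. Fubini freezes the starting point, and at a frozen point \<open>u\<close>
  the next noise has law \<open>p u\<close>.\<close>

lemma markov_step:
  fixes M :: "'w measure" and k n :: nat
  assumes rf: "random_fields M p K \<zeta> U0" and n: "0 < n"
    and f: "\<And>x y. \<bar>f x - f y\<bar> \<le> L * sum_dist (Suc n) x y" and W: "\<And>x. \<bar>f x\<bar> \<le> W" and L: "0 \<le> L"
  defines "V \<equiv> trajectory S \<zeta> U0"
  shows "(\<integral>\<omega>. f (\<lambda>i\<in>{..<Suc n}. V (k + i) \<omega>) \<partial>M) = (\<integral>\<omega>. integrate_last n f (\<lambda>i\<in>{..<n}. V (k + i) \<omega>) \<partial>M)"
    and "V k \<in> M \<rightarrow>\<^sub>M borel"
proof -
  from rf obtain \<F> where prob: "prob_space M" and sub: "\<forall>k. subalgebra M (\<F> k)"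
    and indep: "prob_space.indep_sets M (\<lambda>k. sets (\<F> k)) UNIV" and U0: "U0 \<in> \<F> 0 \<rightarrow>\<^sub>M borel"
    and \<zeta>: "\<forall>k\<ge>1. (\<lambda>(U, \<omega>). \<zeta> k U \<omega>) \<in> borel \<Otimes>\<^sub>M \<F> k \<rightarrow>\<^sub>M borel \<and>
      (\<forall>U. \<forall>\<omega>\<in>space M. \<zeta> k U \<omega> \<in> K) \<and> (\<forall>U. distr M borel (\<zeta> k U) = p U)"
    unfolding random_fields_def by (elim exE conjE) (rule that; assumption)
  have \<zeta>m: "(\<lambda>(U, \<omega>). \<zeta> k U \<omega>) \<in> borel \<Otimes>\<^sub>M \<F> k \<rightarrow>\<^sub>M borel"
    and \<zeta>K: "\<omega> \<in> space M \<Longrightarrow> \<zeta> k U \<omega> \<in> K"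
    and law: "distr M borel (\<zeta> k U) = p U" if "k \<ge> 1" for k U \<omega>
    using \<zeta> that by blast+
  interpret prob_space M by (rule prob)
  have sp: "space (\<F> i) = space M" and sets: "sets (\<F> i) \<subseteq> sets M" for i using sub by (auto simp: subalgebra_def)
  note traj = trajectory_measurable[where \<F>=\<F> and \<zeta>=\<zeta> and \<Omega>="space M" and ?U0.0=U0, OF U0 \<zeta>m \<zeta>K, folded V_def]
  show "V k \<in> M \<rightarrow>\<^sub>M borel" for k by (rule traj) (use sp sets in auto)
  define j where "j = k + (n - 1)"
  define N where "N = PiM {..<n} (\<lambda>_::nat. borel :: 'x measure)"
  define X where "X = (\<lambda>\<omega>. \<lambda>i\<in>{..<n}. V (k + i) \<omega>)"
  define \<G> where "\<G> = sigma (space M) (\<Union>i\<in>{..j}. sets (\<F> i))"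
  have pow: "(\<Union>i\<in>{..j}. sets (\<F> i)) \<subseteq> Pow (space M)" using sets.sets_into_space[of _ "\<F> _"] sp by blast
  have \<F>\<G>: "sets (\<F> i) \<subseteq> sets \<G>" if "i \<le> j" for i
    unfolding \<G>_def sets_measure_of[OF pow] using that by (intro subsetI sigma_sets.Basic UN_I[of i]) auto
  have X\<G>: "X \<in> \<G> \<rightarrow>\<^sub>M N"
    unfolding X_def N_def
  proof (rule measurable_restrict)
    fix i assume "i \<in> {..<n}"
    then have "k + i \<le> j" by (auto simp: j_def)
    then show "V (k + i) \<in> \<G> \<rightarrow>\<^sub>M borel"
      using sp \<F>\<G> by (intro traj) (auto simp: \<G>_def space_measure_of_conv)
  qed
  have \<G>_sub: "sets \<G> \<subseteq> sets M"
    unfolding \<G>_def using pow sets by (subst sets_measure_of) (auto intro!: sets.sigma_sets_subset)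
  have XM: "X \<in> M \<rightarrow>\<^sub>M N"
    using X\<G> \<G>_sub by (intro measurable_mono[THEN subsetD, OF _ _ _ _ X\<G>]) (auto simp: \<G>_def space_measure_of_conv)
  have id: "(\<lambda>\<omega>. \<omega>) \<in> M \<rightarrow>\<^sub>M \<F> (Suc j)"
    using sp sets by (intro measurableI) (auto simp: subset_iff)
  have indep2: "indep_sets (\<lambda>b. sigma_sets (space M) (\<Union>i\<in>(case b of True \<Rightarrow> {..j} | False \<Rightarrow> {Suc j}). sets (\<F> i))) UNIV"
  proof (rule indep_sets_collect_sigma)
    show "indep_sets (\<lambda>k. sets (\<F> k)) (\<Union>b\<in>UNIV. case b of True \<Rightarrow> {..j} | False \<Rightarrow> {Suc j})"
      by (rule indep_sets_mono_index[OF _ indep]) auto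
    show "disjoint_family (\<lambda>b. case b of True \<Rightarrow> {..j} | False \<Rightarrow> {Suc j})"
      by (auto simp: disjoint_family_on_def split: bool.split)
    show "Int_stable (sets (\<F> i))" for i by (auto simp: Int_stable_def)
  qed
  have indep3: "indep_set (sigma_sets (space M) (\<Union>i\<in>{..j}. sets (\<F> i))) (sigma_sets (space M) (sets (\<F> (Suc j))))"
    unfolding indep_set_def by (rule indep_sets_mono_sets[OF indep2]) (auto split: bool.split)
  have law': "prob_space (distr M N X)" "prob_space (distr M (\<F> (Suc j)) (\<lambda>\<omega>. \<omega>))"
    using XM id by (auto intro: prob_space_distr)
  \<comment> \<open>The second component is the whole outcome \<open>\<omega>\<close> seen through
    \<open>\<F> (Suc j)\<close>, not the value of one \<open>\<zeta> (Suc j) U\<close>: the field is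
    evaluated at a random point, so all its values are needed at once.\<close>
  have joint: "distr M N X \<Otimes>\<^sub>M distr M (\<F> (Suc j)) (\<lambda>\<omega>. \<omega>) = distr M (N \<Otimes>\<^sub>M \<F> (Suc j)) (\<lambda>\<omega>. (X \<omega>, \<omega>))"
  proof (rule pair_measure_eqI)
    fix A B assume "A \<in> sets (distr M N X)" "B \<in> sets (distr M (\<F> (Suc j)) (\<lambda>\<omega>. \<omega>))"
    then have A: "A \<in> sets N" and B: "B \<in> sets (\<F> (Suc j))" by auto
    have XA: "X -` A \<inter> space M \<in> sigma_sets (space M) (\<Union>i\<in>{..j}. sets (\<F> i))"
      using measurable_sets[OF X\<G> A] pow by (simp add: \<G>_def sets_measure_of space_measure_of_conv)
    have BM: "B \<subseteq> space M" using sets.sets_into_space[OF B] sp by simp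
    have "prob ((X -` A \<inter> space M) \<inter> B) = prob (X -` A \<inter> space M) * prob B"
      by (rule indep_setD[OF indep3 XA sigma_sets.Basic[OF B]])
    moreover have "(\<lambda>\<omega>. (X \<omega>, \<omega>)) -` (A \<times> B) \<inter> space M = (X -` A \<inter> space M) \<inter> B"
      "(\<lambda>\<omega>. \<omega>) -` B \<inter> space M = B" using BM by auto
    ultimately show "emeasure (distr M N X) A * emeasure (distr M (\<F> (Suc j)) (\<lambda>\<omega>. \<omega>)) B =
        emeasure (distr M (N \<Otimes>\<^sub>M \<F> (Suc j)) (\<lambda>\<omega>. (X \<omega>, \<omega>))) (A \<times> B)"
      using XM id A B by (simp add: emeasure_distr emeasure_eq_measure ennreal_mult)
  qed (use law' in \<open>auto simp: prob_space_imp_sigma_finite cong: sets_pair_measure_cong\<close>)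
  define H where "H = (\<lambda>(x, \<omega>). f (x(n := S' (x (n - 1)) (\<zeta> (Suc j) (x (n - 1)) \<omega>))))"
  have fm: "f \<in> borel_measurable (PiM (insert n {..<n}) (\<lambda>_. borel))"
    using sum_dist_lipschitz_measurable[OF f] by (simp add: lessThan_Suc)
  have Hm [measurable]: "H \<in> borel_measurable (N \<Otimes>\<^sub>M \<F> (Suc j))"
  proof -
    have 1 [measurable]: "(\<lambda>z. fst z (n - 1)) \<in> N \<Otimes>\<^sub>M \<F> (Suc j) \<rightarrow>\<^sub>M borel"
      using n unfolding N_def by (intro measurable_compose[OF measurable_fst] measurable_component_singleton) auto
    have 2 [measurable]: "(\<lambda>z. \<zeta> (Suc j) (fst z (n - 1)) (snd z)) \<in> N \<Otimes>\<^sub>M \<F> (Suc j) \<rightarrow>\<^sub>M borel"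
      using measurable_compose[OF measurable_Pair[OF 1 measurable_snd] \<zeta>m[of "Suc j"]] by simp
    have 3: "(\<lambda>z. S' (fst z (n - 1)) (\<zeta> (Suc j) (fst z (n - 1)) (snd z))) \<in> N \<Otimes>\<^sub>M \<F> (Suc j) \<rightarrow>\<^sub>M borel"
      by measurable
    have "(\<lambda>z. (fst z)(n := S' (fst z (n - 1)) (\<zeta> (Suc j) (fst z (n - 1)) (snd z)))) \<in>
        N \<Otimes>\<^sub>M \<F> (Suc j) \<rightarrow>\<^sub>M PiM (insert n {..<n}) (\<lambda>_. borel)"
      by (intro measurable_fun_upd[where J="{..<n}"] 3) (auto simp: N_def)
    from measurable_compose[OF this fm] show ?thesis by (simp add: H_def case_prod_beta)
  qed
  interpret pair: pair_prob_space "distr M N X" "distr M (\<F> (Suc j)) (\<lambda>\<omega>. \<omega>)"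
    using law' by (simp add: pair_prob_space_def pair_sigma_finite_def prob_space_imp_sigma_finite)
  have "f (\<lambda>i\<in>{..<Suc n}. V (k + i) \<omega>) = H (X \<omega>, \<omega>)" if "\<omega> \<in> space M" for \<omega>
  proof -
    have kn: "k + n = Suc j" "k + (n - Suc 0) = j" using n by (auto simp: j_def)
    have "V (Suc j) \<omega> = S' (V j \<omega>) (\<zeta> (Suc j) (V j \<omega>) \<omega>)"
      using \<zeta>K[of "Suc j" \<omega>] that by (simp add: V_def S'_def)
    then have "(\<lambda>i\<in>{..<Suc n}. V (k + i) \<omega>) = (X \<omega>)(n := S' (X \<omega> (n - 1)) (\<zeta> (Suc j) (X \<omega> (n - 1)) \<omega>))"
      using n kn by (auto simp: X_def fun_eq_iff less_Suc_eq)
    then show ?thesis by (simp add: H_def)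
  qed
  then have "(\<integral>\<omega>. f (\<lambda>i\<in>{..<Suc n}. V (k + i) \<omega>) \<partial>M) = (\<integral>\<omega>. H (X \<omega>, \<omega>) \<partial>M)"
    by (intro Bochner_Integration.integral_cong) auto
  also have "\<dots> = (\<integral>z. H z \<partial>distr M (N \<Otimes>\<^sub>M \<F> (Suc j)) (\<lambda>\<omega>. (X \<omega>, \<omega>)))"
    using XM id by (intro integral_distr[symmetric]) auto
  also have "\<dots> = (\<integral>z. H z \<partial>(distr M N X \<Otimes>\<^sub>M distr M (\<F> (Suc j)) (\<lambda>\<omega>. \<omega>)))" by (simp only: joint)
  also have "\<dots> = (\<integral>x. (\<integral>\<omega>. H (x, \<omega>) \<partial>distr M (\<F> (Suc j)) (\<lambda>\<omega>. \<omega>)) \<partial>distr M N X)"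
  proof (rule pair.integral_fst'[symmetric])
    show "integrable (distr M N X \<Otimes>\<^sub>M distr M (\<F> (Suc j)) (\<lambda>\<omega>. \<omega>)) H"
    proof (rule pair.P.integrable_const_bound[where B=W])
      show "H \<in> borel_measurable (distr M N X \<Otimes>\<^sub>M distr M (\<F> (Suc j)) (\<lambda>\<omega>. \<omega>))"
        using Hm by (subst measurable_cong_sets[OF sets_pair_measure_cong[OF sets_distr sets_distr] refl])
    qed (use W in \<open>auto simp: H_def\<close>)
  qed
  also have "\<dots> = (\<integral>x. integrate_last n f x \<partial>distr M N X)"
  proof (rule Bochner_Integration.integral_cong)
    fix x assume "x \<in> space (distr M N X)"
    then have x: "x \<in> space N" by simp
    let ?u = "x (n - 1)"
    have [measurable]: "\<zeta> (Suc j) ?u \<in> \<F> (Suc j) \<rightarrow>\<^sub>M borel"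
      using measurable_Pair2[OF \<zeta>m[of "Suc j"], of ?u] by simp
    have \<zeta>M: "\<zeta> (Suc j) ?u \<in> M \<rightarrow>\<^sub>M borel" by (rule measurable_compose[OF id]) measurable
    have lip: "(\<lambda>s. f (x(n := s))) \<in> lips" by (rule lip_osc_lips[OF lip_osc_update[OF f W L]])
    have hm: "(\<lambda>\<xi>. f (x(n := S' ?u \<xi>))) \<in> borel_measurable borel"
      by (rule measurable_compose[OF S'_measurable1 lips_measurable[OF lip]])
    have "(\<integral>\<omega>. H (x, \<omega>) \<partial>distr M (\<F> (Suc j)) (\<lambda>\<omega>. \<omega>)) = (\<integral>\<omega>. H (x, \<omega>) \<partial>M)"
      using x by (intro integral_distr id measurable_compose[OF measurable_Pair1' Hm])
    also have "\<dots> = (\<integral>\<xi>. f (x(n := S' ?u \<xi>)) \<partial>distr M borel (\<zeta> (Suc j) ?u))"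
      unfolding H_def using \<zeta>M hm by (simp add: integral_distr)
    also have "\<dots> = integrate_last n f x" by (simp add: law integrate_last_def P_def)
    finally show "(\<integral>\<omega>. H (x, \<omega>) \<partial>distr M (\<F> (Suc j)) (\<lambda>\<omega>. \<omega>)) = integrate_last n f x" .
  qed simp
  also have "\<dots> = (\<integral>\<omega>. integrate_last n f (X \<omega>) \<partial>M)"
    using sum_dist_lipschitz_measurable[OF integrate_last_lipschitz(1)[OF f W L n]]
    by (intro integral_distr XM) (simp add: N_def)
  finally show "(\<integral>\<omega>. f (\<lambda>i\<in>{..<Suc n}. V (k + i) \<omega>) \<partial>M) = (\<integral>\<omega>. integrate_last n f (\<lambda>i\<in>{..<n}. V (k + i) \<omega>) \<partial>M)"
    by (simp add: X_def)
qed

lemma integral_reduce: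
  assumes rf: "random_fields M p K \<zeta> U0"
    and "\<And>x y. \<bar>f x - f y\<bar> \<le> L * sum_dist (Suc n) x y" and "\<And>x. \<bar>f x\<bar> \<le> W" and "0 \<le> L"
  shows "(\<integral>\<omega>. f (\<lambda>i\<in>{..<Suc n}. trajectory S \<zeta> U0 (k + i) \<omega>) \<partial>M) = (\<integral>\<omega>. reduce n f (trajectory S \<zeta> U0 k \<omega>) \<partial>M)"
  using assms(2-4)
proof (induction n arbitrary: f L)
  case 0
  have "f (\<lambda>i\<in>{..<Suc 0}. trajectory S \<zeta> U0 (k + i) \<omega>) = f (\<lambda>_. trajectory S \<zeta> U0 k \<omega>)" for \<omega>
    by (rule sum_dist_lipschitz_cong[OF 0(1)]) simp
  then show ?case by (simp only: reduce.simps)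
next
  case (Suc n)
  have W0: "0 \<le> W" using Suc.prems(2)[of undefined] by linarith
  have "(\<integral>\<omega>. f (\<lambda>i\<in>{..<Suc (Suc n)}. trajectory S \<zeta> U0 (k + i) \<omega>) \<partial>M) =
      (\<integral>\<omega>. integrate_last (Suc n) f (\<lambda>i\<in>{..<Suc n}. trajectory S \<zeta> U0 (k + i) \<omega>) \<partial>M)"
    by (rule markov_step(1)[OF rf zero_less_Suc Suc.prems])
  also have "\<dots> = (\<integral>\<omega>. reduce n (integrate_last (Suc n) f) (trajectory S \<zeta> U0 k \<omega>) \<partial>M)"
    using q C W0 Suc.prems(3) by (intro Suc.IH[OF integrate_last_lipschitz[OF Suc.prems zero_less_Suc]]) auto
  finally show ?case by (simp only: reduce.simps)
qed

lemma integral_trajectory: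
  assumes rf: "random_fields M p K \<zeta> (\<lambda>_. U)" and g: "lip_osc g L w"
  shows "(\<integral>\<omega>. g (trajectory S \<zeta> (\<lambda>_. U) k \<omega>) \<partial>M) = (P ^^ k) g U"
  using g
proof (induction k arbitrary: g L)
  case 0
  have "prob_space M" using rf by (simp add: random_fields_def)
  then show ?case by (simp add: prob_space.prob_space)
next
  case (Suc k)
  obtain c where c: "\<And>x. \<bar>g x\<bar> \<le> c" using lips_bounded[OF lip_osc_lips[OF Suc.prems]] by auto
  have L: "0 \<le> L" using lip_osc_nonneg[OF Suc.prems] by simp
  \<comment> \<open>A function of one point is treated as a function of a segment of length 2 that
    ignores the first entry, so that the Markov step applies.\<close>
  have "\<bar>g (x 1) - g (y 1)\<bar> \<le> L * sum_dist (Suc 1) x y" for x y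
  proof -
    have "\<bar>g (x 1) - g (y 1)\<bar> \<le> L * dist (x 1) (y 1)" using Suc.prems by (simp add: lip_osc_def)
    also have "\<dots> \<le> L * sum_dist (Suc 1) x y" using L by (intro mult_left_mono dist_le_sum_dist) auto
    finally show ?thesis .
  qed
  from markov_step(1)[OF rf zero_less_one this c L, of k]
  have "(\<integral>\<omega>. g (trajectory S \<zeta> (\<lambda>_. U) (Suc k) \<omega>) \<partial>M) = (\<integral>\<omega>. P g (trajectory S \<zeta> (\<lambda>_. U) k \<omega>) \<partial>M)"
    by (simp add: integrate_last_def)
  also have "\<dots> = (P ^^ k) (P g) U" by (rule Suc.IH[OF P_lip_osc[OF Suc.prems]])
  finally show ?case by (simp add: funpow_swap1)
qed

end

section \<open>Passage to the dual-Lipschitz distance\<close>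

lemma dual_lip_dist_le:
  assumes "\<And>x y. x \<in> space \<mu> \<Longrightarrow> y \<in> space \<mu> \<Longrightarrow> 0 \<le> d x y"
    and "\<And>f. (\<forall>x\<in>space \<mu>. \<bar>f x\<bar> \<le> 1) \<Longrightarrow> (\<forall>x\<in>space \<mu>. \<forall>y\<in>space \<mu>. \<bar>f x - f y\<bar> \<le> d x y) \<Longrightarrow>
      \<bar>(\<integral>x. f x \<partial>\<mu>) - (\<integral>x. f x \<partial>\<nu>)\<bar> \<le> c"
  shows "dual_lip_dist d \<mu> \<nu> \<le> c"
  unfolding dual_lip_dist_def
proof (rule cSUP_least)
  have "(\<lambda>_. 0) \<in> {f :: 'a \<Rightarrow> real. (\<forall>x\<in>space \<mu>. \<bar>f x\<bar> \<le> 1) \<and> (\<forall>x\<in>space \<mu>. \<forall>y\<in>space \<mu>. \<bar>f x - f y\<bar> \<le> d x y)}"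
    using assms(1) by simp
  then show "{f :: 'a \<Rightarrow> real. (\<forall>x\<in>space \<mu>. \<bar>f x\<bar> \<le> 1) \<and>
      (\<forall>x\<in>space \<mu>. \<forall>y\<in>space \<mu>. \<bar>f x - f y\<bar> \<le> d x y)} \<noteq> {}" by (metis empty_iff)
qed (use assms(2) in auto)

text \<open>The test functions of \<open>dual_lip_dist\<close> are controlled only on the carrier of
  the product, that is, on extensional tuples. Composition with the restriction \<open>R n\<close>
  extends the bounds to all sequences.\<close>

lemma (in rds_mixing) integral_segment_law:
  fixes M :: "'w measure" and f :: "(nat \<Rightarrow> 'x) \<Rightarrow> real"
  defines "R \<equiv> \<lambda>n x. restrict x {..<Suc n}"
  assumes rf: "random_fields M p K \<zeta> U0"
    and f: "\<And>x y. \<bar>f (R n x) - f (R n y)\<bar> \<le> L * sum_dist (Suc n) x y" "\<And>x. \<bar>f (R n x)\<bar> \<le> W" and L: "0 \<le> L"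
  shows "(\<integral>x. f x \<partial>segment_law M (trajectory S \<zeta> U0) k (Suc n)) =
    (\<integral>\<omega>. reduce n (\<lambda>x. f (R n x)) (trajectory S \<zeta> U0 k \<omega>) \<partial>M)"
proof -
  let ?N = "PiM {..<Suc n} (\<lambda>_::nat. borel :: 'x measure)"
  have V: "trajectory S \<zeta> U0 k \<in> M \<rightarrow>\<^sub>M borel" for k
    by (rule markov_step(2)[OF rf zero_less_Suc, of "\<lambda>_. 0" 0 0 0]) auto
  have "(\<lambda>x. f (R n x)) \<in> borel_measurable ?N" by (rule sum_dist_lipschitz_measurable[OF f(1)])
  moreover have "f (R n x) = f x" if "x \<in> space ?N" for x
    using that by (simp add: R_def space_PiM PiE_iff extensional_restrict)
  ultimately have fm: "f \<in> borel_measurable ?N" by (simp cong: measurable_cong)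
  have "(\<integral>x. f x \<partial>segment_law M (trajectory S \<zeta> U0) k (Suc n)) =
      (\<integral>\<omega>. f (\<lambda>i\<in>{..<Suc n}. trajectory S \<zeta> U0 (k + i) \<omega>) \<partial>M)"
    unfolding segment_law_def by (intro integral_distr fm measurable_restrict V)
  also have "\<dots> = (\<integral>\<omega>. f (R n (\<lambda>i\<in>{..<Suc n}. trajectory S \<zeta> U0 (k + i) \<omega>)) \<partial>M)"
    by (simp add: R_def)
  also have "\<dots> = (\<integral>\<omega>. reduce n (\<lambda>x. f (R n x)) (trajectory S \<zeta> U0 k \<omega>) \<partial>M)"
    by (rule integral_reduce[OF rf f L])
  finally show ?thesis .
qed

theorem theorem2p3:
  fixes S :: "'x::{metric_space, second_countable_topology} \<Rightarrow>
              'e::{banach, second_countable_topology} \<Rightarrow> 'x"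
    and p :: "'x \<Rightarrow> 'e measure"
    and K F :: "'e set"
  assumes "compact (UNIV :: 'x set)"
    and "p \<in> borel \<rightarrow>\<^sub>M prob_algebra borel"
    and "compact K"
    and "\<exists>L. \<forall>U U'. \<forall>\<xi>\<in>K. \<forall>\<xi>'\<in>K. dist (S U \<xi>) (S U' \<xi>') \<le> L * (dist U U' + norm (\<xi> - \<xi>'))"
    and "DN p K"
    and "GCP S p K"
    and "LAC S K F"
    and "DLP p F"
  shows "\<exists>\<mu>. stationary_measure S p K \<mu> \<and> (\<forall>\<nu>. stationary_measure S p K \<nu> \<longrightarrow> \<nu> = \<mu>) \<and>
    (\<exists>C>0. \<exists>\<gamma>>0.
      (\<forall>U k. dual_lip_dist dist (Pk S p K k U) \<mu> \<le> C * exp (- \<gamma> * real k)) \<and>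
      (\<forall>(N :: 'v measure) \<zeta>' V0.
         random_fields N p K \<zeta>' V0 \<and> (\<forall>k. distr N borel (trajectory S \<zeta>' V0 k) = \<mu>) \<longrightarrow>
         (\<forall>s\<ge>1. \<exists>C\<^sub>s>0. \<forall>(M :: 'w measure) \<zeta> U k.
            random_fields M p K \<zeta> (\<lambda>_. U) \<longrightarrow>
            dual_lip_dist (sum_dist (s + 1))
              (segment_law M (trajectory S \<zeta> (\<lambda>_. U)) k (s + 1))
              (segment_law N (trajectory S \<zeta>' V0) 1 (s + 1))
            \<le> C\<^sub>s * exp (- \<gamma> * real k))))"
proof -
  interpret rds S p K
    using assms by unfold_locales (auto simp: DN_def)
  obtain C0 where "0 < C0" and C0: "\<And>U U'. tv_dist (p U) (p U') \<le> C0 * dist U U'"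
    using \<open>DN p K\<close> by (auto simp: DN_def)
  have tv: "\<forall>U U'. \<forall>A\<in>sets borel. measure (p U) A \<le> measure (p U') A + C0 * dist U U'"
  proof (intro allI ballI)
    fix U U' and A :: "'e set" assume "A \<in> sets borel"
    then show "measure (p U) A \<le> measure (p U') A + C0 * dist U U'"
      using measure_diff_le_tv_dist[OF prob_p prob_p, of A U U'] C0[of U U'] by simp
  qed
  obtain q C where qC: "0 < q" "q < 1" "0 < C"
    and P: "\<forall>f L w U U'. (\<forall>x y. \<bar>f x - f y\<bar> \<le> L * dist x y) \<and> 0 \<le> L \<and> (\<forall>x y. \<bar>f x - f y\<bar> \<le> w) \<longrightarrow>
      \<bar>P f U - P f U'\<bar> \<le> (q * L + C * w) * dist U U'"
    using lasota_yorke[OF \<open>LAC S K F\<close> \<open>DLP p F\<close> tv \<open>0 < C0\<close>] by (elim exE conjE) (rule that; assumption)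
  have P_lip_osc: "lip_osc (P f) (q * L + C * w) w" if f: "lip_osc f L w" for f L w
  proof -
    have "\<bar>P f U - P f U'\<bar> \<le> w" for U U'
      using f P_oscillation[OF lip_osc_lips[OF f]] by (simp add: lip_osc_def)
    moreover have "\<bar>P f U - P f U'\<bar> \<le> (q * L + C * w) * dist U U'" for U U'
      using P f unfolding lip_osc_def by blast
    ultimately show ?thesis using lip_osc_nonneg[OF f] qC by (simp add: lip_osc_def)
  qed
  interpret rds_mixing S p K q C
    by unfold_locales (fact qC P_lip_osc \<open>GCP S p K\<close>)+
  obtain \<mu> A \<gamma> where \<mu>: "stationary_measure S p K \<mu>" and unique: "\<forall>\<nu>. stationary_measure S p K \<nu> \<longrightarrow> \<nu> = \<mu>"
    and "0 < A" "0 < \<gamma>"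
    and mixing: "\<forall>f L w n U. lip_osc f L w \<longrightarrow> \<bar>(P ^^ n) f U - (\<integral>x. f x \<partial>\<mu>)\<bar> \<le> A * (w + L) * exp (- \<gamma> * real n)"
    using exists_mixing_stationary_measure by (elim exE conjE) (rule that; assumption)
  \<comment> \<open>The 3 is \<open>w + L\<close> for test functions of oscillation at most 2 and
    Lipschitz constant 1.\<close>
  have one_time: "dual_lip_dist dist (Pk S p K k U) \<mu> \<le> A * 3 * exp (- \<gamma> * real k)" for U k
  proof (rule dual_lip_dist_le)
    have space: "space (Pk S p K k U) = UNIV"
      using sets_eq_imp_space_eq[of "Pk S p K k U" borel] Pk_prob[of k U] by (simp add: space_prob_algebra)
    fix f :: "'x \<Rightarrow> real"
    assume bound: "\<forall>x\<in>space (Pk S p K k U). \<bar>f x\<bar> \<le> 1"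
      and lip: "\<forall>x\<in>space (Pk S p K k U). \<forall>y\<in>space (Pk S p K k U). \<bar>f x - f y\<bar> \<le> dist x y"
    have "\<bar>f x - f y\<bar> \<le> 2" for x y
    proof -
      have "\<bar>f x\<bar> \<le> 1" "\<bar>f y\<bar> \<le> 1" using bound space by auto
      then show ?thesis by linarith
    qed
    then have f: "lip_osc f 1 2" using lip space by (simp add: lip_osc_def)
    show "\<bar>(\<integral>x. f x \<partial>Pk S p K k U) - (\<integral>x. f x \<partial>\<mu>)\<bar> \<le> A * 3 * exp (- \<gamma> * real k)"
      using mixing[rule_format, OF f, of k U] by (simp add: integral_Pk[OF lip_osc_lips[OF f]])
  qed simp
  \<comment> \<open>Both segment laws are reduced to integrals of the same function of the first
    entry, which has the law of the chain at time \<open>k\<close> in one case and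
    \<open>\<mu>\<close> in the other. This function has oscillation at most 2 and Lipschitz
    constant \<open>G\<close>, so the one-time estimate applies with the same
    \<open>\<gamma>\<close>.\<close>
  have segments: "\<exists>Cs>0. \<forall>(M :: 'w measure) \<zeta> U k. random_fields M p K \<zeta> (\<lambda>_. U) \<longrightarrow>
      dual_lip_dist (sum_dist (s + 1)) (segment_law M (trajectory S \<zeta> (\<lambda>_. U)) k (s + 1))
        (segment_law N (trajectory S \<zeta>' V0) 1 (s + 1)) \<le> Cs * exp (- \<gamma> * real k)"
    if N: "random_fields N p K \<zeta>' V0" and law: "\<forall>k. distr N borel (trajectory S \<zeta>' V0 k) = \<mu>"
    for N :: "'v measure" and \<zeta>' V0 s
  proof -
    obtain G where "0 \<le> G" and G: "\<forall>f. (\<forall>x y. \<bar>f x - f y\<bar> \<le> 1 * sum_dist (Suc s) x y) \<and> (\<forall>x. \<bar>f x\<bar> \<le> 1) \<longrightarrow>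
        lip_osc (reduce s f) G (2 * 1)"
      using reduce_lip_osc[of 1 1 s] by auto
    have "dual_lip_dist (sum_dist (s + 1)) (segment_law M (trajectory S \<zeta> (\<lambda>_. U)) k (s + 1))
        (segment_law N (trajectory S \<zeta>' V0) 1 (s + 1)) \<le> A * (2 + G) * exp (- \<gamma> * real k)"
      if M: "random_fields M p K \<zeta> (\<lambda>_. U)" for M :: "'w measure" and \<zeta> U k
      unfolding Suc_eq_plus1[symmetric]
    proof (rule dual_lip_dist_le)
      let ?\<mu> = "segment_law M (trajectory S \<zeta> (\<lambda>_. U)) k (Suc s)"
      fix f :: "(nat \<Rightarrow> 'x) \<Rightarrow> real"
      assume bound: "\<forall>x\<in>space ?\<mu>. \<bar>f x\<bar> \<le> 1"
        and lip: "\<forall>x\<in>space ?\<mu>. \<forall>y\<in>space ?\<mu>. \<bar>f x - f y\<bar> \<le> sum_dist (Suc s) x y"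
      let ?f = "\<lambda>x. f (restrict x {..<Suc s})"
      have R: "restrict x {..<Suc s} \<in> space ?\<mu>" for x
        by (auto simp: segment_law_def space_PiM)
      have f1: "\<bar>?f x - ?f y\<bar> \<le> 1 * sum_dist (Suc s) x y" for x y
      proof -
        have "sum_dist (Suc s) (restrict x {..<Suc s}) (restrict y {..<Suc s}) = sum_dist (Suc s) x y"
          by (rule sum_dist_cong) simp
        then show ?thesis using lip R by (metis mult_1)
      qed
      have f2: "\<bar>?f x\<bar> \<le> 1" for x using bound R by blast
      have g: "lip_osc (reduce s ?f) G 2" using G f1 f2 by simp
      have "trajectory S \<zeta>' V0 1 \<in> N \<rightarrow>\<^sub>M borel"
        by (rule markov_step(2)[OF N zero_less_Suc, of "\<lambda>_. 0" 0 0 0]) auto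
      then have V1: "(\<integral>x. reduce s ?f x \<partial>distr N borel (trajectory S \<zeta>' V0 1)) =
          (\<integral>\<omega>. reduce s ?f (trajectory S \<zeta>' V0 1 \<omega>) \<partial>N)"
        by (intro integral_distr lips_measurable[OF lip_osc_lips[OF g]])
      have "(\<integral>x. f x \<partial>segment_law N (trajectory S \<zeta>' V0) 1 (Suc s)) = (\<integral>x. reduce s ?f x \<partial>\<mu>)"
        unfolding V1[unfolded law[rule_format]] by (rule integral_segment_law[OF N f1 f2 zero_le_one])
      moreover have "(\<integral>x. f x \<partial>?\<mu>) = (P ^^ k) (reduce s ?f) U"
        unfolding integral_trajectory[OF M g, of k, symmetric]
        by (rule integral_segment_law[OF M f1 f2 zero_le_one])
      ultimately show "\<bar>(\<integral>x. f x \<partial>?\<mu>) - (\<integral>x. f x \<partial>segment_law N (trajectory S \<zeta>' V0) 1 (Suc s))\<bar> \<le>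
          A * (2 + G) * exp (- \<gamma> * real k)"
        using mixing[rule_format, OF g, of k U] by simp
    qed simp
    moreover have "0 < A * (2 + G)" using \<open>0 < A\<close> \<open>0 \<le> G\<close> by simp
    ultimately show ?thesis by blast
  qed
  show ?thesis
  proof (intro exI[of _ \<mu>] conjI \<mu> unique)
    show "\<exists>C>0. \<exists>\<gamma>>0.
      (\<forall>U k. dual_lip_dist dist (Pk S p K k U) \<mu> \<le> C * exp (- \<gamma> * real k)) \<and>
      (\<forall>(N :: 'v measure) \<zeta>' V0.
         random_fields N p K \<zeta>' V0 \<and> (\<forall>k. distr N borel (trajectory S \<zeta>' V0 k) = \<mu>) \<longrightarrow>
         (\<forall>s\<ge>1. \<exists>C\<^sub>s>0. \<forall>(M :: 'w measure) \<zeta> U k.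
            random_fields M p K \<zeta> (\<lambda>_. U) \<longrightarrow>
            dual_lip_dist (sum_dist (s + 1))
              (segment_law M (trajectory S \<zeta> (\<lambda>_. U)) k (s + 1))
              (segment_law N (trajectory S \<zeta>' V0) 1 (s + 1))
            \<le> C\<^sub>s * exp (- \<gamma> * real k)))"
    proof (rule exI[of _ "A * 3"], intro conjI, simp add: \<open>0 < A\<close>, rule exI[of _ \<gamma>], intro conjI allI impI)
      show "0 < \<gamma>" by fact
    qed (use one_time segments in blast)+
  qed
qed

end
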